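(* Assume the Riemann hypothesis. Let $\kappa>0$ and $c>0$ be constants, let $k=+1$, and put $R(t)=|Z(t)|$. For $t>0$ with $Z(t)\ne0$ define $\rho(t)$ and $p(t)$ by the Friedmann equations $$\kappa c^2\rho=\frac{3}{R^2}\left(kc^2+R'^2\right),\qquad \kappa p=-\frac{2R''}{R}-\frac{R'^2}{R^2}-\frac{kc^2}{R^2}.$$ Then there exist a sequence $\{\tilde t_0\}$ of positive real numbers with $\tilde t_0\to+\infty$ and $Z'(\tilde t_0)=0$, each lying strictly between two neighboring ordinates $0<\tilde\gamma'<\tilde\gamma''$ of zeros of $\zeta$ on the critical line, and numbers $\delta(\tilde t_0)>0$ such that $$\tilde\gamma'<\tilde t_0-\delta(\tilde t_0)<\tilde t_0+\delta(\tilde t_0)<\tilde\gamma''$$ and $$\rho(t)>0,\quad p(t)\ge 0\qquad\text{for all } t\in[\tilde t_0-\delta(\tilde t_0),\ \tilde t_0+\delta(\tilde t_0)].$$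
   Context: $\zeta$ is the Riemann zeta function. For real $t>0$, $Z(t)=e^{i\vartheta(t)}\zeta(\tfrac12+it)$, where $\vartheta(t)=\operatorname{Im}\log\Gamma(\tfrac14+\tfrac{it}{2})-\tfrac{t}{2}\ln\pi$ is the Riemann–Siegel theta function (continuous branch with $\vartheta(0)=0$); $Z$ is real-valued and smooth. Primes on functions denote derivatives with respect to $t$. Neighboring ordinates $\gamma'<\gamma''$ means that $\tfrac12+i\gamma'$ and $\tfrac12+i\gamma''$ are zeros of $\zeta$ and there is no zero $\tfrac12+i\gamma$ of $\zeta$ with $\gamma'<\gamma<\gamma''$. (Physically, $\kappa$ is the gravitational constant, $c$ the speed of light, $\rho$ the mass density, $p$ the pressure and $R$ the radius of the Universe.) *)

theory Defs
  imports "HOL-Complex_Analysis.Complex_Analysis"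
begin

text \<open>
  The Riemann zeta function is the analytic continuation to the plane without the point 1 of the
  Dirichlet series. The continuation is unique by the identity theorem; only the value at the
  pole 1 is arbitrary, and it is fixed to be 0.
\<close>

definition is_zeta :: "(complex \<Rightarrow> complex) \<Rightarrow> bool" where
  "is_zeta f \<longleftrightarrow>
     f holomorphic_on (- {1}) \<and>
     (\<forall>s. Re s > 1 \<longrightarrow> (\<lambda>n. 1 / of_nat (Suc n) powr s) sums f s) \<and>
     f 1 = 0"

definition zeta :: "complex \<Rightarrow> complex" where
  "zeta = (THE f. is_zeta f)"

lemma is_zeta_unique:
  assumes f: "is_zeta f" and g: "is_zeta g"
  shows "f = g"
proof
  fix s :: complex
  show "f s = g s"
  proof (cases "s = 1")
    case True
    then show ?thesis using f g by (simp add: is_zeta_def)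
  next
    case False
    let ?U = "{s. Re s > 1}"
    have U: "open ?U" by (rule open_halfspace_Re_gt)
    have eq: "f z - g z = 0" if "z \<in> ?U" for z
      using f g that sums_unique2 unfolding is_zeta_def by fastforce
    have hol: "(\<lambda>z. f z - g z) holomorphic_on (- {1})"
      using f g unfolding is_zeta_def by (intro holomorphic_intros) auto
    have lim: "2 islimpt ?U"
      using U by (intro interior_limit_point) (simp add: interior_open)
    have con: "connected (- {1 :: complex})"
      by (rule connected_punctured_universe) simp
    have "f s - g s = 0"
      by (rule analytic_continuation[OF hol _ con _ _ lim eq]) (use False in auto)
    then show ?thesis by simp
  qed
qed

definition riemann_hypothesis :: bool where
  "riemann_hypothesis \<longleftrightarrow>
     (\<forall>s. zeta s = 0 \<and> 0 < Re s \<and> Re s < 1 \<longrightarrow> Re s = 1 / 2)"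

text \<open>
  The library function \<^const>\<open>ln_Gamma\<close> is holomorphic on the plane cut along the nonpositive
  reals and real on the positive reals, so its imaginary part is the continuous branch of
  the argument of \<^const>\<open>Gamma\<close> along the line through 1/4 (it is not the principal
  logarithm of \<^const>\<open>Gamma\<close>). The lemmas below record this.
\<close>

definition rs_theta :: "real \<Rightarrow> real" where
  "rs_theta t = Im (ln_Gamma (Complex (1 / 4) (t / 2))) - t / 2 * ln pi"

lemma rs_theta_0: "rs_theta 0 = 0"
proof -
  have "ln_Gamma (complex_of_real (1 / 4)) = of_real (ln_Gamma (1 / 4))"
    by (rule ln_Gamma_complex_of_real) simp
  moreover have "Complex (1 / 4) 0 = complex_of_real (1 / 4)"
    by (simp add: complex_of_real_def)
  ultimately show ?thesis
    unfolding rs_theta_def by (metis Im_complex_of_real diff_zero div_0 mult_zero_left)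
qed

lemma exp_rs_theta:
  "exp (ln_Gamma (Complex (1 / 4) (t / 2))) = Gamma (Complex (1 / 4) (t / 2))"
proof -
  have "Complex (1 / 4) (t / 2) \<notin> \<int>\<^sub>\<le>\<^sub>0"
    by (auto elim!: nonpos_Ints_cases simp: complex_eq_iff)
  then show ?thesis by (simp add: Gamma_complex_altdef)
qed

lemma continuous_on_rs_theta: "continuous_on A rs_theta"
proof -
  have "continuous_on UNIV (\<lambda>t. ln_Gamma (Complex (1 / 4) (t / 2)))"
  proof (rule continuous_on_compose2[of "- \<real>\<^sub>\<le>\<^sub>0" ln_Gamma])
    show "continuous_on (- \<real>\<^sub>\<le>\<^sub>0) (ln_Gamma :: complex \<Rightarrow> complex)"
      by (intro holomorphic_on_imp_continuous_on holomorphic_ln_Gamma) auto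
    show "continuous_on UNIV (\<lambda>t. Complex (1 / 4) (t / 2))"
      by (simp add: Complex_eq) (intro continuous_intros, auto)
  qed (auto elim!: nonpos_Reals_cases simp: complex_eq_iff)
  then have "continuous_on UNIV rs_theta"
    unfolding rs_theta_def by (intro continuous_intros) auto
  then show ?thesis by (rule continuous_on_subset) simp
qed

text \<open>
  The function Z is kept complex-valued as it is written in its defining formula; that its values
  are real is a consequence of the functional equation of \<^const>\<open>zeta\<close>.
\<close>

definition hardy_Z :: "real \<Rightarrow> complex" where
  "hardy_Z t = exp (\<i> * complex_of_real (rs_theta t)) * zeta (Complex (1 / 2) t)"

definition radius :: "real \<Rightarrow> real" where
  "radius t = cmod (hardy_Z t)"

definition neighboring_ordinates :: "real \<Rightarrow> real \<Rightarrow> bool" where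
  "neighboring_ordinates a b \<longleftrightarrow>
     a < b \<and> zeta (Complex (1 / 2) a) = 0 \<and> zeta (Complex (1 / 2) b) = 0 \<and>
     \<not> (\<exists>x. a < x \<and> x < b \<and> zeta (Complex (1 / 2) x) = 0)"

end

theory Submission
  imports Defs "HOL-Real_Asymp.Real_Asymp"
begin

text \<open>
  Write \<open>q = R\<^sup>2\<close>, so that \<open>q t = \<bar>zeta (1/2 + i t)\<bar>\<^sup>2\<close>. Then
  \<open>\<kappa> p q = - q'' + q'\<^sup>2 / (4 q) - c\<^sup>2\<close>, so it suffices to find maxima of \<open>q\<close>, between neighbouring zeros and
  arbitrarily high up, at which \<open>- q''\<close> exceeds \<open>c\<^sup>2\<close>. By the maximum principle \<open>q\<close> does not tend to 0. Hence
  there are high \<open>t\<close> with \<open>q t \<ge> d\<^sup>2 > 0\<close>, and the maximum of \<open>q\<close> between the zeros surrounding \<open>t\<close> is at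
  least \<open>d\<^sup>2\<close>. Under the Riemann hypothesis \<open>- (ln q)''\<close> is essentially the sum of \<open>2 / (t - \<gamma>)\<^sup>2\<close> over the zero
  ordinates \<open>\<gamma>\<close>. A finite version of the Hadamard product in a disc of large fixed radius about \<open>t\<close> bounds the
  growth of the holomorphic extension of \<open>q\<close> in the imaginary direction in terms of this sum. The
  functional equation makes that growth at least a power of \<open>t\<close>, so the sum is at least a constant
  times \<open>ln t\<close>. The same comparison shows that there are zeros near \<open>t\<close> at all.
\<close>

section \<open>Growth of a holomorphic function with real zeros\<close>

text \<open>A disc of fixed radius N suffices because of how the error scales. On the circle of
  radius N the logarithm of the growth is about (N + 4) ln t, and Borel-Caratheodory followed by
  Cauchy's inequality divides this by N^2. The part of the second logarithmic derivative that is not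
  due to zeros thus costs about ln t / N, while the functional equation forces a fixed multiple of
  ln t. Crude bounds are then affordable: zeta = O(t^2) on the critical line is enough, provided
  that the comparison is made far enough away, at distance 6. The Riemann hypothesis enters through
  signs: for a real zero a the same quantity 1 / a^2 bounds the growth along the imaginary axis and
  measures the concavity along the real axis. The lower bound d for zeta is used twice, to normalise
  the growth by the value at the centre and to pass from a large - q'' / q to a large - q''. Since
  zeta is specified only by its characteristic properties, its continuation and functional equation
  are obtained first, from the error of the trapezoid rule for x^(-s).\<close>

lemma Borel_Caratheodory:
  assumes g: "g holomorphic_on ball 0 R" and R: "R > 0" and g0: "g 0 = 0"
    and Re: "\<And>z. z \<in> ball 0 R \<Longrightarrow> Re (g z) < M" and z: "norm z \<le> R / 2"
  shows "norm (g z) \<le> 2 * M"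
proof -
  have M: "M > 0" using Re[of 0] g0 R by simp
  \<comment> \<open>The map w / (2 M - w) carries the half-plane Re w < M into the unit disc and
    fixes 0, so Schwarz's lemma applies. At half the radius it gives |g| \<le> |2 M - g| / 2, which
    is then solved for |g|.\<close>
  define \<phi> where "\<phi> = (\<lambda>w. g (of_real R * w) / (2 * of_real M - g (of_real R * w)))"
  have in_ball: "of_real R * w \<in> ball 0 R" if "norm w < 1" for w :: complex
    using that R by (simp add: norm_mult)
  have less: "norm (g w) < norm (2 * of_real M - g w)" if "w \<in> ball 0 R" for w
  proof -
    have "(norm (g w))\<^sup>2 < (norm (2 * of_real M - g w))\<^sup>2"
      unfolding cmod_power2 using Re[OF that] M by (simp add: power2_eq_square algebra_simps)
    then show ?thesis by (rule power_less_imp_less_base) simp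
  qed
  have nz: "2 * of_real M - g w \<noteq> 0" if "w \<in> ball 0 R" for w
    using less[OF that] by auto
  have holR: "(\<lambda>w. g (of_real R * w)) holomorphic_on ball 0 1"
    by (rule holomorphic_on_compose_gen[OF _ g, unfolded o_def])
      (auto intro!: holomorphic_intros in_ball)
  have hol: "\<phi> holomorphic_on ball 0 1"
    unfolding \<phi>_def using nz in_ball by (intro holomorphic_intros holR) auto
  have lt: "norm (\<phi> w) < 1" if "norm w < 1" for w
    using less[OF in_ball[OF that]] unfolding \<phi>_def by (simp add: norm_divide divide_less_eq)
  have "norm (z / of_real R) < 1" using z R by (simp add: norm_divide)
  from Schwarz_Lemma(1)[OF hol _ lt this] g0
  have "norm (\<phi> (z / of_real R)) \<le> norm (z / of_real R)" by (simp add: \<phi>_def)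
  also have "\<dots> \<le> 1 / 2" using z R by (simp add: norm_divide divide_simps)
  finally have *: "norm (g z / (2 * of_real M - g z)) \<le> 1 / 2" using R by (simp add: \<phi>_def)
  have zb: "z \<in> ball 0 R" using z R by auto
  have "norm (g z) \<le> 1 / 2 * norm (2 * of_real M - g z)"
    using * nz[OF zb] by (simp add: norm_divide divide_simps split: if_splits)
  also have "\<dots> \<le> 1 / 2 * (2 * M + norm (g z))"
    using norm_triangle_ineq4[of "2 * of_real M" "g z"] M by (simp add: norm_mult)
  finally show ?thesis by simp
qed

text \<open>Zeros are split off through 1 - z / a rather than z - a, so that the cofactor keeps the
  value of \<open>f\<close> at 0, the point by which all later bounds are normalised. With
  \<open>n\<close> the full order of the zero, the quotient extends over \<open>a\<close> without
  vanishing there.\<close>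

lemma holomorphic_factor_zero:
  fixes f :: "complex \<Rightarrow> complex"
  assumes f: "f holomorphic_on S" and S: "open S" "connected S" and a: "a \<in> S" "f a = 0" "a \<noteq> 0"
    and b: "b \<in> S" "f b \<noteq> 0"
  obtains n g where "g holomorphic_on S" "g a \<noteq> 0" "\<And>z. z \<in> S \<Longrightarrow> f z = (1 - z / a) ^ n * g z"
proof -
  define n where "n = nat (zorder f a)"
  define h where "h = zor_poly f a"
  have "\<exists>w\<in>S. f w \<noteq> 0" using b by blast
  from zorder_exist_zero[OF f S a(1) this] a(2) have "zorder f a > 0"
    and "\<exists>r>0. cball a r \<subseteq> S \<and> h holomorphic_on cball a r \<and> (\<forall>w\<in>cball a r. f w = h w * (w - a) ^ n \<and> h w \<noteq> 0)"
    unfolding n_def h_def by simp_all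
  then obtain r where r: "0 < r" "cball a r \<subseteq> S" "h holomorphic_on cball a r"
    and eq: "\<And>w. w \<in> cball a r \<Longrightarrow> f w = h w * (w - a) ^ n \<and> h w \<noteq> 0" and "zorder f a > 0"
    by blast
  then have n: "n > 0" by (simp add: n_def)
  define g where "g = (\<lambda>z. if z = a then h a * (- a) ^ n else f z / (1 - z / a) ^ n)"
  have [simp]: "1 - z / a \<noteq> 0" if "z \<noteq> a" for z using that a(3) by (simp add: divide_simps)
  have e: "(1 - z / a) ^ n * (- a) ^ n = (z - a) ^ n" for z
    using a(3) by (subst power_mult_distrib[symmetric]) (simp add: algebra_simps)
  have g1: "g holomorphic_on S - {a}"
  proof (rule holomorphic_transform[of "\<lambda>z. f z / (1 - z / a) ^ n"])
    show "(\<lambda>z. f z / (1 - z / a) ^ n) holomorphic_on S - {a}"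
      using a(3) by (intro holomorphic_intros holomorphic_on_subset[OF f]) auto
  qed (auto simp: g_def)
  have g2: "g holomorphic_on ball a r"
  proof (rule holomorphic_transform[of "\<lambda>z. h z * (- a) ^ n"])
    show "(\<lambda>z. h z * (- a) ^ n) holomorphic_on ball a r"
      by (intro holomorphic_intros holomorphic_on_subset[OF r(3)]) auto
    fix z assume z: "z \<in> ball a r"
    show "h z * (- a) ^ n = g z"
    proof (cases "z = a")
      case False
      have "g z = h z * ((1 - z / a) ^ n * (- a) ^ n) / (1 - z / a) ^ n"
        using eq[of z] z False unfolding g_def e by auto
      then show ?thesis using False by simp
    qed (simp add: g_def)
  qed
  have "g holomorphic_on (S - {a}) \<union> ball a r"
    by (rule holomorphic_on_Un[OF g1 g2]) (use S in auto)
  moreover have "(S - {a}) \<union> ball a r = S" using r a by auto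
  ultimately have "g holomorphic_on S" by simp
  moreover have "g a \<noteq> 0" using eq[of a] r a(3) by (simp add: g_def)
  moreover have "f z = (1 - z / a) ^ n * g z" if "z \<in> S" for z
    using that a n by (auto simp: g_def)
  ultimately show ?thesis by (rule that)
qed

text \<open>Induction on the number of distinct zeros in \<open>K\<close>: each step removes one of
  them with its whole multiplicity, which the list \<open>as\<close> records by repetition. The
  cofactor may still vanish on \<open>S\<close> outside \<open>K\<close>.\<close>

lemma holomorphic_factor_zeros:
  fixes f :: "complex \<Rightarrow> complex"
  assumes f: "f holomorphic_on S" and S: "open S" "connected S" "0 \<in> S" and f0: "f 0 \<noteq> 0"
    and K: "compact K" "K \<subseteq> S"
  obtains as g where "set as \<subseteq> {z \<in> K. f z = 0}" "g holomorphic_on S"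
    "\<And>z. z \<in> K \<Longrightarrow> g z \<noteq> 0" "\<And>z. z \<in> S \<Longrightarrow> f z = (\<Prod>a\<leftarrow>as. 1 - z / a) * g z"
proof -
  have fin: "finite {z \<in> K. f z = 0}"
    if "f holomorphic_on S" "f 0 \<noteq> 0" "\<exists>z\<in>S. f z = 0" for f :: "complex \<Rightarrow> complex"
    using that S K by (intro holomorphic_compact_finite_zeros[OF that(1)])
      (force simp: constant_on_def)+
  have "\<exists>as g. set as \<subseteq> {z \<in> K. f z = 0} \<and> g holomorphic_on S \<and> (\<forall>z\<in>K. g z \<noteq> 0) \<and>
          (\<forall>z\<in>S. f z = (\<Prod>a\<leftarrow>as. 1 - z / a) * g z)"
    using f f0
  proof (induction "card {z \<in> K. f z = 0}" arbitrary: f rule: less_induct)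
    case (less f)
    show ?case
    proof (cases "\<exists>a\<in>K. f a = 0")
      case False
      then show ?thesis using less.prems by (intro exI[of _ "[]"] exI[of _ f]) auto
    next
      case True
      then obtain a where a: "a \<in> K" "f a = 0" by blast
      then have "a \<in> S" "a \<noteq> 0" using K less.prems by auto
      then obtain n g where g: "g holomorphic_on S" "g a \<noteq> 0"
        and eq: "\<And>z. z \<in> S \<Longrightarrow> f z = (1 - z / a) ^ n * g z"
        using holomorphic_factor_zero[OF less.prems(1) S(1,2) _ a(2) _ S(3) less.prems(2)] by metis
      have g0: "g 0 \<noteq> 0" using eq[of 0] S less.prems by auto
      have sub: "{z \<in> K. g z = 0} \<subset> {z \<in> K. f z = 0}"
        using eq K a g(2) by auto
      have "finite {z \<in> K. f z = 0}" using fin[OF less.prems] a \<open>a \<in> S\<close> by blast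
      from less.hyps[OF psubset_card_mono[OF this sub] g(1) g0]
      obtain as h where h: "set as \<subseteq> {z \<in> K. g z = 0}" "h holomorphic_on S" "\<forall>z\<in>K. h z \<noteq> 0"
        "\<forall>z\<in>S. g z = (\<Prod>a\<leftarrow>as. 1 - z / a) * h z" by blast
      show ?thesis
        using h sub a eq by (intro exI[of _ "replicate n a @ as"] exI[of _ h]) (auto simp: prod_list_replicate)
    qed
  qed
  then show ?thesis using that by blast
qed

lemma deriv_prod_list_linear:
  fixes z :: complex
  assumes "0 \<notin> set as" "z \<notin> set as"
  shows "((\<lambda>z. \<Prod>a\<leftarrow>as. 1 - z / a) has_field_derivative
           (\<Prod>a\<leftarrow>as. 1 - z / a) * (\<Sum>a\<leftarrow>as. 1 / (z - a))) (at z)"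
  using assms
proof (induction as)
  case (Cons a as)
  have "((\<lambda>z. (1 - z / a) * (\<Prod>a\<leftarrow>as. 1 - z / a)) has_field_derivative
     (- 1 / a) * (\<Prod>a\<leftarrow>as. 1 - z / a) + (1 - z / a) * ((\<Prod>a\<leftarrow>as. 1 - z / a) * (\<Sum>a\<leftarrow>as. 1 / (z - a)))) (at z)"
    using Cons by (auto intro!: derivative_eq_intros)
  moreover have e: "- 1 / a = (1 - z / a) * (1 / (z - a))"
    using Cons.prems by (auto simp: divide_simps)
  have "(- 1 / a) * (\<Prod>a\<leftarrow>as. 1 - z / a) + (1 - z / a) * ((\<Prod>a\<leftarrow>as. 1 - z / a) * (\<Sum>a\<leftarrow>as. 1 / (z - a)))
      = (\<Prod>a\<leftarrow>a # as. 1 - z / a) * (\<Sum>a\<leftarrow>a # as. 1 / (z - a))"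
    unfolding e by (simp only: list.map prod_list.Cons sum_list.Cons distrib_left mult_ac)
  ultimately show ?case by simp
qed simp

lemma deriv_sum_list_inverse:
  fixes as :: "complex list"
  assumes "0 \<notin> set as"
  shows "((\<lambda>z. \<Sum>a\<leftarrow>as. 1 / (z - a)) has_field_derivative - (\<Sum>a\<leftarrow>as. 1 / a\<^sup>2)) (at 0)"
  using assms
  by (induction as) (auto intro!: derivative_eq_intros simp: power2_eq_square)

text \<open>The sum with the reflected function has derivative 0 at the origin, so two mean value
  estimates leave a quadratic bound. Without this cancellation the linear term of \<open>g\<close>
  would give an error of first order in y / r, which is too large.\<close>

lemma norm_even_part_le:
  assumes g: "g holomorphic_on ball 0 R" and B: "\<And>z. norm z < R \<Longrightarrow> norm (deriv (deriv g) z) \<le> B"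
    and g0: "g 0 = 0" and z: "norm z < R"
  shows "norm (g z + g (- z)) \<le> 2 * B * (norm z)\<^sup>2"
proof -
  have B0: "B \<ge> 0" using B[of 0] z by (metis norm_ge_zero norm_zero order_trans order_le_less_trans)
  have d: "(g has_field_derivative deriv g w) (at w)" if "norm w < R" for w
    using that by (intro holomorphic_derivI[OF g]) auto
  have d2: "(deriv g has_field_derivative deriv (deriv g) w) (at w)" if "norm w < R" for w
    using that by (intro holomorphic_derivI[OF holomorphic_deriv[OF g]]) auto
  have neg: "((\<lambda>w. h (- w)) has_field_derivative - h') (at w)"
    if "(h has_field_derivative h') (at (- w))" for h h' and w :: complex
    using DERIV_chain2[OF that DERIV_minus[OF DERIV_ident]] by simp
  have 1: "((\<lambda>w. deriv g w - deriv g (- w)) has_field_derivative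
             deriv (deriv g) w + deriv (deriv g) (- w)) (at w)" if "norm w < R" for w
    using DERIV_diff[OF d2[OF that] neg[OF d2]] that by simp
  have 2: "((\<lambda>w. g w + g (- w)) has_field_derivative deriv g w - deriv g (- w)) (at w)"
    if "norm w < R" for w
    using DERIV_add[OF d[OF that] neg[OF d]] that by simp
  have 3: "norm (deriv g w - deriv g (- w)) \<le> 2 * B * norm z" if w: "norm w \<le> norm z" for w
  proof -
    have "norm ((deriv g w - deriv g (- w)) - (deriv g 0 - deriv g (- 0))) \<le> (2 * B) * norm (w - 0)"
    proof (rule field_differentiable_bound[where S = "cball 0 (norm z)"])
      fix u :: complex assume u: "u \<in> cball 0 (norm z)"
      then have u: "norm u < R" using z by auto
      show "((\<lambda>w. deriv g w - deriv g (- w)) has_field_derivative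
             deriv (deriv g) u + deriv (deriv g) (- u)) (at u within cball 0 (norm z))"
        by (rule has_field_derivative_at_within[OF 1[OF u]])
      have "norm (deriv (deriv g) u + deriv (deriv g) (- u)) \<le> B + B"
        using u by (intro norm_triangle_mono B) auto
      then show "norm (deriv (deriv g) u + deriv (deriv g) (- u)) \<le> 2 * B" by simp
    qed (use w in auto)
    also have "\<dots> \<le> 2 * B * norm z" using w B0 by (simp add: mult_left_mono)
    finally show ?thesis by simp
  qed
  have "norm ((g z + g (- z)) - (g 0 + g (- 0))) \<le> (2 * B * norm z) * norm (z - 0)"
  proof (rule field_differentiable_bound[where S = "cball 0 (norm z)"])
    fix u :: complex assume u: "u \<in> cball 0 (norm z)"
    then have "norm u < R" using z by auto
    from has_field_derivative_at_within[OF 2[OF this]]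
    show "((\<lambda>w. g w + g (- w)) has_field_derivative deriv g u - deriv g (- u)) (at u within cball 0 (norm z))" .
    show "norm (deriv g u - deriv g (- u)) \<le> 2 * B * norm z" using 3 u by auto
  qed auto
  then show ?thesis using g0 by (simp add: power2_eq_square)
qed

lemma norm_one_minus_ge:
  fixes z a :: complex
  assumes "norm a \<le> r / 2" "norm z = r" "a \<noteq> 0"
  shows "1 \<le> norm (1 - z / a)"
proof -
  have "2 \<le> norm z / norm a" using assms by (simp add: field_simps)
  also have "\<dots> = norm (z / a)" by (simp add: norm_divide)
  also have "\<dots> \<le> norm (1 - z / a) + norm (1::complex)"
    using norm_triangle_ineq4[of 1 "1 - z / a"] by simp
  finally show ?thesis by simp
qed

text \<open>
  In the factorisation \<open>f z = f 0 * (\<Prod>a. 1 - z / a) * exp (g z)\<close> over the zeros \<open>a\<close> of modulus at most \<open>r / 2\<close>,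
  each real zero contributes the factor \<open>1 + y\<^sup>2 / a\<^sup>2 \<le> exp (y\<^sup>2 / a\<^sup>2)\<close> to \<open>f (\<i> y) f (- \<i> y)\<close> and
  \<open>- 1 / a\<^sup>2\<close> to the second logarithmic derivative at \<open>0\<close>; the contribution of \<open>g\<close> to both is controlled
  by Borel-Caratheodory.
\<close>

lemma real_zeros_growth:
  fixes f :: "complex \<Rightarrow> complex"
  assumes f: "f holomorphic_on ball 0 R" and r: "0 < r" "r < R" and f0: "f 0 \<noteq> 0" and M: "M > 0"
    and bound: "\<And>z. norm z = r \<Longrightarrow> norm (f z) \<le> norm (f 0) * exp M"
    and zeros: "\<And>z. norm z \<le> r / 2 \<Longrightarrow> f z = 0 \<Longrightarrow> z \<in> \<real>"
    and y: "0 < y" "y < r / 8"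
  obtains S :: real where "S \<ge> 0" "(\<And>z. norm z \<le> r / 2 \<Longrightarrow> f z \<noteq> 0) \<Longrightarrow> S = 0"
    "norm (f (\<i> * of_real y) * f (- (\<i> * of_real y))) \<le> (norm (f 0))\<^sup>2 * exp (y\<^sup>2 * (S + 1024 * M / r\<^sup>2))"
    "norm (deriv (deriv f) 0 / f 0 - (deriv f 0 / f 0)\<^sup>2 + of_real S) \<le> 1024 * M / r\<^sup>2"
proof -
  have "0 \<in> ball (0::complex) R" "cball (0::complex) (r / 2) \<subseteq> ball 0 R" using r by auto
  note factor = holomorphic_factor_zeros[OF f open_ball connected_ball this(1) f0 compact_cball this(2)]
  obtain as G where as: "set as \<subseteq> {z \<in> cball 0 (r / 2). f z = 0}"
    and G: "G holomorphic_on ball 0 R" "\<And>z. z \<in> cball 0 (r / 2) \<Longrightarrow> G z \<noteq> 0"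
    and fG: "\<And>z. z \<in> ball 0 R \<Longrightarrow> f z = (\<Prod>a\<leftarrow>as. 1 - z / a) * G z"
    using factor by blast
  have as0: "0 \<notin> set as" using as f0 by auto
  have asR: "a \<in> \<real>" if "a \<in> set as" for a using as zeros that by auto
  have P0: "(\<Prod>a\<leftarrow>as. 1 - 0 / a) = (1::complex)" by (induction as) auto
  have G0: "G 0 = f 0" using fG[of 0] r P0 by simp
  \<comment> \<open>On the circle of radius \<open>r\<close> every factor split off has modulus at
    least 1, so \<open>G\<close> inherits the bound for \<open>f\<close> there, and the maximum
    principle carries it inside.\<close>
  have GM: "norm (G z) \<le> norm (f 0) * exp M" if z: "z \<in> cball 0 r" for z
  proof (rule maximum_modulus_frontier[of G "cball 0 r"])
    show "G holomorphic_on interior (cball 0 r)"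
      by (rule holomorphic_on_subset[OF G(1)]) (use r in auto)
    show "continuous_on (closure (cball 0 r)) G"
      by (intro holomorphic_on_imp_continuous_on holomorphic_on_subset[OF G(1)]) (use r in auto)
    fix w :: complex assume "w \<in> frontier (cball 0 r)"
    then have w: "norm w = r" by (simp add: dist_norm)
    have "1 \<le> norm (\<Prod>a\<leftarrow>as. 1 - w / a)"
      using as as0
    proof (induction as)
      case (Cons a as)
      then have "1 \<le> norm (1 - w / a)" by (intro norm_one_minus_ge[of a r w] w) auto
      moreover have "1 \<le> norm (\<Prod>a\<leftarrow>as. 1 - w / a)" using Cons by auto
      ultimately show ?case using mult_mono[of 1 "norm (1 - w / a)" 1 "norm (\<Prod>a\<leftarrow>as. 1 - w / a)"] by (simp add: norm_mult)
    qed simp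
    then have "norm (G w) \<le> norm (f w)"
      using fG[of w] w r by (simp add: norm_mult mult_le_cancel_right1)
    then show "norm (G w) \<le> norm (f 0) * exp M" using bound[OF w] by simp
  qed (use z in auto)
  have "\<exists>l. l holomorphic_on ball 0 (r / 2) \<and> (\<forall>x\<in>ball 0 (r / 2). exp (l x) = G x)"
  proof (rule holomorphic_logarithm_exists[of "ball 0 (r / 2)" G 0])
    show "G x \<noteq> 0" if "x \<in> ball 0 (r / 2)" for x using G(2)[of x] that by auto
  qed (use r in \<open>auto intro: holomorphic_on_subset[OF G(1)]\<close>)
  then obtain l where l: "l holomorphic_on ball 0 (r / 2)" "\<And>x. x \<in> ball 0 (r / 2) \<Longrightarrow> exp (l x) = G x"
    by blast
  define g where "g = (\<lambda>z. l z - l 0)"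
  have g: "g holomorphic_on ball 0 (r / 2)" unfolding g_def by (intro holomorphic_intros l)
  have g0: "g 0 = 0" by (simp add: g_def)
  have fg: "f z = f 0 * (\<Prod>a\<leftarrow>as. 1 - z / a) * exp (g z)" if "z \<in> ball 0 (r / 2)" for z
    using fG[of z] that r l(2)[of z] l(2)[of 0] G0 by (auto simp: g_def exp_diff)
  \<comment> \<open>The factor 2 only makes the bound strict, as \<open>Borel_Caratheodory\<close>
    requires.\<close>
  have Reg: "Re (g z) < 2 * M" if z: "z \<in> ball 0 (r / 2)" for z
  proof -
    have "norm (f 0) * exp (Re (g z)) = norm (G z)"
      using l(2)[of z] l(2)[of 0] G0 z r f0 by (simp add: g_def exp_diff norm_divide flip: norm_exp_eq_Re)
    also have "\<dots> \<le> norm (f 0) * exp M" using GM[of z] z r by auto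
    finally have "Re (g z) \<le> M" using f0 by simp
    then show ?thesis using M by simp
  qed
  have g4: "norm (g z) \<le> 4 * M" if "norm z \<le> r / 4" for z
    using Borel_Caratheodory[OF g _ g0 Reg, of z] that r by simp
  \<comment> \<open>Cauchy's inequality for the second derivative on circles of radius r / 8, where
    |g| \<le> 4 M, gives 2 * 4 M / (r / 8)^2 = 512 M / r^2. The 1024 in the conclusion is 2 B, from
    the even part.\<close>
  define B where "B = 512 * M / r\<^sup>2"
  have B0: "B \<ge> 0" using M by (simp add: B_def)
  have g'': "norm (deriv (deriv g) z) \<le> B" if z: "norm z < r / 8" for z
  proof -
    have sub: "cball z (r / 8) \<subseteq> ball 0 (r / 2)" "\<And>x. x \<in> cball z (r / 8) \<Longrightarrow> norm x \<le> r / 4"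
    proof -
      show *: "norm x \<le> r / 4" if "x \<in> cball z (r / 8)" for x
        using that z norm_triangle_sub[of x z] by (simp add: dist_norm norm_minus_commute)
      show "cball z (r / 8) \<subseteq> ball 0 (r / 2)" using * r by fastforce
    qed
    have "norm ((deriv ^^ 2) g z) \<le> fact 2 * (4 * M) / (r / 8) ^ 2"
    proof (rule Cauchy_inequality)
      show "g holomorphic_on ball z (r / 8)"
        by (rule holomorphic_on_subset[OF g]) (use sub in auto)
      show "continuous_on (cball z (r / 8)) g"
        by (intro holomorphic_on_imp_continuous_on holomorphic_on_subset[OF g] sub)
      show "0 < r / 8" using r by simp
      fix x assume "norm (z - x) = r / 8"
      then show "norm (g x) \<le> 4 * M" using g4 sub(2)[of x] by (simp add: dist_norm)
    qed
    then show ?thesis using r by (simp add: B_def numeral_2_eq_2 power_divide)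
  qed
  define S where "S = (\<Sum>a\<leftarrow>as. 1 / (Re a)\<^sup>2)"
  have S_complex: "of_real S = (\<Sum>a\<leftarrow>as. 1 / a\<^sup>2)"
    unfolding S_def using asR
    by (induction as) (auto elim!: Reals_cases)
  have S0: "S \<ge> 0" unfolding S_def by (intro sum_list_nonneg) auto
  have SS: "S = 0" if "\<And>z. norm z \<le> r / 2 \<Longrightarrow> f z \<noteq> 0"
  proof -
    have "a \<notin> set as" for a using as that[of a] by auto
    then have "as = []" by (metis list.set_intros(1) neq_Nil_conv)
    then show ?thesis by (simp add: S_def)
  qed
  let ?w = "\<i> * complex_of_real y"
  have PP: "norm ((\<Prod>a\<leftarrow>as. 1 - ?w / a) * (\<Prod>a\<leftarrow>as. 1 - (- ?w) / a)) \<le> exp (y\<^sup>2 * S)"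
    unfolding S_def using asR as0
  proof (induction as)
    case (Cons a as)
    obtain x where x: "a = of_real x" using Cons.prems by (auto elim: Reals_cases)
    have "(1 - ?w / a) * (1 - (- ?w) / a) = of_real (1 + y\<^sup>2 / x\<^sup>2)"
      by (simp add: x algebra_simps power2_eq_square)
    then have "norm ((1 - ?w / a) * (1 - (- ?w) / a)) = \<bar>1 + y\<^sup>2 / x\<^sup>2\<bar>" by (simp only: norm_of_real)
    also have "\<dots> = 1 + y\<^sup>2 / x\<^sup>2" by simp
    also have "\<dots> \<le> exp (y\<^sup>2 * (1 / (Re a)\<^sup>2))" using exp_ge_add_one_self[of "y\<^sup>2 / x\<^sup>2"] by (simp add: x)
    finally have 1: "norm ((1 - ?w / a) * (1 - (- ?w) / a)) \<le> exp (y\<^sup>2 * (1 / (Re a)\<^sup>2))" .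
    have 2: "norm ((\<Prod>a\<leftarrow>as. 1 - ?w / a) * (\<Prod>a\<leftarrow>as. 1 - (- ?w) / a)) \<le> exp (y\<^sup>2 * (\<Sum>a\<leftarrow>as. 1 / (Re a)\<^sup>2))"
      using Cons by auto
    have "norm (((1 - ?w / a) * (1 - (- ?w) / a)) * ((\<Prod>a\<leftarrow>as. 1 - ?w / a) * (\<Prod>a\<leftarrow>as. 1 - (- ?w) / a)))
        \<le> exp (y\<^sup>2 * (1 / (Re a)\<^sup>2)) * exp (y\<^sup>2 * (\<Sum>a\<leftarrow>as. 1 / (Re a)\<^sup>2))"
      by (subst norm_mult) (intro mult_mono 1 2; simp)
    also have "\<dots> = exp (y\<^sup>2 * (\<Sum>a\<leftarrow>a # as. 1 / (Re a)\<^sup>2))"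
      by (simp add: algebra_simps flip: exp_add)
    finally show ?case by (simp add: mult_ac)
  qed simp
  have even: "norm (g ?w + g (- ?w)) \<le> 2 * B * y\<^sup>2"
  proof -
    have "g holomorphic_on ball 0 (r / 8)" by (rule holomorphic_on_subset[OF g]) (use r in auto)
    from norm_even_part_le[OF this g'' g0, of ?w] y show ?thesis by (simp add: norm_mult)
  qed
  have wb: "?w \<in> ball 0 (r / 2)" "- ?w \<in> ball 0 (r / 2)" using y r by (auto simp: norm_mult)
  have "norm (f ?w * f (- ?w)) =
     norm ((f 0)\<^sup>2 * ((\<Prod>a\<leftarrow>as. 1 - ?w / a) * (\<Prod>a\<leftarrow>as. 1 - (- ?w) / a)) * exp (g ?w + g (- ?w)))"
    by (subst fg[OF wb(1)], subst fg[OF wb(2)]) (simp only: exp_add power2_eq_square mult_ac)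
  also have "\<dots> = (norm (f 0))\<^sup>2 * (norm ((\<Prod>a\<leftarrow>as. 1 - ?w / a) * (\<Prod>a\<leftarrow>as. 1 - (- ?w) / a))
       * exp (Re (g ?w + g (- ?w))))"
    by (simp only: norm_mult norm_power norm_exp_eq_Re mult_ac)
  also have "\<dots> \<le> (norm (f 0))\<^sup>2 * (exp (y\<^sup>2 * S) * exp (2 * B * y\<^sup>2))"
    using even complex_Re_le_cmod[of "g ?w + g (- ?w)"]
    by (intro mult_left_mono mult_mono PP) auto
  also have "\<dots> = (norm (f 0))\<^sup>2 * exp (y\<^sup>2 * (S + 1024 * M / r\<^sup>2))"
    by (simp add: B_def algebra_simps flip: exp_add)
  finally have fin1: "norm (f ?w * f (- ?w)) \<le> (norm (f 0))\<^sup>2 * exp (y\<^sup>2 * (S + 1024 * M / r\<^sup>2))" .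

  have df: "(f has_field_derivative deriv f z) (at z)" if "z \<in> ball 0 R" for z
    using that by (intro holomorphic_derivI[OF f]) auto
  have d2f: "(deriv f has_field_derivative deriv (deriv f) z) (at z)" if "z \<in> ball 0 R" for z
    using that by (intro holomorphic_derivI[OF holomorphic_deriv[OF f]]) auto
  have logd: "deriv f z / f z = (\<Sum>a\<leftarrow>as. 1 / (z - a)) + deriv g z"
    if z: "z \<in> ball 0 (r / 2)" "f z \<noteq> 0" for z
  proof -
    have zas: "z \<notin> set as" using as z by auto
    let ?P = "\<lambda>z. \<Prod>a\<leftarrow>as. 1 - z / a"
    have dg: "(g has_field_derivative deriv g z) (at z)" by (rule holomorphic_derivI[OF g _ z(1)]) simp
    have "((\<lambda>z. f 0 * ?P z * exp (g z)) has_field_derivative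
        f z * ((\<Sum>a\<leftarrow>as. 1 / (z - a)) + deriv g z)) (at z)"
      unfolding fg[OF z(1)]
      by (rule derivative_eq_intros dg deriv_prod_list_linear[OF as0 zas] refl)+ (simp add: algebra_simps)
    then have "(f has_field_derivative f z * ((\<Sum>a\<leftarrow>as. 1 / (z - a)) + deriv g z)) (at z)"
      by (rule has_field_derivative_transform_within_open[of _ _ _ "ball 0 (r / 2)"])
        (use z in \<open>auto simp: fg[symmetric]\<close>)
    from DERIV_imp_deriv[OF this] show ?thesis using z(2) by simp
  qed
  have "open (ball 0 R \<inter> f -` (- {0}))"
    by (intro continuous_open_preimage holomorphic_on_imp_continuous_on[OF f]) auto
  then have "\<forall>\<^sub>F z in nhds 0. z \<in> ball 0 R \<inter> f -` (- {0})"
    by (rule eventually_nhds_in_open) (use r f0 in auto)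
  then have "\<forall>\<^sub>F z in nhds 0. f z \<noteq> 0" by (rule eventually_mono) auto
  moreover have "\<forall>\<^sub>F z in nhds 0. z \<in> ball 0 (r / 2)" using r by (intro eventually_nhds_in_open) auto
  ultimately have ev: "\<forall>\<^sub>F z in nhds 0. deriv f z / f z = (\<Sum>a\<leftarrow>as. 1 / (z - a)) + deriv g z"
    by eventually_elim (rule logd)
  have d2g: "(deriv g has_field_derivative deriv (deriv g) 0) (at 0)"
    by (rule holomorphic_derivI[OF holomorphic_deriv[OF g]]) (use r in auto)
  have A: "((\<lambda>z. deriv f z / f z) has_field_derivative - of_real S + deriv (deriv g) 0) (at 0)"
    using DERIV_add[OF deriv_sum_list_inverse[OF as0] d2g]
    unfolding S_complex by (subst DERIV_cong_ev[OF refl ev refl])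
  have "((\<lambda>z. deriv f z / f z) has_field_derivative
         (deriv (deriv f) 0 * f 0 - deriv f 0 * deriv f 0) / (f 0 * f 0)) (at 0)"
    by (rule DERIV_divide) (use df[of 0] d2f[of 0] r f0 in auto)
  from DERIV_unique[OF this A]
  have "deriv (deriv f) 0 / f 0 - (deriv f 0 / f 0)\<^sup>2 + of_real S = deriv (deriv g) 0"
    using f0 by (simp add: divide_simps power2_eq_square)
  moreover have "norm (deriv (deriv g) 0) \<le> B" using g''[of 0] r by simp
  ultimately have fin2: "norm (deriv (deriv f) 0 / f 0 - (deriv f 0 / f 0)\<^sup>2 + of_real S) \<le> 1024 * M / r\<^sup>2"
    using B0 by (simp add: B_def)
  show ?thesis by (rule that[OF S0 SS fin1 fin2])
qed

section \<open>Mellin transform of the trapezoid error\<close>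

text \<open>The trapezoid rule minus the integral for x^(-s) on [a, a + 1]. For s < 0 the convention
  \<open>0 powr r = 0\<close> gives the right boundary value at a = 0.\<close>

definition powr_trapezoid :: "real \<Rightarrow> real \<Rightarrow> real" where
  "powr_trapezoid a s =
     (a powr - s + (a + 1) powr - s) / 2 - ((a + 1) powr (1 - s) - a powr (1 - s)) / (1 - s)"

text \<open>The same error for exp (- x y) as a function of y on [0, 1]; on [a, a + 1] it is
  multiplied by exp (- a x).\<close>

definition exp_trapezoid :: "real \<Rightarrow> real" where
  "exp_trapezoid x = (1 + exp (- x)) / 2 - (1 - exp (- x)) / x"

text \<open>
  Both trapezoid errors are integrals of the second derivative against the same Peano kernel.
\<close>

lemma exp_trapezoid_integral:
  assumes x: "x > 0"
  shows "((\<lambda>y. (y - a) * (a + 1 - y) / 2 * (x\<^sup>2 * exp (- (y * x)))) has_integral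
           exp (- (a * x)) * exp_trapezoid x) {a..a + 1}"
proof -
  let ?A = "\<lambda>y. - ((y - a) * (a + 1 - y) / 2 * (x * exp (- (y * x)))) + (y - a - 1 / 2) * exp (- (y * x))
      + exp (- (y * x)) / x"
  have "((\<lambda>y. (y - a) * (a + 1 - y) / 2 * (x\<^sup>2 * exp (- (y * x)))) has_integral (?A (a + 1) - ?A a)) {a..a + 1}"
  proof (rule fundamental_theorem_of_calculus)
    fix y assume "y \<in> {a..a + 1}"
    have "(?A has_real_derivative ((y - a) * (a + 1 - y) / 2 * (x\<^sup>2 * exp (- (y * x))))) (at y)"
      using x by (auto intro!: derivative_eq_intros simp: field_simps power2_eq_square)
    then show "(?A has_vector_derivative ((y - a) * (a + 1 - y) / 2 * (x\<^sup>2 * exp (- (y * x))))) (at y within {a..a + 1})"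
      by (simp add: has_real_derivative_iff_has_vector_derivative has_vector_derivative_at_within)
  qed simp
  moreover have "?A (a + 1) - ?A a = exp (- (a * x)) * exp_trapezoid x"
    using x by (simp add: exp_trapezoid_def field_simps flip: exp_add)
  ultimately show ?thesis by simp
qed

lemma exp_trapezoid_nonneg:
  assumes "x > 0"
  shows "exp_trapezoid x \<ge> 0"
  using has_integral_nonneg[OF exp_trapezoid_integral[OF assms, of 0]] by simp

text \<open>The second derivative of y^(-s) is s (s + 1) y^(-s - 2). Its constant is negative here
  and is moved to the right, which keeps the integrand nonnegative for the later exchange of
  integrals. For a = 0 the integrand has an integrable singularity at the endpoint.\<close>

lemma powr_trapezoid_integral:
  assumes s: "-1 < s" "s < 0" and a: "a \<ge> 0"
  shows "((\<lambda>y. (y - a) * (a + 1 - y) / 2 * y powr (- s - 2)) has_integral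
           powr_trapezoid a s / (s * (s + 1))) {a..a + 1}"
proof -
  \<comment> \<open>The kernel factor y - a is multiplied into the power: for a = 0 the power y^(-s
    - 1), unbounded at 0, then has coefficient 0, and the antiderivative is continuous up to the
    endpoint.\<close>
  define A where "A = (\<lambda>y. (- s * ((y powr - s - a * y powr (- s - 1)) * (a + 1 - y) / 2)
      + (y - a - 1 / 2) * y powr - s - y powr (1 - s) / (1 - s)) / (s * (s + 1)))"
  have p: "y powr (- s - 1) = y powr (- s - 2) * y" "y powr - s = y powr (- s - 2) * y * y"
      "y powr (1 - s) = y powr (- s - 2) * y * y * y" if "y > 0" for y :: real
    using that powr_add[of y "- s - 2" 1] powr_add[of y "- s - 2" 2] powr_add[of y "- s - 2" 3]
    by (simp_all add: power2_eq_square power3_eq_cube minus_diff_commute)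
  have "((\<lambda>y. (y - a) * (a + 1 - y) / 2 * y powr (- s - 2)) has_integral (A (a + 1) - A a)) {a..a + 1}"
  proof (rule fundamental_theorem_of_calculus_interior)
    have "continuous_on {a..a + 1} (\<lambda>y. a * y powr (- s - 1))"
    proof (cases "a = 0")
      case False
      then show ?thesis using a by (intro continuous_intros) auto
    qed simp
    moreover have "continuous_on {a..a + 1} (\<lambda>y. y powr - s)" "continuous_on {a..a + 1} (\<lambda>y. y powr (1 - s))"
      using a s by (auto intro!: continuous_on_powr' continuous_on_id continuous_on_const)
    moreover have "continuous_on {a..a + 1} (\<lambda>y. (- s * ((p1 y - p2 y) * (a + 1 - y) / 2)
        + (y - a - 1 / 2) * p1 y - p3 y / (1 - s)) / (s * (s + 1)))"
      if "continuous_on {a..a + 1} p1" "continuous_on {a..a + 1} p2" "continuous_on {a..a + 1} p3" for p1 p2 p3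
      using s by (intro continuous_intros that) auto
    ultimately show "continuous_on {a..a + 1} A"
      unfolding A_def by blast
    fix y assume "y \<in> {a<..<a + 1}"
    then have y: "y > 0" using a by auto
    define P where "P = y powr (- s - 2)"
    have d: "((\<lambda>y. y powr r) has_real_derivative r * y powr (r - 1)) (at y)" for r
      using has_real_derivative_powr[OF y] by simp
    have d1: "((\<lambda>y. y powr (- s)) has_real_derivative (- s) * y powr (- s - 1)) (at y)" by (rule d)
    have d2: "((\<lambda>y. y powr (- s - 1)) has_real_derivative (- s - 1) * y powr (- s - 2)) (at y)"
      using d[of "- s - 1"] unfolding diff_diff_add one_add_one .
    have d3: "((\<lambda>y. y powr (1 - s)) has_real_derivative (1 - s) * y powr (- s)) (at y)"
      using d[of "1 - s"] by simp
    have d4: "((\<lambda>y. a + 1 - y) has_real_derivative - 1) (at y)"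
      and d5: "((\<lambda>y. y - a - 1 / 2) has_real_derivative 1) (at y)"
      by (auto intro!: derivative_eq_intros)
    have "(A has_real_derivative
        (- s * ((((- s) * y powr (- s - 1) - a * ((- s - 1) * y powr (- s - 2))) * (a + 1 - y)
             + (- 1) * (y powr - s - a * y powr (- s - 1))) / 2)
          + (1 * y powr - s + ((- s) * y powr (- s - 1)) * (y - a - 1 / 2)) - (1 - s) * y powr (- s) / (1 - s)) / (s * (s + 1))) (at y)"
      unfolding A_def
      by (intro DERIV_cdivide DERIV_diff DERIV_add DERIV_cmult DERIV_mult d1 d2 d3 d4 d5)
    also have "(- s * ((((- s) * y powr (- s - 1) - a * ((- s - 1) * y powr (- s - 2))) * (a + 1 - y)
             + (- 1) * (y powr - s - a * y powr (- s - 1))) / 2)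
          + (1 * y powr - s + ((- s) * y powr (- s - 1)) * (y - a - 1 / 2)) - (1 - s) * y powr (- s) / (1 - s)) / (s * (s + 1))
        = (y - a) * (a + 1 - y) / 2 * y powr (- s - 2)"
      unfolding p[OF y] P_def[symmetric] using s by (simp add: divide_simps) algebra
    finally show "(A has_vector_derivative (y - a) * (a + 1 - y) / 2 * y powr (- s - 2)) (at y)"
      by (simp add: has_real_derivative_iff_has_vector_derivative)
  qed simp
  moreover have "A (a + 1) - A a = powr_trapezoid a s / (s * (s + 1))"
  proof -
    have e: "a * a powr (- s - 1) = a powr - s"
      using a by (cases "a = 0") (auto simp: powr_mult_base)
    show ?thesis unfolding A_def powr_trapezoid_def
      by (subst diff_divide_distrib[symmetric], rule arg_cong[where f = "\<lambda>u. u / (s * (s + 1))"])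
        (simp add: e diff_divide_distrib add_divide_distrib)
  qed
  ultimately show ?thesis by simp
qed

lemma Gamma_nn_integral_scaled:
  assumes "s > 0" "y > 0"
  shows "(\<integral>\<^sup>+x. ennreal (indicator {0<..} x * (x powr (s - 1) * exp (- (y * x)))) \<partial>lborel)
           = ennreal (Gamma s * y powr - s)"
proof -
  have "ennreal (Gamma s) = (\<integral>\<^sup>+t. ennreal (indicator {0..} t * t powr (s - 1) / exp t) \<partial>lborel)"
    by (rule Gamma_conv_nn_integral_real) fact
  also have "\<dots> = ennreal \<bar>y\<bar> * (\<integral>\<^sup>+t. ennreal (indicator {0..} (0 + y * t) * (0 + y * t) powr (s - 1) / exp (0 + y * t)) \<partial>lborel)"
    by (rule nn_integral_real_affine) (use assms in auto)
  also have "(\<integral>\<^sup>+t. ennreal (indicator {0..} (0 + y * t) * (0 + y * t) powr (s - 1) / exp (0 + y * t)) \<partial>lborel)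
     = (\<integral>\<^sup>+t. ennreal (y powr (s - 1)) * ennreal (indicator {0<..} t * (t powr (s - 1) * exp (- (y * t)))) \<partial>lborel)"
    using assms
    by (intro nn_integral_cong)
      (auto simp: indicator_def powr_mult exp_minus zero_le_mult_iff field_simps simp flip: ennreal_mult)
  also have "\<dots> = ennreal (y powr (s - 1)) * (\<integral>\<^sup>+t. ennreal (indicator {0<..} t * (t powr (s - 1) * exp (- (y * t)))) \<partial>lborel)"
    by (rule nn_integral_cmult) measurable
  finally have *: "ennreal (Gamma s) = ennreal (y powr s) *
      (\<integral>\<^sup>+t. ennreal (indicator {0<..} t * (t powr (s - 1) * exp (- (y * t)))) \<partial>lborel)"
    using assms by (simp add: powr_mult_base flip: ennreal_mult mult.assoc)
  have "ennreal (Gamma s * y powr - s) = ennreal (y powr - s) * ennreal (Gamma s)"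
    using assms Gamma_real_pos[of s] by (simp add: mult.commute flip: ennreal_mult)
  also have "\<dots> = ennreal (y powr - s * y powr s) *
      (\<integral>\<^sup>+t. ennreal (indicator {0<..} t * (t powr (s - 1) * exp (- (y * t)))) \<partial>lborel)"
    unfolding * by (simp add: ennreal_mult mult.assoc)
  finally show ?thesis using assms by (simp flip: powr_add)
qed

text \<open>Both sides come from one double integral over x and the Peano variable y. The factor x^2
  of the second derivative moves the Mellin exponent from s to s + 2, so the inner Gamma integral
  converges although s < 0; nonnegativity permits the exchange.\<close>

lemma powr_trapezoid_mellin:
  assumes s: "-1 < s" "s < 0" and a: "a \<ge> 0"
  shows "(\<integral>\<^sup>+x. ennreal (indicator {0<..} x * (x powr (s - 1) * (exp (- (a * x)) * exp_trapezoid x))) \<partial>lborel)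
           = ennreal (Gamma (s + 2) * (powr_trapezoid a s / (s * (s + 1))))"
proof -
  define k where "k = (\<lambda>y. (y - a) * (a + 1 - y) / 2)"
  have k: "k y \<ge> 0" if "y \<in> {a..a + 1}" for y using that by (auto simp: k_def)
  have "(\<integral>\<^sup>+x. ennreal (indicator {0<..} x * (x powr (s - 1) * (exp (- (a * x)) * exp_trapezoid x))) \<partial>lborel)
      = (\<integral>\<^sup>+x. \<integral>\<^sup>+y. ennreal (indicator ({0<..} \<times> {a..a + 1}) (x, y) * (x powr (s + 1) * exp (- (y * x)) * k y)) \<partial>lborel \<partial>lborel)"
  proof (rule nn_integral_cong)
    fix x :: real
    show "ennreal (indicator {0<..} x * (x powr (s - 1) * (exp (- (a * x)) * exp_trapezoid x)))
      = (\<integral>\<^sup>+y. ennreal (indicator ({0<..} \<times> {a..a + 1}) (x, y) * (x powr (s + 1) * exp (- (y * x)) * k y)) \<partial>lborel)"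
    proof (cases "x > 0")
      case True
      have "((\<lambda>y. k y * (x\<^sup>2 * exp (- (y * x)))) has_integral exp (- (a * x)) * exp_trapezoid x) {a..a + 1}"
        using exp_trapezoid_integral[OF True] by (simp add: k_def)
      from nn_integral_has_integral_lebesgue[OF _ has_integral_mult_right[OF this, of "x powr (s - 1)"]] k
      have "(\<integral>\<^sup>+y. ennreal (indicator {a..a + 1} y * (x powr (s - 1) * (k y * (x\<^sup>2 * exp (- (y * x)))))) \<partial>lborel)
         = ennreal (x powr (s - 1) * (exp (- (a * x)) * exp_trapezoid x))" by simp
      moreover have "x powr (s + 1) = x powr (s - 1) * x\<^sup>2"
        using True by (simp add: powr_add powr_diff power2_eq_square)
      ultimately show ?thesis using True by (simp add: indicator_def mult_ac)
    qed simp
  qed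
  also have "\<dots> = (\<integral>\<^sup>+y. \<integral>\<^sup>+x. ennreal (indicator ({0<..} \<times> {a..a + 1}) (x, y) * (x powr (s + 1) * exp (- (y * x)) * k y)) \<partial>lborel \<partial>lborel)"
    by (subst lborel_pair.Fubini')
      (auto simp: case_prod_unfold indicator_def k_def cong: measurable_cong_sets)
  also have "\<dots> = (\<integral>\<^sup>+y. ennreal (indicator {a..a + 1} y * (Gamma (s + 2) * (k y * y powr (- s - 2)))) \<partial>lborel)"
  proof (rule nn_integral_cong_AE, rule eventually_mono[OF AE_lborel_singleton[of 0]])
    fix y :: real assume "y \<noteq> 0"
    show "(\<integral>\<^sup>+x. ennreal (indicator ({0<..} \<times> {a..a + 1}) (x, y) * (x powr (s + 1) * exp (- (y * x)) * k y)) \<partial>lborel)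
      = ennreal (indicator {a..a + 1} y * (Gamma (s + 2) * (k y * y powr (- s - 2))))"
    proof (cases "y \<in> {a..a + 1}")
      case True
      then have y: "y > 0" using a \<open>y \<noteq> 0\<close> by auto
      have "(\<integral>\<^sup>+x. ennreal (indicator ({0<..} \<times> {a..a + 1}) (x, y) * (x powr (s + 1) * exp (- (y * x)) * k y)) \<partial>lborel)
         = (\<integral>\<^sup>+x. ennreal (k y) * ennreal (indicator {0<..} x * (x powr ((s + 2) - 1) * exp (- (y * x)))) \<partial>lborel)"
        using True k[OF True]
        by (intro nn_integral_cong) (auto simp: indicator_def mult_ac add_ac simp flip: ennreal_mult)
      also have "\<dots> = ennreal (k y) * ennreal (Gamma (s + 2) * y powr - (s + 2))"
        by (subst nn_integral_cmult, measurable, subst Gamma_nn_integral_scaled) (use s y in auto)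
      also have "\<dots> = ennreal (indicator {a..a + 1} y * (Gamma (s + 2) * (k y * y powr (- s - 2))))"
        using True k[OF True] Gamma_real_pos[of "s + 2"] s by (simp add: mult_ac flip: ennreal_mult)
      finally show ?thesis .
    qed (auto simp: indicator_def)
  qed
  also have "\<dots> = ennreal (Gamma (s + 2) * (powr_trapezoid a s / (s * (s + 1))))"
  proof (rule nn_integral_has_integral_lebesgue)
    show "((\<lambda>y. Gamma (s + 2) * (k y * y powr (- s - 2))) has_integral
        Gamma (s + 2) * (powr_trapezoid a s / (s * (s + 1)))) {a..a + 1}"
      unfolding k_def by (intro has_integral_mult_right powr_trapezoid_integral s a)
    show "0 \<le> Gamma (s + 2) * (k y * y powr (- s - 2))" if "y \<in> {a..a + 1}" for y
      using k[OF that] Gamma_real_pos[of "s + 2"] s by simp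
  qed
  finally show ?thesis .
qed

text \<open>The substitution t = x^2 / (x^2 + c^2) leads to the Beta integral with parameters (1 +
  s) / 2 and (1 - s) / 2. Their sum is 1, so the Beta value is a product of two Gamma
  values.\<close>

lemma beta_mellin:
  assumes s: "-1 < s" "s < 1" and c: "c > 0"
  shows "(\<integral>\<^sup>+x. ennreal (indicator {0<..} x * (x powr (s - 1) * (2 * x / (x\<^sup>2 + c\<^sup>2)))) \<partial>lborel)
           = ennreal (c powr (s - 1) * (Gamma ((1 + s) / 2) * Gamma ((1 - s) / 2)))"
proof -
  define g where "g = (\<lambda>x. x\<^sup>2 / (x\<^sup>2 + c\<^sup>2))"
  define g' where "g' = (\<lambda>x. 2 * x * c\<^sup>2 / (x\<^sup>2 + c\<^sup>2)\<^sup>2)"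
  define f where "f = (\<lambda>t::real. t powr ((1 + s) / 2 - 1) * (1 - t) powr ((1 - s) / 2 - 1))"
  define G where "G = Gamma ((1 + s) / 2) * Gamma ((1 - s) / 2)"
  have pos: "x\<^sup>2 + c\<^sup>2 > 0" for x using c by (simp add: add_nonneg_pos)
  have fG: "(f has_integral G) {0<..<1}"
  proof -
    have "(1 + s) / 2 + (1 - s) / 2 = 1" by (simp add: field_simps)
    then have "Beta ((1 + s) / 2) ((1 - s) / 2) = G" by (simp add: Beta_def G_def)
    then show ?thesis using has_integral_Beta_real[of "(1 + s) / 2" "(1 - s) / 2"] s
      by (simp add: f_def has_integral_Icc_iff_Ioo)
  qed
  have inj: "inj_on g {0<..}"
  proof (rule inj_onI)
    fix x y assume xy: "x \<in> {0<..}" "y \<in> {0<..}" "g x = g y"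
    then have "x\<^sup>2 * (y\<^sup>2 + c\<^sup>2) = y\<^sup>2 * (x\<^sup>2 + c\<^sup>2)"
      using pos[of x] pos[of y] by (simp add: g_def divide_simps)
    then have "x\<^sup>2 = y\<^sup>2" using c by (simp add: algebra_simps)
    then show "x = y" using xy by simp
  qed
  have img: "g ` {0<..} = {0<..<1}"
  proof (intro set_eqI iffI)
    fix t assume "t \<in> g ` {0<..}"
    then show "t \<in> {0<..<1}" using pos c by (auto simp: g_def divide_simps)
  next
    fix t :: real assume t: "t \<in> {0<..<1}"
    define x where "x = c * sqrt (t / (1 - t))"
    have "x > 0" using t c by (simp add: x_def)
    moreover have "g x = t"
    proof -
      have "x\<^sup>2 = c\<^sup>2 * (t / (1 - t))" using t by (simp add: x_def power_mult_distrib)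
      moreover have "c\<^sup>2 > 0" using c by simp
      ultimately show ?thesis using t by (simp add: g_def divide_simps) (simp add: algebra_simps)
    qed
    ultimately show "t \<in> g ` {0<..}" by force
  qed
  have der: "(g has_field_derivative g' x) (at x within {0<..})" for x
    unfolding g_def g'_def using pos[of x]
    by (auto intro!: derivative_eq_intros simp: power2_eq_square divide_simps; simp add: algebra_simps)
  have "f absolutely_integrable_on {0<..<1}"
    using fG by (intro nonnegative_absolutely_integrable_1) (auto simp: f_def)
  then have "f absolutely_integrable_on (g ` {0<..}) \<and> integral (g ` {0<..}) f = G"
    unfolding img using fG by (auto simp: integral_unique)
  then have "(\<lambda>x. \<bar>g' x\<bar> * f (g x)) absolutely_integrable_on {0<..} \<and> integral {0<..} (\<lambda>x. \<bar>g' x\<bar> * f (g x)) = G"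
    by (subst has_absolute_integral_change_of_variables_1'[OF _ der inj]) auto
  then have "((\<lambda>x. \<bar>g' x\<bar> * f (g x)) has_integral G) {0<..}"
    by (metis absolutely_integrable_on_def has_integral_iff)
  then have "((\<lambda>x. c powr (s - 1) * (\<bar>g' x\<bar> * f (g x))) has_integral c powr (s - 1) * G) {0<..}"
    by (rule has_integral_mult_right)
  also have "?this \<longleftrightarrow> ((\<lambda>x. x powr (s - 1) * (2 * x / (x\<^sup>2 + c\<^sup>2))) has_integral c powr (s - 1) * G) {0<..}"
  proof (rule has_integral_cong)
    fix x :: real assume "x \<in> {0<..}"
    then have x: "x > 0" by simp
    define D where "D = x\<^sup>2 + c\<^sup>2"
    have D: "D > 0" unfolding D_def by (rule pos)
    have 1: "1 - g x = c\<^sup>2 / D" using D using c by (simp add: g_def D_def divide_simps)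
    have x2: "x\<^sup>2 powr (r / 2) = x powr r" if "x > 0" for x r :: real
    proof -
      have "x\<^sup>2 = x powr 2" using that by simp
      then show ?thesis by (simp only: powr_powr) simp
    qed
    have "f (g x) = (x powr (s - 1) / D powr ((s - 1) / 2)) * (c powr (- s - 1) / D powr ((- s - 1) / 2))"
    proof -
      have e: "(1 + s) / 2 - 1 = (s - 1) / 2" "(1 - s) / 2 - 1 = (- s - 1) / 2" by simp_all
      have "(x\<^sup>2 / D) powr ((s - 1) / 2) = x powr (s - 1) / D powr ((s - 1) / 2)"
        using x D x2[of x "s - 1"] by (subst powr_divide) auto
      moreover have "(c\<^sup>2 / D) powr ((- s - 1) / 2) = c powr (- s - 1) / D powr ((- s - 1) / 2)"
        using c D x2[of c "- s - 1"] by (subst powr_divide) auto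
      ultimately show ?thesis unfolding f_def 1 e by (simp only: g_def D_def[symmetric])
    qed
    also have "\<dots> = x powr (s - 1) * c powr (- s - 1) * D"
    proof -
      have "D powr ((s - 1) / 2) * D powr ((- s - 1) / 2) = D powr - 1"
        unfolding powr_add[symmetric] by (simp add: field_simps)
      then have "D powr ((s - 1) / 2) * D powr ((- s - 1) / 2) = 1 / D" using D by (simp add: powr_minus_divide)
      then show ?thesis using D by (simp add: divide_simps mult_ac)
    qed
    finally have "c powr (s - 1) * (\<bar>g' x\<bar> * f (g x))
        = (c powr (s - 1) * c powr (- s - 1) * c\<^sup>2) * (x powr (s - 1) * (2 * x / D))"
    proof -
      have "\<bar>g' x\<bar> = 2 * x * c\<^sup>2 / (D * D)"
        using x D by (simp add: g'_def D_def[symmetric] power2_eq_square[of D])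
      moreover assume "f (g x) = x powr (s - 1) * c powr (- s - 1) * D"
      ultimately show ?thesis using D by (simp only:) (simp add: divide_simps)
    qed
    also have "c powr (s - 1) * c powr (- s - 1) * c\<^sup>2 = 1"
      using c by (simp add: powr_minus_divide powr_numeral flip: powr_add)
    finally show "c powr (s - 1) * (\<bar>g' x\<bar> * f (g x)) = x powr (s - 1) * (2 * x / (x\<^sup>2 + c\<^sup>2))"
      by (simp add: D_def)
  qed
  finally show ?thesis unfolding G_def
    by (intro nn_integral_has_integral_lebesgue) (auto intro!: divide_nonneg_nonneg mult_nonneg_nonneg)
qed


section \<open>Two expansions of \<open>exp_trapezoid x / (1 - exp (- x))\<close>\<close>

lemma exp_trapezoid_geometric_sums:
  assumes x: "x > 0"
  shows "(\<lambda>n. exp (- (real n * x)) * exp_trapezoid x) sums (exp_trapezoid x / (1 - exp (- x)))"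
proof -
  have "(\<lambda>n. exp (- x) ^ n) sums (1 / (1 - exp (- x)))" by (rule geometric_sums) (use x in simp)
  then have "(\<lambda>n. exp (- x) ^ n * exp_trapezoid x) sums (1 / (1 - exp (- x)) * exp_trapezoid x)"
    by (rule sums_mult2)
  then show ?thesis by (simp flip: exp_of_nat_mult)
qed

text \<open>In the reflection formula Gamma w * Gamma (1 - w) * sin (pi w) is constant.
  Differentiating it expresses the cotangent by Digamma values, whose series are the partial
  fractions.\<close>

lemma cot_partial_fractions_complex:
  fixes z :: complex
  assumes z: "z \<notin> \<int>"
  shows "(\<lambda>k. inverse (1 + z + of_nat k) - inverse (1 - z + of_nat k)) sums
           (of_real pi * cot (of_real pi * z) - 1 / z)"
proof -
  have "z \<noteq> 0" using z by auto
  have nn: "z \<notin> \<int>\<^sub>\<le>\<^sub>0" "1 - z \<notin> \<int>\<^sub>\<le>\<^sub>0" "1 + z \<notin> \<int>\<^sub>\<le>\<^sub>0"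
    using z nonpos_Ints_Int Ints_diff[of 1 "1 - z"] Ints_diff[of "1 + z" 1] by force+
  have "open (- \<int> :: complex set)" by (simp add: open_Compl)
  have ev: "\<forall>\<^sub>F w in nhds z. Gamma w * Gamma (1 - w) * sin (of_real pi * w) = of_real pi"
  proof (rule eventually_mono[OF eventually_nhds_in_open[OF \<open>open (- \<int>)\<close>]])
    show "Gamma w * Gamma (1 - w) * sin (of_real pi * w) = of_real pi" if "w \<in> - \<int>" for w :: complex
      using Gamma_reflection_complex[of w] sin_eq_0[of "of_real pi * w"] that by (auto simp: divide_simps)
  qed (use z in auto)
  have sin: "sin (of_real pi * z) \<noteq> 0" using sin_eq_0[of "of_real pi * z"] z by auto
  have "((\<lambda>w. Gamma w * Gamma (1 - w) * sin (of_real pi * w)) has_field_derivative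
      Gamma z * Gamma (1 - z) * (sin (of_real pi * z) * (Digamma z - Digamma (1 - z)) + of_real pi * cos (of_real pi * z))) (at z)"
    using nn by (auto intro!: derivative_eq_intros simp: algebra_simps)
  moreover have "((\<lambda>w. Gamma w * Gamma (1 - w) * sin (of_real pi * w)) has_field_derivative 0) (at z)"
    by (subst DERIV_cong_ev[OF refl ev refl]) auto
  ultimately have "Gamma z * Gamma (1 - z) * (sin (of_real pi * z) * (Digamma z - Digamma (1 - z)) + of_real pi * cos (of_real pi * z)) = 0"
    by (rule DERIV_unique)
  then have "sin (of_real pi * z) * (Digamma z - Digamma (1 - z)) + of_real pi * cos (of_real pi * z) = 0"
    using nn by (simp add: Gamma_eq_zero_iff)
  then have "Digamma (1 - z) - Digamma z = of_real pi * cot (of_real pi * z)"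
    using sin by (simp add: cot_def divide_simps) (simp add: algebra_simps)
  then have "Digamma (1 - z) - Digamma (1 + z) = of_real pi * cot (of_real pi * z) - 1 / z"
    using Digamma_plus1[of z] \<open>z \<noteq> 0\<close> by (simp add: add.commute)
  moreover have "(\<lambda>k. (inverse (of_nat (Suc k)) - inverse (1 - z + of_nat k)) - (inverse (of_nat (Suc k)) - inverse (1 + z + of_nat k)))
      sums ((Digamma (1 - z) + euler_mascheroni) - (Digamma (1 + z) + euler_mascheroni))"
    unfolding Digamma_def diff_add_cancel using nn
    by (intro sums_diff summable_sums summable_Digamma) auto
  ultimately show ?thesis by simp
qed

text \<open>The value of the series is coth (x / 2) / 2 - 1 / x, so this is the cotangent expansion
  at the imaginary point i x / (2 pi).\<close>

lemma coth_partial_fractions: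
  fixes x :: real
  assumes x: "x > 0"
  shows "(\<lambda>m. 2 * x / (x\<^sup>2 + (2 * pi * real (Suc m))\<^sup>2)) sums (exp_trapezoid x / (1 - exp (- x)))"
proof -
  define u where "u = x / (2 * pi)"
  have u: "u > 0" using x by (simp add: u_def)
  define z where "z = \<i> * complex_of_real u"
  have "z \<notin> \<int>" using u by (auto simp: z_def complex_eq_iff elim!: Ints_cases)
  from sums_mult[OF cot_partial_fractions_complex[OF this], of "\<i> / (2 * of_real pi)"]
  have S: "(\<lambda>k. \<i> / (2 * of_real pi) * (inverse (1 + z + of_nat k) - inverse (1 - z + of_nat k))) sums
           (\<i> / (2 * of_real pi) * (of_real pi * cot (of_real pi * z) - 1 / z))" .
  have trm: "\<i> / (2 * of_real pi) * (inverse (1 + z + of_nat k) - inverse (1 - z + of_nat k))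
      = of_real (2 * x / (x\<^sup>2 + (2 * pi * real (Suc k))\<^sup>2))" for k
  proof -
    define n where "n = real (Suc k)"
    have n: "n > 0" by (simp add: n_def)
    have "Re (of_real n + z) \<noteq> 0" "Re (of_real n - z) \<noteq> 0" using n by (auto simp: z_def)
    then have nz: "of_real n + z \<noteq> 0" "of_real n - z \<noteq> 0" by (metis zero_complex.sel(1))+
    have "inverse (of_real n + z) - inverse (of_real n - z) = - 2 * z / ((of_real n + z) * (of_real n - z))"
      using nz by (simp add: divide_simps)
    also have "(of_real n + z) * (of_real n - z) = of_real (n\<^sup>2 + u\<^sup>2)"
      by (simp add: z_def algebra_simps power2_eq_square)
    finally have "\<i> / (2 * of_real pi) * (inverse (of_real n + z) - inverse (of_real n - z)) = of_real (u / (pi * (n\<^sup>2 + u\<^sup>2)))"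
      by (simp add: z_def)
    also have "u / (pi * (n\<^sup>2 + u\<^sup>2)) = 2 * x / (x\<^sup>2 + (2 * pi * n)\<^sup>2)"
    proof -
      have "x = 2 * pi * u" by (simp add: u_def)
      moreover from this have "x\<^sup>2 + (2 * pi * n)\<^sup>2 = (2 * pi)\<^sup>2 * (n\<^sup>2 + u\<^sup>2)"
        by (simp add: power_mult_distrib algebra_simps)
      ultimately show ?thesis by (simp add: power2_eq_square[of pi])
    qed
    finally have "\<i> / (2 * of_real pi) * (inverse (of_real n + z) - inverse (of_real n - z))
        = of_real (2 * x / (x\<^sup>2 + (2 * pi * n)\<^sup>2))" .
    moreover have "of_real n + z = 1 + z + of_nat k" "of_real n - z = 1 - z + of_nat k"
      by (simp_all add: n_def)
    ultimately show ?thesis by (simp only: n_def)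
  qed
  have "\<i> / (2 * of_real pi) * (of_real pi * cot (of_real pi * z) - 1 / z) = of_real (exp_trapezoid x / (1 - exp (- x)))"
  proof -
    have pz: "of_real pi * z = \<i> * of_real (x / 2)" by (simp add: z_def u_def)
    define E where "E = exp (x / 2)"
    have E: "E > 1" using x by (simp add: E_def)
    have expx: "exp (- x) = 1 / (E * E)" by (simp add: E_def exp_minus inverse_eq_divide flip: exp_add)
    define Q where "Q = (1 + exp (- x)) / (1 - exp (- x))"
    have "cot (\<i> * of_real (x / 2)) = - \<i> * of_real ((E + 1 / E) / (E - 1 / E))"
    proof -
      have e: "exp (\<i> * (\<i> * of_real (x / 2))) = of_real (1 / E)" "exp (- (\<i> * (\<i> * of_real (x / 2)))) = of_real E"
        by (simp_all add: E_def exp_minus inverse_eq_divide flip: exp_of_real mult.assoc)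
      have "1 / E < E" using E less_1_mult[of E E] by (simp add: divide_simps)
      then have B: "complex_of_real (E - 1 / E) \<noteq> 0" by (simp del: of_real_diff)
      have c: "cos (\<i> * of_real (x / 2)) = of_real (E + 1 / E) / 2"
        unfolding cos_exp_eq e by simp
      have s: "sin (\<i> * of_real (x / 2)) = - of_real (E - 1 / E) / (2 * \<i>)"
        unfolding sin_exp_eq e by simp
      have "(A / 2) / (- B / (2 * \<i>)) = - \<i> * (A / B)" if "B \<noteq> 0" for A B :: complex
        using that by (simp add: divide_simps)
      from this[OF B] show ?thesis unfolding cot_def c s of_real_divide[of "E + 1 / E" "E - 1 / E"] .
    qed
    moreover have "(E + 1 / E) / (E - 1 / E) = Q"
      using E by (simp add: Q_def E_def[symmetric] expx divide_simps)
    ultimately have "cot (\<i> * of_real (x / 2)) = - \<i> * of_real Q" by simp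
    then have "\<i> / (2 * of_real pi) * (of_real pi * cot (of_real pi * z) - 1 / z) = of_real (Q / 2 - 1 / x)"
      unfolding pz by (simp add: z_def u_def field_simps)
    then have "\<i> / (2 * of_real pi) * (of_real pi * cot (of_real pi * z) - 1 / z)
        = of_real ((1 + exp (- x)) / (1 - exp (- x)) / 2 - 1 / x)" by (simp only: Q_def)
    also have "(1 + exp (- x)) / (1 - exp (- x)) / 2 - 1 / x = exp_trapezoid x / (1 - exp (- x))"
      using x by (simp add: exp_trapezoid_def divide_simps)
    finally show ?thesis .
  qed
  with S trm show ?thesis by (simp only: sums_of_real_iff)
qed

text \<open>This is the functional equation on a real interval. The Mellin transform of
  \<open>exp_trapezoid x / (1 - exp (- x))\<close> is computed twice, from the geometric series and
  from the partial fractions; the two results are the sum of the trapezoid errors and the Dirichlet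
  series at 1 - s. All terms are nonnegative, so neither exchange of sum and integral needs an
  estimate.\<close>

theorem powr_trapezoid_sums:
  assumes s: "-1 < s" "s < 0" and Z: "(\<lambda>m. real (Suc m) powr (s - 1)) sums Z"
  shows "(\<lambda>n. powr_trapezoid (real n) s) sums
           ((2 * pi) powr (s - 1) * (Gamma ((1 + s) / 2) * Gamma ((1 - s) / 2)) / Gamma s * Z)"
proof -
  define G where "G = (2 * pi) powr (s - 1) * (Gamma ((1 + s) / 2) * Gamma ((1 - s) / 2))"
  define q where "q = Gamma (s + 2) / (s * (s + 1))"
  have G0: "G \<ge> 0" unfolding G_def using s Gamma_real_pos[of "(1 + s) / 2"] Gamma_real_pos[of "(1 - s) / 2"] by simp
  have sn: "s \<notin> \<int>\<^sub>\<le>\<^sub>0" "s + 1 \<notin> \<int>\<^sub>\<le>\<^sub>0" using s by (auto elim!: nonpos_Ints_cases)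
  have q: "q = Gamma s"
    using Gamma_plus1[OF sn(1)] Gamma_plus1[OF sn(2)] s by (simp add: q_def add.assoc)
  have q0: "q \<noteq> 0" using sn unfolding q by (simp add: Gamma_eq_zero_iff)
  have "(\<Sum>n. ennreal (q * powr_trapezoid (real n) s))
     = (\<Sum>n. \<integral>\<^sup>+x. ennreal (indicator {0<..} x * (x powr (s - 1) * (exp (- (real n * x)) * exp_trapezoid x))) \<partial>lborel)"
    using powr_trapezoid_mellin[OF s] by (simp add: q_def)
  also have "\<dots> = (\<integral>\<^sup>+x. (\<Sum>n. ennreal (indicator {0<..} x * (x powr (s - 1) * (exp (- (real n * x)) * exp_trapezoid x)))) \<partial>lborel)"
    by (rule nn_integral_suminf[symmetric]) (simp add: exp_trapezoid_def)
  also have "\<dots> = (\<integral>\<^sup>+x. (\<Sum>m. ennreal (indicator {0<..} x * (x powr (s - 1) * (2 * x / (x\<^sup>2 + (2 * pi * real (Suc m))\<^sup>2))))) \<partial>lborel)"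
  proof (rule nn_integral_cong)
    fix x :: real
    show "(\<Sum>n. ennreal (indicator {0<..} x * (x powr (s - 1) * (exp (- (real n * x)) * exp_trapezoid x))))
      = (\<Sum>m. ennreal (indicator {0<..} x * (x powr (s - 1) * (2 * x / (x\<^sup>2 + (2 * pi * real (Suc m))\<^sup>2)))))"
    proof (cases "x > 0")
      case True
      have "(\<Sum>n. ennreal (indicator {0<..} x * (x powr (s - 1) * (exp (- (real n * x)) * exp_trapezoid x))))
        = ennreal (indicator {0<..} x * (x powr (s - 1) * (exp_trapezoid x / (1 - exp (- x)))))"
        using True exp_trapezoid_nonneg[OF True]
        by (intro suminf_ennreal_eq sums_mult exp_trapezoid_geometric_sums) auto
      also have "\<dots> = (\<Sum>m. ennreal (indicator {0<..} x * (x powr (s - 1) * (2 * x / (x\<^sup>2 + (2 * pi * real (Suc m))\<^sup>2)))))"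
        using True
        by (intro suminf_ennreal_eq[symmetric] sums_mult coth_partial_fractions) auto
      finally show ?thesis .
    qed simp
  qed
  also have "\<dots> = (\<Sum>m. \<integral>\<^sup>+x. ennreal (indicator {0<..} x * (x powr (s - 1) * (2 * x / (x\<^sup>2 + (2 * pi * real (Suc m))\<^sup>2)))) \<partial>lborel)"
    by (rule nn_integral_suminf) simp
  also have "\<dots> = (\<Sum>m. ennreal (G * real (Suc m) powr (s - 1)))"
  proof (rule suminf_cong)
    fix m
    have "(\<integral>\<^sup>+x. ennreal (indicator {0<..} x * (x powr (s - 1) * (2 * x / (x\<^sup>2 + (2 * pi * real (Suc m))\<^sup>2)))) \<partial>lborel)
       = ennreal ((2 * pi * real (Suc m)) powr (s - 1) * (Gamma ((1 + s) / 2) * Gamma ((1 - s) / 2)))"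
      by (rule beta_mellin) (use s in auto)
    also have "(2 * pi * real (Suc m)) powr (s - 1) = (2 * pi) powr (s - 1) * real (Suc m) powr (s - 1)"
      by (rule powr_mult)
    finally show "(\<integral>\<^sup>+x. ennreal (indicator {0<..} x * (x powr (s - 1) * (2 * x / (x\<^sup>2 + (2 * pi * real (Suc m))\<^sup>2)))) \<partial>lborel)
       = ennreal (G * real (Suc m) powr (s - 1))" by (simp add: G_def mult_ac)
  qed
  also have "\<dots> = ennreal (G * Z)"
    using G0 by (intro suminf_ennreal_eq sums_mult Z) auto
  finally have eq: "(\<Sum>n. ennreal (q * powr_trapezoid (real n) s)) = ennreal (G * Z)" .
  \<comment> \<open>For -1 < s < 0 the function x^(-s) is concave, so its trapezoid errors are at
    most 0; \<open>q\<close>, which is Gamma s, is negative as well.\<close>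
  have nonneg: "q * powr_trapezoid (real n) s \<ge> 0" for n
  proof -
    have "powr_trapezoid (real n) s / (s * (s + 1)) \<ge> 0"
      by (rule has_integral_nonneg[OF powr_trapezoid_integral[OF s]]) auto
    moreover have "Gamma (s + 2) > 0" using s by (intro Gamma_real_pos) auto
    ultimately have "Gamma (s + 2) * (powr_trapezoid (real n) s / (s * (s + 1))) \<ge> 0"
      by (intro mult_nonneg_nonneg) auto
    then show ?thesis by (simp add: q_def)
  qed
  have Z0: "Z \<ge> 0" using Z by (metis sums_le[OF _ sums_zero] powr_ge_zero)
  have sm: "summable (\<lambda>n. q * powr_trapezoid (real n) s)"
    by (rule summable_suminf_not_top) (use nonneg eq in auto)
  have "(\<Sum>n. q * powr_trapezoid (real n) s) = G * Z"
    using eq suminf_ennreal2[OF nonneg sm] suminf_nonneg[OF sm nonneg] G0 Z0 by simp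
  then have "(\<lambda>n. q * powr_trapezoid (real n) s) sums (G * Z)" using sm by (simp add: sums_iff)
  from sums_mult[OF this, of "1 / q"] q0 show ?thesis by (simp add: G_def q)
qed

section \<open>Continuation and functional equation of zeta\<close>

definition zeta_trapezoid :: "nat \<Rightarrow> complex \<Rightarrow> complex" where
  "zeta_trapezoid n s =
     (of_nat n powr - s + of_nat (n + 1) powr - s) / 2 -
     (of_nat (n + 1) powr (1 - s) - of_nat n powr (1 - s)) / (1 - s)"

text \<open>The trapezoid rule is exact for linear functions, which gains two powers of
  \<open>n\<close>: the series of errors converges for Re s > -1, far enough to the left to contain
  the strip -1 < Re s < 0 of the functional equation.\<close>

lemma norm_zeta_trapezoid_le:
  assumes s: "s \<noteq> 1" "Re s \<ge> - 2" and n: "n > 0"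
  shows "norm (zeta_trapezoid n s) \<le> norm s * norm (s + 1) / 2 * real n powr (- Re s - 2)"
proof -
  define a where "a = complex_of_real (real n)"
  let ?S = "closed_segment (0::complex) 1"
  define B where "B = norm s * norm (s + 1) / 2 * real n powr (- Re s - 2)"
  have B: "B \<ge> 0" by (simp add: B_def)
  have ab: "\<exists>x. a + z = complex_of_real x \<and> x \<ge> real n \<and> z = of_real (x - real n) \<and> x \<le> real n + 1"
    if z: "z \<in> ?S" for z
  proof -
    from z obtain u where u: "0 \<le> u" "u \<le> 1" "z = of_real u"
      by (auto simp: closed_segment_def scaleR_conv_of_real)
    then show ?thesis by (intro exI[of _ "real n + u"]) (auto simp: a_def)
  qed
  have nonneg: "a + z \<notin> \<real>\<^sub>\<le>\<^sub>0" if z: "z \<in> ?S" for z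
    using ab[OF z] n by (auto simp del: of_real_add)
  have d: "((\<lambda>z. (a + z) powr w) has_field_derivative w * (a + z) powr (w - 1)) (at z within ?S)"
    if "z \<in> ?S" for z w
    using nonneg[OF that] by (auto intro!: derivative_eq_intros)
  define f where "f = (\<lambda>z. (a + z) powr (- s))"
  define f' where "f' = (\<lambda>z. (- s) * (a + z) powr (- s - 1))"
  define f'' where "f'' = (\<lambda>z. (- s) * ((- s - 1) * (a + z) powr (- s - 2)))"
  have df: "(f has_field_derivative f' z) (at z within ?S)" if "z \<in> ?S" for z
    unfolding f_def f'_def by (rule d[OF that])
  have df': "(f' has_field_derivative f'' z) (at z within ?S)" if "z \<in> ?S" for z
    unfolding f''_def f'_def using DERIV_cmult[OF d[OF that, of "- s - 1"], of "- s"]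
    by (simp only: diff_diff_add one_add_one)
  define F where "F = (\<lambda>z. (a + z) powr (1 - s) / (1 - s))"
  have dF: "(F has_field_derivative f z) (at z within ?S)" if "z \<in> ?S" for z
    unfolding F_def f_def using DERIV_cdivide[OF d[OF that, of "1 - s"], of "1 - s"] s by simp
  \<comment> \<open>The error on [n, n + z] as a function of the length z. It vanishes at 0 together
    with its derivative, and its second derivative is z f'' / 2, so two mean value estimates
    suffice.\<close>
  define \<phi> where "\<phi> = (\<lambda>z. z * (f 0 + f z) / 2 - (F z - F 0))"
  define \<phi>' where "\<phi>' = (\<lambda>z. (f 0 - f z + z * f' z) / 2)"
  have d\<phi>: "(\<phi> has_field_derivative \<phi>' z) (at z within ?S)" if "z \<in> ?S" for z
    unfolding \<phi>_def \<phi>'_def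
    by (auto intro!: derivative_eq_intros df dF that simp: field_simps)
  have d\<phi>': "(\<phi>' has_field_derivative z * f'' z / 2) (at z within ?S)" if "z \<in> ?S" for z
    unfolding \<phi>'_def
    by (auto intro!: derivative_eq_intros df df' that simp: field_simps)
  have f''_le: "norm (f'' z) \<le> 2 * B" if z: "z \<in> ?S" for z
  proof -
    obtain x where x: "a + z = complex_of_real x" "x \<ge> real n" using ab[OF z] by blast
    have "norm (f'' z) = norm s * norm (s + 1) * x powr (- Re s - 2)"
    proof -
      have "- s - 1 = - (s + 1)" by simp
      then show ?thesis
        unfolding f''_def x using x n by (simp only: norm_mult norm_minus_cancel) (simp add: norm_powr_real_powr)
    qed
    also have "x powr (- Re s - 2) \<le> real n powr (- Re s - 2)"
      by (rule powr_mono2') (use x n s in auto)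
    finally show ?thesis by (simp add: B_def mult_left_mono)
  qed
  have seg: "norm z \<le> 1" if "z \<in> ?S" for z
    using that by (auto simp: closed_segment_def)
  have 1: "norm (\<phi>' z) \<le> B" if z: "z \<in> ?S" for z
  proof -
    have "norm (\<phi>' z - \<phi>' 0) \<le> B * norm (z - 0)"
    proof (rule field_differentiable_bound[where S = ?S, OF _ d\<phi>'])
      fix w assume w: "w \<in> ?S"
      have "norm w * norm (f'' w) \<le> 1 * (2 * B)"
        by (rule mult_mono[OF seg[OF w] f''_le[OF w]]) (auto simp: B)
      then show "norm (w * f'' w / 2) \<le> B" by (simp add: norm_mult)
    qed (use z in auto)
    also have "\<dots> \<le> B * 1" using seg[OF z] B by (intro mult_left_mono) auto
    finally show ?thesis by (simp add: \<phi>'_def)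
  qed
  have "norm (\<phi> 1 - \<phi> 0) \<le> B * norm (1 - 0 :: complex)"
    by (rule field_differentiable_bound[where S = ?S, OF _ d\<phi>]) (auto intro: 1)
  moreover have "\<phi> 1 - \<phi> 0 = zeta_trapezoid n s"
    by (simp add: \<phi>_def f_def F_def zeta_trapezoid_def a_def add_ac diff_divide_distrib)
  ultimately show ?thesis by (simp add: B_def)
qed

lemma summable_zeta_trapezoid_bound:
  assumes "x > -1"
  shows "summable (\<lambda>n. real (Suc n) powr (- x - 2))"
  using assms summable_real_powr_iff[of "- x - 2"] by (subst summable_Suc_iff) auto

lemma summable_zeta_trapezoid:
  assumes s: "s \<noteq> 1" "Re s > - 1"
  shows "summable (\<lambda>n. zeta_trapezoid (Suc n) s)"
proof (rule summable_comparison_test')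
  show "summable (\<lambda>n. norm s * norm (s + 1) / 2 * real (Suc n) powr (- Re s - 2))"
    by (intro summable_mult summable_zeta_trapezoid_bound s)
  show "norm (zeta_trapezoid (Suc n) s) \<le> norm s * norm (s + 1) / 2 * real (Suc n) powr (- Re s - 2)"
    if "n \<ge> 0" for n using norm_zeta_trapezoid_le[of s "Suc n"] s by simp
qed

text \<open>Euler-Maclaurin summation: for Re s > 1 the trapezoid errors on [1, \<infinity>) add up
  to the Dirichlet series minus half of its first term minus the integral 1 / (s - 1).\<close>

definition zeta_right :: "complex \<Rightarrow> complex" where
  "zeta_right s = 1 / (s - 1) + 1 / 2 + (\<Sum>n. zeta_trapezoid (Suc n) s)"

lemma holomorphic_zeta_right: "zeta_right holomorphic_on {s. Re s > - 1} - {1}"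
proof -
  let ?S = "{s. Re s > - 1} - {1 :: complex}"
  have op: "open ?S" by (intro open_Diff open_halfspace_Re_gt) auto
  have "(\<lambda>s. \<Sum>n. zeta_trapezoid (Suc n) s) holomorphic_on ?S"
  proof (rule holomorphic_uniform_sequence[OF op])
    show "(\<lambda>s. \<Sum>i<n. zeta_trapezoid (Suc i) s) holomorphic_on ?S" for n
      unfolding zeta_trapezoid_def by (intro holomorphic_intros) auto
    fix z assume z: "z \<in> ?S"
    obtain d where d: "d > 0" "cball z d \<subseteq> ?S" using op z open_contains_cball by blast
    \<comment> \<open>A majorant that is uniform on the ball needs real parts bounded away from -1;
      compactness provides this.\<close>
    obtain x where x: "x > - 1" "\<And>w. w \<in> cball z d \<Longrightarrow> Re w \<ge> x"
    proof -
      have "\<exists>w\<in>cball z d. \<forall>v\<in>cball z d. Re w \<le> Re v"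
        by (rule continuous_attains_inf) (use d in \<open>auto intro!: continuous_intros\<close>)
      then obtain v where v: "v \<in> cball z d" "\<forall>w\<in>cball z d. Re v \<le> Re w" by blast
      then have "Re v > - 1" using d by auto
      then show ?thesis using that v(2) by blast
    qed
    define K where "K = (norm z + d) * (norm z + d + 1) / 2"
    have "uniform_limit (cball z d) (\<lambda>n s. \<Sum>i<n. zeta_trapezoid (Suc i) s) (\<lambda>s. \<Sum>n. zeta_trapezoid (Suc n) s) sequentially"
    proof (rule Weierstrass_m_test)
      show "summable (\<lambda>n. K * real (Suc n) powr (- x - 2))"
        by (intro summable_mult summable_zeta_trapezoid_bound x)
      fix n w assume w: "w \<in> cball z d"
      have nw: "norm w \<le> norm z + d" using w norm_triangle_sub[of w z] by (simp add: dist_norm norm_minus_commute)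
      then have nw1: "norm (w + 1) \<le> norm z + d + 1" using norm_triangle_ineq[of w 1] by simp
      have "norm (zeta_trapezoid (Suc n) w) \<le> norm w * norm (w + 1) / 2 * real (Suc n) powr (- Re w - 2)"
        using norm_zeta_trapezoid_le[of w "Suc n"] w d by force
      also have "\<dots> \<le> K * real (Suc n) powr (- x - 2)"
        unfolding K_def using x(2)[OF w] d
        by (intro mult_mono divide_right_mono powr_mono nw nw1) auto
      finally show "norm (zeta_trapezoid (Suc n) w) \<le> K * real (Suc n) powr (- x - 2)" .
    qed
    with d show "\<exists>d>0. cball z d \<subseteq> ?S \<and> uniform_limit (cball z d)
        (\<lambda>n s. \<Sum>i<n. zeta_trapezoid (Suc i) s) (\<lambda>s. \<Sum>n. zeta_trapezoid (Suc n) s) sequentially" by blast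
  qed
  then show ?thesis unfolding zeta_right_def by (intro holomorphic_intros) auto
qed

lemma tendsto_of_nat_powr_0:
  assumes "Re w < 0"
  shows "(\<lambda>n. of_nat (Suc n) powr w :: complex) \<longlonglongrightarrow> 0"
proof -
  have "(\<lambda>n. real n powr Re w) \<longlonglongrightarrow> 0"
    by (rule tendsto_neg_powr[OF assms filterlim_real_sequentially])
  then have "(\<lambda>n. real (Suc n) powr Re w) \<longlonglongrightarrow> 0" by (rule LIMSEQ_Suc)
  moreover have "norm (of_nat (Suc n) powr w :: complex) = real (Suc n) powr Re w" for n
    using norm_powr_real_powr[of "complex_of_real (real (Suc n))" w] by simp
  ultimately show ?thesis by (subst tendsto_norm_zero_iff[symmetric]) (simp only:)
qed

lemma zeta_right_sums:
  assumes s: "Re s > 1"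
  shows "(\<lambda>n. 1 / of_nat (Suc n) powr s) sums zeta_right s"
proof -
  have s1: "s \<noteq> 1" using s by auto
  let ?E = "\<Sum>n. zeta_trapezoid (Suc n) s"
  have part: "(\<Sum>k<N. 1 / of_nat (Suc k) powr s) = (\<Sum>k<N. zeta_trapezoid (Suc k) s)
      - (of_nat (Suc N) powr - s - 1) / 2 + (of_nat (Suc N) powr (1 - s) - 1) / (1 - s)" for N
  proof -
    have "(\<Sum>k<N. p (Suc k)) = (\<Sum>k<N. (p (Suc k) + p (Suc k + 1)) / 2 - (q (Suc k + 1) - q (Suc k)) / c)
        - (p (Suc N) - p 1) / 2 + (q (Suc N) - q 1) / c" for p q :: "nat \<Rightarrow> complex" and c
      by (induction N) (simp_all add: add_divide_distrib diff_divide_distrib)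
    from this[of "\<lambda>n. of_nat n powr - s" "\<lambda>n. of_nat n powr (1 - s)" "1 - s"]
    show ?thesis by (simp only: zeta_trapezoid_def powr_minus_divide of_nat_1 powr_one_eq_one div_by_1)
  qed
  have "(\<lambda>N. (\<Sum>k<N. zeta_trapezoid (Suc k) s)
      - (of_nat (Suc N) powr - s - 1) / 2 + (of_nat (Suc N) powr (1 - s) - 1) / (1 - s))
     \<longlonglongrightarrow> ?E - (0 - 1) / 2 + (0 - 1) / (1 - s)"
    using s s1 summable_LIMSEQ[OF summable_zeta_trapezoid[of s]]
    by (intro tendsto_intros tendsto_of_nat_powr_0) auto
  moreover have "?E - (0 - 1) / 2 + (0 - 1) / (1 - s) = zeta_right s"
    using s1 by (simp add: zeta_right_def divide_simps) (simp add: algebra_simps)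
  ultimately show ?thesis unfolding sums_def part by simp
qed

text \<open>The classical factor chi(s) in zeta(s) = chi(s) zeta(1 - s).\<close>

definition zeta_factor :: "complex \<Rightarrow> complex" where
  "zeta_factor s = of_real pi powr (s - 1 / 2) * Gamma ((1 - s) / 2) * rGamma (s / 2)"

text \<open>Given \<open>powr_trapezoid_sums\<close>, the main point is Legendre's duplication
  formula, which turns the quotient Gamma ((1 + s) / 2) / Gamma s into the form used in
  \<open>zeta_factor\<close>.\<close>

lemma zeta_right_functional_equation_real:
  assumes s: "-1 < s" "s < 0"
  shows "zeta_right (of_real s) = zeta_factor (of_real s) * zeta_right (1 - of_real s)"
proof -
  have nat: "of_nat n powr complex_of_real r = of_real (real n powr r)" for n r
    using powr_of_real[of "real n" r] by simp
  have "1 < Re (1 - complex_of_real s)" using s by simp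
  have trm: "1 / of_nat (Suc n) powr (1 - of_real s) = complex_of_real (real (Suc n) powr (s - 1))" for n
    using nat[of "Suc n" "1 - s"] powr_minus_divide[of "real (Suc n)" "1 - s"] by (simp del: of_nat_Suc)
  from zeta_right_sums[OF \<open>1 < Re (1 - complex_of_real s)\<close>]
  have 1: "(\<lambda>n. complex_of_real (real (Suc n) powr (s - 1))) sums zeta_right (1 - of_real s)"
    unfolding trm .
  from sums_Re[OF 1] have "(\<lambda>n. real (Suc n) powr (s - 1)) sums Re (zeta_right (1 - of_real s))"
    by (simp only: Re_complex_of_real)
  then obtain Z where Z: "(\<lambda>n. real (Suc n) powr (s - 1)) sums Z" by blast
  then have Z1: "zeta_right (1 - of_real s) = of_real Z"
    using 1 sums_of_real[OF Z, where 'a = complex] sums_unique2 by blast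
  define G where "G = (2 * pi) powr (s - 1) * (Gamma ((1 + s) / 2) * Gamma ((1 - s) / 2)) / Gamma s"
  have S: "(\<lambda>n. powr_trapezoid (real n) s) sums (G * Z)"
    unfolding G_def by (rule powr_trapezoid_sums[OF s Z])
  have "zeta_trapezoid n (of_real s) = of_real (powr_trapezoid (real n) s)" for n
    using nat[of n "- s"] nat[of n "1 - s"] nat[of "n + 1" "- s"] nat[of "n + 1" "1 - s"]
    unfolding zeta_trapezoid_def powr_trapezoid_def by (simp add: add.commute)
  (* the term at 0, where 0 powr - s = 0, accounts for the part of zeta_right outside the series *)
  moreover have "powr_trapezoid 0 s = 1 / (s - 1) + 1 / 2"
    using s by (simp add: powr_trapezoid_def divide_simps) (simp add: algebra_simps)
  moreover have "(\<lambda>n. powr_trapezoid (real (Suc n)) s) sums (G * Z - powr_trapezoid 0 s)"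
    using S by (subst sums_Suc_iff) simp
  ultimately have "zeta_right (of_real s) = of_real (G * Z)"
  proof -
    assume t: "\<And>n. zeta_trapezoid n (of_real s) = of_real (powr_trapezoid (real n) s)"
      and t0: "powr_trapezoid 0 s = 1 / (s - 1) + 1 / 2"
      and S': "(\<lambda>n. powr_trapezoid (real (Suc n)) s) sums (G * Z - powr_trapezoid 0 s)"
    have "(\<lambda>n. zeta_trapezoid (Suc n) (of_real s)) sums of_real (G * Z - powr_trapezoid 0 s)"
      unfolding t by (rule sums_of_real[OF S'])
    then have "zeta_right (of_real s) = 1 / (of_real s - 1) + 1 / 2 + of_real (G * Z - powr_trapezoid 0 s)"
      unfolding zeta_right_def by (simp add: sums_iff)
    then show ?thesis unfolding t0 by simp
  qed
  moreover have "zeta_factor (of_real s) = of_real G"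
  proof -
    have nn: "s / 2 \<notin> \<int>\<^sub>\<le>\<^sub>0" "s / 2 + 1 / 2 \<notin> \<int>\<^sub>\<le>\<^sub>0" "s \<notin> \<int>\<^sub>\<le>\<^sub>0"
      using s by (auto elim!: nonpos_Ints_cases)
    have nnc: "complex_of_real s / 2 \<notin> \<int>\<^sub>\<le>\<^sub>0" "complex_of_real s / 2 + 1 / 2 \<notin> \<int>\<^sub>\<le>\<^sub>0"
      using s by (auto elim!: nonpos_Ints_cases simp: complex_eq_iff)
    have "complex_of_real (Gamma (s / 2) * Gamma ((1 + s) / 2)) = Gamma (of_real s / 2) * Gamma (of_real s / 2 + 1 / 2)"
      using Gamma_complex_of_real[of "s / 2"] Gamma_complex_of_real[of "(1 + s) / 2"]
      by (simp add: add_divide_distrib add.commute)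
    also have "\<dots> = of_real (exp ((1 - s) * ln 2) * sqrt pi * Gamma s)"
      using Gamma_legendre_duplication[OF nnc] Gamma_complex_of_real[of s]
      by (simp flip: exp_of_real)
    finally have dup: "Gamma (s / 2) * Gamma ((1 + s) / 2) = 2 powr (1 - s) * sqrt pi * Gamma s"
      unfolding of_real_eq_iff by (simp add: powr_def)
    have ne: "Gamma (s / 2) \<noteq> 0" "Gamma s \<noteq> 0" using nn by (auto simp: Gamma_eq_zero_iff)
    have "G = (2 * pi) powr (s - 1) * Gamma ((1 - s) / 2) * (2 powr (1 - s) * sqrt pi) / Gamma (s / 2)"
    proof -
      have "Gamma ((1 + s) / 2) / Gamma s = 2 powr (1 - s) * sqrt pi / Gamma (s / 2)"
        using dup ne by (simp add: frac_eq_eq mult.commute)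
      moreover have "G = (2 * pi) powr (s - 1) * Gamma ((1 - s) / 2) * (Gamma ((1 + s) / 2) / Gamma s)"
        unfolding G_def by simp
      ultimately show ?thesis by simp
    qed
    also have "(2 * pi) powr (s - 1) = 2 powr (s - 1) * pi powr (s - 1)" by (rule powr_mult)
    also have "2 powr (s - 1) * pi powr (s - 1) * Gamma ((1 - s) / 2) * (2 powr (1 - s) * sqrt pi) / Gamma (s / 2)
        = (2 powr (s - 1) * 2 powr (1 - s)) * (pi powr (s - 1) * pi powr (1 / 2)) * Gamma ((1 - s) / 2) / Gamma (s / 2)"
      by (simp add: powr_half_sqrt)
    also have "\<dots> = pi powr (s - 1 / 2) * Gamma ((1 - s) / 2) * rGamma (s / 2)"
      unfolding powr_add[symmetric] by (simp add: Gamma_def field_simps)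
    finally have G: "G = pi powr (s - 1 / 2) * Gamma ((1 - s) / 2) * rGamma (s / 2)" .
    have "of_real pi powr (complex_of_real s - 1 / 2) = of_real (pi powr (s - 1 / 2))"
      by (subst powr_of_real[symmetric]) auto
    moreover have "Gamma ((1 - complex_of_real s) / 2) = of_real (Gamma ((1 - s) / 2))"
      by (subst Gamma_complex_of_real[symmetric]) simp
    moreover have "rGamma (complex_of_real s / 2) = of_real (rGamma (s / 2))"
      by (subst rGamma_complex_of_real[symmetric]) simp
    ultimately show ?thesis
      unfolding G zeta_factor_def by (simp only: of_real_mult)
  qed
  ultimately show ?thesis by (simp only: Z1 of_real_mult)
qed


lemma zeta_right_functional_equation:
  assumes s: "-1 < Re s" "Re s < 0"
  shows "zeta_right s = zeta_factor s * zeta_right (1 - s)"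
proof -
  let ?S = "{s. - 1 < Re s} \<inter> {s. Re s < 0}"
  have S: "open ?S" "connected ?S"
    by (intro open_Int open_halfspace_Re_gt open_halfspace_Re_lt
        convex_connected convex_Int convex_halfspace_Re_gt convex_halfspace_Re_lt)+
  have hol: "(\<lambda>s. zeta_right s - zeta_factor s * zeta_right (1 - s)) holomorphic_on ?S"
  proof -
    have 1: "zeta_right holomorphic_on ?S" by (rule holomorphic_on_subset[OF holomorphic_zeta_right]) auto
    have 2: "(\<lambda>s. zeta_right (1 - s)) holomorphic_on ?S"
      by (rule holomorphic_on_compose_gen[OF _ holomorphic_zeta_right, unfolded o_def])
        (auto intro!: holomorphic_intros)
    have 3: "zeta_factor holomorphic_on ?S"
      unfolding zeta_factor_def
      by (intro holomorphic_intros) (auto elim!: nonpos_Ints_cases simp: complex_eq_iff)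
    show ?thesis by (rule holomorphic_on_diff[OF 1 holomorphic_on_mult[OF 3 2]])
  qed
  have "(\<lambda>s. zeta_right s - zeta_factor s * zeta_right (1 - s)) s = 0"
  proof (rule analytic_continuation[OF hol S, of "of_real ` {-1<..<0}" "of_real (- (1 / 2))"])
    have "(- 1 / 2 :: real) islimpt {-1<..<0}" by (simp add: islimpt_greaterThanLessThan1 open_imp_islimpt)
    then show "complex_of_real (- (1 / 2)) islimpt of_real ` {-1<..<0}"
      unfolding islimpt_approachable
      by (metis (no_types, lifting) dist_of_real image_eqI minus_divide_left of_real_eq_iff)
  qed (use s in \<open>auto simp: zeta_right_functional_equation_real\<close>)
  then show ?thesis by simp
qed

definition zeta_extension :: "complex \<Rightarrow> complex" where
  "zeta_extension s =
     (if s = 1 then 0 else if Re s > - 1 then zeta_right s else zeta_factor s * zeta_right (1 - s))"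

lemma is_zeta_zeta_extension: "is_zeta zeta_extension"
  unfolding is_zeta_def
proof (intro conjI allI impI)
  have 1: "zeta_extension holomorphic_on {s. Re s > - 1} - {1}"
    by (rule holomorphic_transform[OF holomorphic_zeta_right]) (auto simp: zeta_extension_def)
  have 2: "zeta_extension holomorphic_on {s. Re s < 0}"
  proof (rule holomorphic_transform)
    have h1: "(\<lambda>s. zeta_right (1 - s)) holomorphic_on {s. Re s < 0}"
      by (rule holomorphic_on_compose_gen[OF _ holomorphic_zeta_right, unfolded o_def])
        (auto intro!: holomorphic_intros)
    have h2: "zeta_factor holomorphic_on {s. Re s < 0}"
      unfolding zeta_factor_def
      by (intro holomorphic_intros) (auto elim!: nonpos_Ints_cases simp: complex_eq_iff)
    show "(\<lambda>s. zeta_factor s * zeta_right (1 - s)) holomorphic_on {s. Re s < 0}"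
      by (rule holomorphic_on_mult[OF h2 h1])
    fix s assume s: "s \<in> {s. Re s < 0}"
    show "zeta_factor s * zeta_right (1 - s) = zeta_extension s"
    proof (cases "Re s > - 1")
      case True
      then show ?thesis using s zeta_right_functional_equation[of s] by (auto simp: zeta_extension_def)
    qed (use s in \<open>auto simp: zeta_extension_def\<close>)
  qed
  have "zeta_extension holomorphic_on ({s. Re s > - 1} - {1}) \<union> {s. Re s < 0}"
    by (rule holomorphic_on_Un[OF 1 2]) (auto intro!: open_Diff open_halfspace_Re_gt open_halfspace_Re_lt)
  moreover have "({s. Re s > - 1} - {1}) \<union> {s. Re s < 0} = - {1}" by auto
  ultimately show "zeta_extension holomorphic_on - {1}" by simp
next
  fix s assume s: "1 < Re s"
  then have "zeta_extension s = zeta_right s" by (auto simp: zeta_extension_def)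
  then show "(\<lambda>n. 1 / of_nat (Suc n) powr s) sums zeta_extension s" using zeta_right_sums[OF s] by (simp only:)
qed (simp add: zeta_extension_def)

lemma zeta_eq_zeta_extension: "zeta = zeta_extension"
  unfolding zeta_def by (rule the_equality) (auto intro: is_zeta_unique is_zeta_zeta_extension)

section \<open>Zeta itself: functional equation, conjugation, polynomial growth\<close>

lemma is_zeta_zeta: "is_zeta zeta"
  unfolding zeta_eq_zeta_extension by (rule is_zeta_zeta_extension)

lemma holomorphic_zeta: "zeta holomorphic_on - {1}"
  using is_zeta_zeta by (simp add: is_zeta_def)

lemma zeta_sums: "Re s > 1 \<Longrightarrow> (\<lambda>n. 1 / of_nat (Suc n) powr s) sums zeta s"
  using is_zeta_zeta by (simp add: is_zeta_def)

lemma zeta_eq_zeta_right: "s \<noteq> 1 \<Longrightarrow> Re s > - 1 \<Longrightarrow> zeta s = zeta_right s"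
  by (simp add: zeta_eq_zeta_extension zeta_extension_def)

text \<open>With reciprocal Gamma functions on both sides this is an identity between functions
  holomorphic off 0 and 1, with no exceptions at poles of Gamma. It holds by construction for Re s <
  -1 and extends by the identity theorem. The points 0 and 1 are excluded because the value of zeta
  at its pole is only a convention.\<close>

lemma zeta_functional_equation:
  assumes "s \<noteq> 0" "s \<noteq> 1"
  shows "zeta s * rGamma ((1 - s) / 2) = of_real pi powr (s - 1 / 2) * rGamma (s / 2) * zeta (1 - s)"
proof -
  let ?S = "- {0, 1 :: complex}"
  have S: "open ?S" "connected ?S"
    by (auto intro!: connected_open_delete_finite[of UNIV "{0, 1}", unfolded Compl_eq_Diff_UNIV[symmetric]])
  have hol: "(\<lambda>s. zeta s * rGamma ((1 - s) / 2) - of_real pi powr (s - 1 / 2) * rGamma (s / 2) * zeta (1 - s)) holomorphic_on ?S"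
  proof -
    have 1: "zeta holomorphic_on ?S" by (rule holomorphic_on_subset[OF holomorphic_zeta]) auto
    have 2: "(\<lambda>s. zeta (1 - s)) holomorphic_on ?S"
      by (rule holomorphic_on_compose_gen[OF _ holomorphic_zeta, unfolded o_def])
        (auto intro!: holomorphic_intros)
    show ?thesis by (intro holomorphic_intros 1 2) auto
  qed
  have "(\<lambda>s. zeta s * rGamma ((1 - s) / 2) - of_real pi powr (s - 1 / 2) * rGamma (s / 2) * zeta (1 - s)) s = 0"
  proof (rule analytic_continuation[OF hol S, of "{s. Re s < - 1}" "- 2"])
    show "- 2 islimpt {s. Re s < - 1}"
      by (intro interior_limit_point) (simp add: interior_open open_halfspace_Re_lt)
    fix z assume "z \<in> {s. Re s < - 1}"
    then have z: "Re z < - 1" by simp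
    then have "(1 - z) / 2 \<notin> \<int>\<^sub>\<le>\<^sub>0" by (auto elim!: nonpos_Ints_cases simp: complex_eq_iff)
    then have "Gamma ((1 - z) / 2) * rGamma ((1 - z) / 2) = 1" by (simp add: Gamma_def rGamma_eq_zero_iff)
    moreover have "zeta z = zeta_factor z * zeta_right (1 - z)"
      using z by (auto simp: zeta_eq_zeta_extension zeta_extension_def)
    moreover have "zeta (1 - z) = zeta_right (1 - z)" using z by (intro zeta_eq_zeta_right) auto
    moreover have "zeta_factor z * zeta_right (1 - z) * rGamma ((1 - z) / 2)
        = of_real pi powr (z - 1 / 2) * rGamma (z / 2) * zeta_right (1 - z) * (Gamma ((1 - z) / 2) * rGamma ((1 - z) / 2))"
      by (simp only: zeta_factor_def mult_ac)
    ultimately show "zeta z * rGamma ((1 - z) / 2) - of_real pi powr (z - 1 / 2) * rGamma (z / 2) * zeta (1 - z) = 0"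
      by (simp only: mult_1_right diff_self)
  qed (use assms in auto)
  then show ?thesis by (simp only: right_minus_eq)
qed

text \<open>The conjugated function satisfies \<open>is_zeta\<close> as well, so uniqueness gives
  the symmetry.\<close>

lemma zeta_cnj: "zeta (cnj s) = cnj (zeta s)"
proof -
  have "is_zeta (cnj \<circ> zeta \<circ> cnj)"
    unfolding is_zeta_def
  proof (intro conjI allI impI)
    have "cnj ` (- {1}) = - {1}" unfolding image_cnj_conv_vimage_cnj by auto
    then show "cnj \<circ> zeta \<circ> cnj holomorphic_on - {1}"
      by (intro holomorphic_on_compose_cnj_cnj) (auto intro: holomorphic_zeta)
    fix s :: complex assume "1 < Re s"
    then have "1 < Re (cnj s)" by simp
    from bounded_linear.sums[OF bounded_linear_cnj zeta_sums[OF this]]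
    have "(\<lambda>n. cnj (1 / of_nat (Suc n) powr cnj s)) sums cnj (zeta (cnj s))" .
    moreover have "cnj (1 / of_nat (Suc n) powr cnj s) = 1 / of_nat (Suc n) powr s" for n
      using cnj_powr[of "of_nat (Suc n)" "cnj s"] by (simp del: of_nat_Suc)
    ultimately show "(\<lambda>n. 1 / of_nat (Suc n) powr s) sums (cnj \<circ> zeta \<circ> cnj) s" by (simp only: o_def)
  qed (use is_zeta_zeta in \<open>simp add: is_zeta_def\<close>)
  from fun_cong[OF is_zeta_unique[OF this is_zeta_zeta], of "cnj s"] show ?thesis by simp
qed

text \<open>The quadratic growth is the factor |s| |s + 1| of the single trapezoid errors; the
  remaining series is majorised by its value at abscissa 1/2. This is the source of the exponent 4
  in \<open>critical_square_upper_bound\<close>.\<close>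

lemma zeta_minus_pole_bound:
  obtains C :: real where "C > 0"
    "\<And>s. Re s \<ge> 1 / 2 \<Longrightarrow> s \<noteq> 1 \<Longrightarrow> norm (zeta s - 1 / (s - 1)) \<le> C * (norm s + 1)\<^sup>2"
proof -
  define K where "K = (\<Sum>n. real (Suc n) powr (- (1 / 2) - 2))"
  have sm: "summable (\<lambda>n. real (Suc n) powr (- (1 / 2) - 2))"
    by (rule summable_zeta_trapezoid_bound) simp
  have K: "K \<ge> 0" unfolding K_def by (rule suminf_nonneg[OF sm]) simp
  have "norm (zeta s - 1 / (s - 1)) \<le> (1 + K) * (norm s + 1)\<^sup>2" if s: "Re s \<ge> 1 / 2" "s \<noteq> 1" for s
  proof -
    have t: "norm (zeta_trapezoid (Suc n) s) \<le> (norm s + 1)\<^sup>2 * real (Suc n) powr (- (1 / 2) - 2)" for n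
    proof -
      have "norm (zeta_trapezoid (Suc n) s) \<le> norm s * norm (s + 1) / 2 * real (Suc n) powr (- Re s - 2)"
        by (rule norm_zeta_trapezoid_le) (use s in auto)
      also have "norm s * norm (s + 1) / 2 \<le> norm s * norm (s + 1)" by simp
      also have "norm s * norm (s + 1) \<le> (norm s + 1) * (norm s + 1)"
        using norm_triangle_ineq[of s 1] by (intro mult_mono) auto
      also have "real (Suc n) powr (- Re s - 2) \<le> real (Suc n) powr (- (1 / 2) - 2)"
        by (rule powr_mono) (use s in auto)
      finally show ?thesis by (simp add: power2_eq_square mult_right_mono mult_left_mono)
    qed
    have "norm (\<Sum>n. zeta_trapezoid (Suc n) s) \<le> (\<Sum>n. (norm s + 1)\<^sup>2 * real (Suc n) powr (- (1 / 2) - 2))"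
      by (rule norm_suminf_le[OF t summable_mult[OF sm]])
    also have "\<dots> = (norm s + 1)\<^sup>2 * K" unfolding K_def by (rule suminf_mult[OF sm])
    finally have "norm (\<Sum>n. zeta_trapezoid (Suc n) s) \<le> (norm s + 1)\<^sup>2 * K" .
    moreover have "zeta s - 1 / (s - 1) = 1 / 2 + (\<Sum>n. zeta_trapezoid (Suc n) s)"
      using s by (subst zeta_eq_zeta_right) (auto simp: zeta_right_def)
    moreover have "norm (1 / 2 :: complex) \<le> (norm s + 1)\<^sup>2"
    proof -
      have "1 \<le> (norm s + 1)\<^sup>2" by (rule one_le_power) simp
      moreover have "norm (1 / 2 :: complex) = 1 / 2" by simp
      ultimately show ?thesis by linarith
    qed
    ultimately show ?thesis
      using norm_triangle_ineq[of "1 / 2 :: complex" "\<Sum>n. zeta_trapezoid (Suc n) s"]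
      by (simp add: distrib_right mult.commute)
  qed
  with K show ?thesis by (intro that[of "1 + K"]) auto
qed

section \<open>Non-vanishing of zeta for real part at least 1\<close>

definition rough_numbers :: "nat \<Rightarrow> nat set" where
  "rough_numbers N = {n. n > 0 \<and> (\<forall>p. prime p \<and> p dvd n \<longrightarrow> p > N)}"

lemma rough_numbers_mult_prime:
  assumes "prime p" "p = Suc N"
  shows "rough_numbers N - rough_numbers p = (*) p ` rough_numbers N"
proof (intro set_eqI iffI)
  fix n assume n: "n \<in> rough_numbers N - rough_numbers p"
  then have N: "n > 0" "\<forall>q. prime q \<and> q dvd n \<longrightarrow> q > N" and "\<not> (\<forall>q. prime q \<and> q dvd n \<longrightarrow> q > p)"
    unfolding rough_numbers_def by blast+
  then obtain q where q: "prime q" "q dvd n" "\<not> q > p" by blast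
  then have "q > N" using N by blast
  then have "q = p" using q(3) assms by linarith
  then obtain m where m: "n = p * m" using q by blast
  then have "m \<in> rough_numbers N" using N by (simp add: rough_numbers_def)
  then show "n \<in> (*) p ` rough_numbers N" using m by blast
next
  fix n assume "n \<in> (*) p ` rough_numbers N"
  then obtain m where m: "n = p * m" "m \<in> rough_numbers N" by blast
  have "q > N" if "prime q" "q dvd n" for q
  proof -
    have "q dvd p \<or> q dvd m" using that m(1) by (simp only: prime_dvd_mult_iff)
    then show ?thesis
    proof
      assume "q dvd p"
      then have "q = p" using that assms(1) primes_dvd_imp_eq by blast
      then show ?thesis using assms(2) by simp
    qed (use m(2) that in \<open>simp add: rough_numbers_def\<close>)
  qed
  moreover have "n > 0" using m assms by (simp add: rough_numbers_def)
  moreover have "p dvd n" using m by simp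
  ultimately show "n \<in> rough_numbers N - rough_numbers p"
    using assms(1) unfolding rough_numbers_def by blast
qed

lemma rough_numbers_Suc_not_prime:
  assumes "\<not> prime (Suc N)"
  shows "rough_numbers (Suc N) = rough_numbers N"
  using assms unfolding rough_numbers_def by (auto simp: less_Suc_eq) (metis Suc_lessI)

definition euler_factor :: "nat \<Rightarrow> complex \<Rightarrow> complex" where
  "euler_factor p s = 1 - of_nat p powr - s"

definition inverse_euler_product :: "nat \<Rightarrow> complex \<Rightarrow> complex" where
  "inverse_euler_product N s = (\<Prod>p\<in>{p. prime p \<and> p \<le> N}. euler_factor p s)"

lemma norm_of_nat_powr: "norm (of_nat n powr z :: complex) = real n powr Re z"
  using norm_powr_real_powr[of "of_nat n" z] by simp

lemma powr_summable_on:
  assumes "Re s > 1"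
  shows "(\<lambda>n. of_nat n powr - s :: complex) summable_on A"
proof -
  have "summable (\<lambda>n. norm (of_nat n powr - s :: complex))"
    unfolding norm_of_nat_powr using assms summable_real_powr_iff[of "- Re s"] by simp
  then have "(\<lambda>n. of_nat n powr - s :: complex) summable_on UNIV"
    by (rule norm_summable_imp_summable_on)
  then show ?thesis by (rule summable_on_subset_banach) simp
qed

lemma zeta_eq_infsum:
  assumes s: "Re s > 1"
  shows "zeta s = (\<Sum>\<^sub>\<infinity>n\<in>rough_numbers 0. of_nat n powr - s)"
proof -
  have "(\<Sum>\<^sub>\<infinity>n\<in>rough_numbers 0. of_nat n powr - s) = (\<Sum>\<^sub>\<infinity>n. of_nat n powr - s)"
    by (rule infsum_cong_neutral) (auto simp: rough_numbers_def prime_gt_0_nat)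
  moreover have "(\<lambda>n. of_nat n powr - s) sums (\<Sum>\<^sub>\<infinity>n. of_nat n powr - s :: complex)"
    by (rule has_sum_imp_sums[OF has_sum_infsum[OF powr_summable_on[OF s]]])
  moreover have "(\<lambda>n. of_nat n powr - s) sums zeta s"
  proof -
    have "(\<lambda>n. of_nat (Suc n) powr - s) sums zeta s"
      using zeta_sums[OF s] by (simp only: powr_minus_divide)
    from sums_Suc[OF this] show ?thesis by simp
  qed
  ultimately show ?thesis using sums_unique2 by simp
qed

text \<open>Sieve of Eratosthenes on the Dirichlet series: multiplying by the factor of the prime p
  subtracts the terms whose index is p times a surviving number, and these are exactly the survivors
  divisible by p.\<close>

lemma zeta_times_inverse_euler_product:
  assumes s: "Re s > 1"
  shows "inverse_euler_product N s * zeta s = (\<Sum>\<^sub>\<infinity>n\<in>rough_numbers N. of_nat n powr - s)"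
proof (induction N)
  case 0
  have "{p :: nat. prime p \<and> p \<le> 0} = {}" by auto
  then show ?case unfolding inverse_euler_product_def zeta_eq_infsum[OF s] by (simp only: prod.empty mult_1)
next
  case (Suc N)
  show ?case
  proof (cases "prime (Suc N)")
    case False
    then have "{p. prime p \<and> p \<le> Suc N} = {p. prime p \<and> p \<le> N}" by (auto simp: le_Suc_eq)
    then show ?thesis
      using Suc unfolding inverse_euler_product_def rough_numbers_Suc_not_prime[OF False] by (simp only:)
  next
    case True
    define p where "p = Suc N"
    have sub: "rough_numbers p \<subseteq> rough_numbers N" by (auto simp: rough_numbers_def p_def)
    have "{q. prime q \<and> q \<le> Suc N} = insert p {q. prime q \<and> q \<le> N}" using True by (auto simp: le_Suc_eq p_def)
    then have "inverse_euler_product (Suc N) s = euler_factor p s * inverse_euler_product N s"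
      unfolding inverse_euler_product_def by (simp add: p_def)
    then have "inverse_euler_product (Suc N) s * zeta s
        = euler_factor p s * (\<Sum>\<^sub>\<infinity>n\<in>rough_numbers N. of_nat n powr - s)" using Suc by (simp add: mult.assoc)
    also have "\<dots> = (\<Sum>\<^sub>\<infinity>n\<in>rough_numbers N. of_nat n powr - s)
        - of_nat p powr - s * (\<Sum>\<^sub>\<infinity>n\<in>rough_numbers N. of_nat n powr - s)"
      by (simp add: euler_factor_def algebra_simps)
    also have "of_nat p powr - s * (\<Sum>\<^sub>\<infinity>n\<in>rough_numbers N. of_nat n powr - s)
        = (\<Sum>\<^sub>\<infinity>n\<in>rough_numbers N. of_nat p powr - s * of_nat n powr - s)"
      by (rule infsum_cmult_right'[symmetric])
    also have "\<dots> = (\<Sum>\<^sub>\<infinity>n\<in>rough_numbers N. of_nat (p * n) powr - s)"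
    proof (rule infsum_cong)
      fix n :: nat
      show "of_nat p powr - s * of_nat n powr - s = (of_nat (p * n) powr - s :: complex)"
        using powr_times_real[of "of_nat p" "of_nat n" "- s"] by simp
    qed
    also have "\<dots> = (\<Sum>\<^sub>\<infinity>n\<in>(*) p ` rough_numbers N. of_nat n powr - s)"
    proof -
      have "p > 0" by (simp add: p_def)
      then have "inj_on ((*) p) (rough_numbers N)" by (simp add: inj_on_def)
      from infsum_reindex[OF this, of "\<lambda>n. of_nat n powr - s"] show ?thesis by (simp only: o_def)
    qed
    also have "(*) p ` rough_numbers N = rough_numbers N - rough_numbers p"
      by (rule rough_numbers_mult_prime[symmetric]) (use True in \<open>auto simp: p_def\<close>)
    also have "(\<Sum>\<^sub>\<infinity>n\<in>rough_numbers N - rough_numbers p. of_nat n powr - s)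
        = (\<Sum>\<^sub>\<infinity>n\<in>rough_numbers N. of_nat n powr - s) - (\<Sum>\<^sub>\<infinity>n\<in>rough_numbers p. of_nat n powr - s)"
      by (rule infsum_Diff[OF powr_summable_on[OF s] powr_summable_on[OF s] sub])
    finally show ?thesis by (simp add: p_def)
  qed
qed

text \<open>A rough number other than 1 is greater than \<open>N\<close>, so the distance to 1 is at
  most a tail of an absolutely convergent series. Stating the limit for the inverse product times
  zeta yields non-vanishing without any division.\<close>

lemma inverse_euler_product_tendsto:
  assumes s: "Re s > 1"
  shows "(\<lambda>N. inverse_euler_product N s * zeta s) \<longlonglongrightarrow> 1"
proof -
  define f where "f = (\<lambda>n. of_nat n powr - s :: complex)"
  have sm: "summable (\<lambda>n. norm (f n))"
    unfolding norm_of_nat_powr f_def using s summable_real_powr_iff[of "- Re s"] by simp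
  have le: "norm (inverse_euler_product N s * zeta s - 1) \<le> (\<Sum>n. norm (f (n + N)))" for N
  proof -
    have 1: "1 \<in> rough_numbers N" by (auto simp: rough_numbers_def)
    have "inverse_euler_product N s * zeta s = (\<Sum>\<^sub>\<infinity>n\<in>rough_numbers N. f n)"
      unfolding f_def by (rule zeta_times_inverse_euler_product[OF s])
    also have "\<dots> = (\<Sum>\<^sub>\<infinity>n\<in>{1} \<union> (rough_numbers N - {1}). f n)" using 1 by (simp add: insert_absorb)
    also have "\<dots> = (\<Sum>\<^sub>\<infinity>n\<in>{1}. f n) + (\<Sum>\<^sub>\<infinity>n\<in>rough_numbers N - {1}. f n)"
      unfolding f_def by (rule infsum_Un_disjoint[OF powr_summable_on[OF s] powr_summable_on[OF s]]) auto
    also have "(\<Sum>\<^sub>\<infinity>n\<in>{1}. f n) = 1" by (simp add: f_def)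
    finally have "norm (inverse_euler_product N s * zeta s - 1) = norm (\<Sum>\<^sub>\<infinity>n\<in>rough_numbers N - {1}. f n)" by simp
    also have nsum: "(\<lambda>n. norm (f n)) summable_on UNIV"
      by (rule summable_nonneg_imp_summable_on[OF sm]) simp
    have "norm (\<Sum>\<^sub>\<infinity>n\<in>rough_numbers N - {1}. f n) \<le> (\<Sum>\<^sub>\<infinity>n\<in>rough_numbers N - {1}. norm (f n))"
      by (intro norm_infsum_bound summable_on_subset_banach[OF nsum]) simp
    also have "\<dots> \<le> (\<Sum>\<^sub>\<infinity>n\<in>range (\<lambda>n. n + N). norm (f n))"
    proof (rule infsum_mono_neutral)
      fix n assume n: "n \<in> rough_numbers N - {1} - range (\<lambda>n. n + N)"
      then have "n < N" by (metis DiffD2 add.commute le_Suc_ex not_le rangeI)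
      obtain p where p: "prime p" "p dvd n" using n prime_factor_nat[of n] by auto
      then have "p > N" "p \<le> n" using n by (auto simp: rough_numbers_def dvd_imp_le)
      then show "norm (f n) \<le> 0" using \<open>n < N\<close> by simp
    qed (auto intro: summable_on_subset_banach[OF nsum])
    also have "\<dots> = (\<Sum>\<^sub>\<infinity>n. norm (f (n + N)))"
      by (subst infsum_reindex) (auto simp: o_def inj_on_def)
    also have "\<dots> = (\<Sum>n. norm (f (n + N)))"
    proof -
      have "(\<lambda>n. norm (f (n + N))) summable_on UNIV"
        by (rule summable_nonneg_imp_summable_on) (use summable_ignore_initial_segment[OF sm] in auto)
      from sums_unique[OF has_sum_imp_sums[OF has_sum_infsum[OF this]]] show ?thesis .
    qed
    finally show ?thesis .
  qed
  have lim: "(\<lambda>N. \<Sum>n. norm (f (n + N))) \<longlonglongrightarrow> 0"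
    by (rule suminf_exist_split2[OF sm])
  have "(\<lambda>N. inverse_euler_product N s * zeta s - 1) \<longlonglongrightarrow> 0"
    by (rule Lim_null_comparison[OF always_eventually lim]) (rule allI, rule le)
  then show ?thesis by (rule LIM_zero_cancel)
qed

lemma zeta_nonzero_right:
  assumes "Re s > 1"
  shows "zeta s \<noteq> 0"
  using inverse_euler_product_tendsto[OF assms] LIMSEQ_unique[of "\<lambda>_. 0::complex" 0 1] by auto

text \<open>After taking logarithms, the power series of ln |1 - z| reduces the claim in each degree
  to 3 + 4 cos \<theta> + cos (2 \<theta>) = 2 (1 + cos \<theta>)^2 \<ge> 0.\<close>

lemma three_four_one:
  fixes z w :: complex
  assumes z: "norm w = 1" and x: "0 \<le> x" "x < 1"
  shows "norm (1 - complex_of_real x) ^ 3 * norm (1 - of_real x * w) ^ 4 * norm (1 - of_real x * w\<^sup>2) \<le> 1"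
proof -
  have L: "(\<lambda>n. - Re (z ^ n) / real n) sums ln (norm (1 - z))" if "norm z < 1" for z :: complex
  proof -
    have "1 - z \<noteq> 0" using that by auto
    have "(\<lambda>n. - (z ^ n) / of_nat n) sums Ln (1 - z)" using Ln_series'[of "- z"] that by simp
    from sums_Re[OF this] show ?thesis using \<open>1 - z \<noteq> 0\<close> by simp
  qed
  have n: "norm (of_real x :: complex) < 1" "norm (of_real x * w) < 1" "norm (of_real x * w\<^sup>2) < 1"
    using z x by (auto simp: norm_mult norm_power)
  let ?a = "norm (1 - complex_of_real x)" and ?b = "norm (1 - of_real x * w)" and ?c = "norm (1 - of_real x * w\<^sup>2)"
  have pos: "?a > 0" "?b > 0" "?c > 0" using n by (auto simp: algebra_simps)
  have S: "(\<lambda>m. 3 * (- Re ((complex_of_real x) ^ m) / real m) + 4 * (- Re ((of_real x * w) ^ m) / real m) + - Re ((of_real x * w\<^sup>2) ^ m) / real m)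
      sums (3 * ln ?a + 4 * ln ?b + ln ?c)"
    by (intro sums_add sums_mult L n)
  have T: "3 * (- Re ((complex_of_real x) ^ m) / real m) + 4 * (- Re ((of_real x * w) ^ m) / real m) + - Re ((of_real x * w\<^sup>2) ^ m) / real m \<le> 0" for m
  proof -
    define v where "v = w ^ m"
    have v: "(Re v)\<^sup>2 + (Im v)\<^sup>2 = 1" using z by (simp add: v_def norm_power flip: cmod_power2)
    have Re_v: "Re (v\<^sup>2) = 2 * (Re v)\<^sup>2 - 1" using v by (simp add: power2_eq_square)
    have "3 + 4 * Re v + Re (v\<^sup>2) = 2 * (1 + Re v)\<^sup>2" unfolding Re_v by (simp add: power2_eq_square algebra_simps)
    then have "3 + 4 * Re v + Re (v\<^sup>2) \<ge> 0" by simp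
    then have "x ^ m * (3 + 4 * Re v + Re (v\<^sup>2)) / real m \<ge> 0" using x by simp
    moreover have "(complex_of_real x) ^ m = of_real (x ^ m)" by simp
    moreover have "(of_real x * w) ^ m = of_real (x ^ m) * v"
      by (simp only: power_mult_distrib v_def of_real_power)
    moreover have "(of_real x * w\<^sup>2) ^ m = of_real (x ^ m) * v\<^sup>2"
      by (simp only: power_mult_distrib v_def of_real_power power_mult[symmetric] mult.commute)
    moreover have "3 * (- a / k) + 4 * (- (a * b) / k) + - (a * d) / k = - (a * (3 + 4 * b + d) / k)" for a b d k :: real
      unfolding divide_inverse by algebra
    moreover have "Re (of_real a * z) = a * Re z" for a z by simp
    ultimately show ?thesis by (simp only: Re_complex_of_real neg_le_0_iff_le)
  qed
  have "3 * ln ?a + 4 * ln ?b + ln ?c \<le> 0" by (rule sums_le[OF T S sums_zero])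
  then have "ln (?a ^ 3 * ?b ^ 4 * ?c) \<le> 0" using pos by (simp add: ln_mult ln_realpow)
  then show ?thesis using pos by simp
qed

text \<open>The inequality for single primes is multiplied over the primes up to \<open>N\<close>.
  It bounds inverse Euler products from above, hence in the limit zeta values from below.\<close>

lemma zeta_three_four_one:
  assumes x: "x > 1"
  shows "1 \<le> norm (zeta (of_real x)) ^ 3 * norm (zeta (Complex x y)) ^ 4 * norm (zeta (Complex x (2 * y)))"
proof -
  let ?s = "complex_of_real x" and ?t = "Complex x y" and ?u = "Complex x (2 * y)"
  have Re: "Re ?s > 1" "Re ?t > 1" "Re ?u > 1" using x by auto
  let ?I = inverse_euler_product
  have fac: "norm (euler_factor p ?s) ^ 3 * norm (euler_factor p ?t) ^ 4 * norm (euler_factor p ?u) \<le> 1" if p: "prime p" for p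
  proof -
    define w where "w = exp (- \<i> * of_real (y * ln (real p)))"
    define r where "r = real p powr - x"
    have p1: "real p > 1" using prime_gt_1_nat[OF p] by simp
    have pw: "of_nat p powr - Complex x v = of_real r * exp (- \<i> * of_real (v * ln (real p)))" for v
    proof -
      have "of_nat p powr - Complex x v = exp (of_real (- x * ln (real p)) + (- \<i> * of_real (v * ln (real p))))"
        using p1 Ln_of_real[of "real p"] by (simp add: powr_def Complex_eq algebra_simps)
      also have "\<dots> = of_real r * exp (- \<i> * of_real (v * ln (real p)))"
        using p1 unfolding exp_add by (simp add: r_def powr_def flip: exp_of_real)
      finally show ?thesis .
    qed
    have s: "?s = Complex x 0" by (simp add: complex_eq_iff)
    have w2: "exp (- \<i> * of_real (2 * y * ln (real p))) = w\<^sup>2"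
      unfolding w_def power2_eq_square exp_add[symmetric] by (rule arg_cong[of _ _ exp]) simp
    have "norm w = 1" unfolding w_def by simp
    moreover have "0 \<le> r" "r < 1" using p1 x by (auto simp: r_def powr_less_one)
    ultimately show ?thesis
      using three_four_one[of w r] unfolding euler_factor_def s pw w2 w_def[symmetric] by simp
  qed
  have le: "norm (?I N ?s) ^ 3 * norm (?I N ?t) ^ 4 * norm (?I N ?u) \<le> 1" for N
  proof -
    let ?P = "{p. prime p \<and> p \<le> N}"
    have "(\<Prod>p\<in>?P. norm (euler_factor p ?s) ^ 3 * norm (euler_factor p ?t) ^ 4 * norm (euler_factor p ?u)) \<le> 1"
      by (rule prod_le_1) (use fac in auto)
    then show ?thesis
      unfolding inverse_euler_product_def by (simp only: prod.distrib prod_power_distrib[symmetric] prod_norm)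
  qed
  have "(\<lambda>N. norm (?I N ?s * zeta ?s) ^ 3 * norm (?I N ?t * zeta ?t) ^ 4 * norm (?I N ?u * zeta ?u))
     \<longlonglongrightarrow> norm (1 :: complex) ^ 3 * norm (1 :: complex) ^ 4 * norm (1 :: complex)"
    by (intro tendsto_intros inverse_euler_product_tendsto Re)
  then have lim: "(\<lambda>N. norm (?I N ?s * zeta ?s) ^ 3 * norm (?I N ?t * zeta ?t) ^ 4 * norm (?I N ?u * zeta ?u)) \<longlonglongrightarrow> 1"
    by simp
  have "norm (?I N ?s * zeta ?s) ^ 3 * norm (?I N ?t * zeta ?t) ^ 4 * norm (?I N ?u * zeta ?u)
     \<le> norm (zeta ?s) ^ 3 * norm (zeta ?t) ^ 4 * norm (zeta ?u)" for N
  proof -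
    have "norm (?I N ?s * zeta ?s) ^ 3 * norm (?I N ?t * zeta ?t) ^ 4 * norm (?I N ?u * zeta ?u)
       = (norm (?I N ?s) ^ 3 * norm (?I N ?t) ^ 4 * norm (?I N ?u)) * (norm (zeta ?s) ^ 3 * norm (zeta ?t) ^ 4 * norm (zeta ?u))"
      by (simp only: norm_mult power_mult_distrib mult_ac)
    also have "\<dots> \<le> 1 * (norm (zeta ?s) ^ 3 * norm (zeta ?t) ^ 4 * norm (zeta ?u))"
      by (rule mult_right_mono[OF le]) simp
    finally show ?thesis by simp
  qed
  then show ?thesis by (intro LIMSEQ_le_const2[OF lim]) auto
qed

text \<open>
  A zero at \<open>1 + i y\<close> would make the product in \<open>zeta_three_four_one\<close> of order \<open>(x - 1)\<^sup>4 / (x - 1)\<^sup>3\<close> as \<open>x\<close> tends to 1.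
\<close>

lemma zeta_nonzero_line_1:
  assumes y: "y \<noteq> 0"
  shows "zeta (Complex 1 y) \<noteq> 0"
proof
  assume z: "zeta (Complex 1 y) = 0"
  have op: "open (- {1 :: complex})" by auto
  have cv: "(\<lambda>x. Complex x v) \<midarrow>1\<rightarrow> Complex 1 v" for v
    unfolding Complex_eq by (intro tendsto_intros)
  have right: "filterlim (\<lambda>x. Complex x v) (at (Complex 1 v)) (at_right 1)" for v
    using cv[of v] by (auto simp: filterlim_at eventually_at_filter complex_eq_iff intro: tendsto_mono[OF at_le])
  have 1: "((\<lambda>x. norm (zeta (Complex x y)) / norm (Complex x y - Complex 1 y)) \<longlongrightarrow> norm (deriv zeta (Complex 1 y))) (at_right 1)"
  proof -
    have "(zeta has_field_derivative deriv zeta (Complex 1 y)) (at (Complex 1 y))"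
      by (rule holomorphic_derivI[OF holomorphic_zeta op]) (use y in \<open>auto simp: complex_eq_iff\<close>)
    then have "((\<lambda>s. (zeta s - zeta (Complex 1 y)) / (s - Complex 1 y)) \<longlongrightarrow> deriv zeta (Complex 1 y)) (at (Complex 1 y))"
      unfolding has_field_derivative_iff .
    from tendsto_norm[OF filterlim_compose[OF this right]] z show ?thesis by (simp add: norm_divide)
  qed
  have 2: "((\<lambda>x. norm (zeta (Complex x (2 * y)))) \<longlongrightarrow> norm (zeta (Complex 1 (2 * y)))) (at_right 1)"
  proof -
    have "isCont zeta (Complex 1 (2 * y))"
      using holomorphic_on_imp_continuous_on[OF holomorphic_zeta] op y
      by (auto simp: continuous_on_eq_continuous_at complex_eq_iff)
    then have "(zeta \<longlongrightarrow> zeta (Complex 1 (2 * y))) (at (Complex 1 (2 * y)))" by (simp add: isCont_def)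
    from tendsto_norm[OF filterlim_compose[OF this right]] show ?thesis .
  qed
  obtain C where C: "C > 0" "\<And>s. Re s \<ge> 1 / 2 \<Longrightarrow> s \<noteq> 1 \<Longrightarrow> norm (zeta s - 1 / (s - 1)) \<le> C * (norm s + 1)\<^sup>2"
    using zeta_minus_pole_bound by blast
  define K where "K = C * 9 + 1"
  have K: "norm (zeta (of_real x)) \<le> K / (x - 1)" if x: "1 < x" "x < 2" for x
  proof -
    have "norm (zeta (of_real x) - 1 / (of_real x - 1)) \<le> C * (norm (complex_of_real x) + 1)\<^sup>2"
      by (rule C(2)) (use x in auto)
    also have "\<dots> \<le> C * 3\<^sup>2" using x C by (intro mult_left_mono power_mono) auto
    finally have "norm (zeta (of_real x)) \<le> C * 9 + norm (1 / (complex_of_real x - 1))"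
      using norm_triangle_sub[of "zeta (of_real x)" "1 / (complex_of_real x - 1)"] by simp
    also have "norm (1 / (complex_of_real x - 1)) = 1 / (x - 1)"
      using x norm_of_real[of "1 / (x - 1)", where 'a = complex] by simp
    also have "C * 9 + 1 / (x - 1) \<le> K / (x - 1)"
    proof -
      have "C * 9 * (x - 1) \<le> C * 9" using x C by (intro mult_left_le) auto
      then have "C * 9 \<le> C * 9 / (x - 1)" using x by (simp add: pos_le_divide_eq)
      then show ?thesis by (simp add: K_def add_divide_distrib)
    qed
    finally show ?thesis .
  qed
  have lim0: "((\<lambda>x. K ^ 3 * (norm (zeta (Complex x y)) / norm (Complex x y - Complex 1 y)) ^ 4 * (x - 1) * norm (zeta (Complex x (2 * y))))
     \<longlongrightarrow> K ^ 3 * norm (deriv zeta (Complex 1 y)) ^ 4 * (1 - 1) * norm (zeta (Complex 1 (2 * y)))) (at_right 1)"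
    by (intro tendsto_intros 1 2)
  have "eventually (\<lambda>x. 1 \<le> K ^ 3 * (norm (zeta (Complex x y)) / norm (Complex x y - Complex 1 y)) ^ 4 * (x - 1) * norm (zeta (Complex x (2 * y)))) (at_right (1::real))"
    unfolding eventually_at_right_field
  proof (intro exI[of _ 2] conjI allI impI)
    fix x :: real assume x: "1 < x" "x < 2"
    have n: "norm (Complex x y - Complex 1 y) = x - 1"
    proof -
      have "Complex x y - Complex 1 y = of_real (x - 1)" by (simp add: complex_eq_iff)
      then show ?thesis using x by (simp only: norm_of_real)
    qed
    have "1 \<le> norm (zeta (of_real x)) ^ 3 * norm (zeta (Complex x y)) ^ 4 * norm (zeta (Complex x (2 * y)))"
      by (rule zeta_three_four_one) fact
    also have "\<dots> \<le> (K / (x - 1)) ^ 3 * norm (zeta (Complex x y)) ^ 4 * norm (zeta (Complex x (2 * y)))"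
      using K[OF x] by (intro mult_right_mono power_mono) auto
    also have "\<dots> = K ^ 3 * (norm (zeta (Complex x y)) / norm (Complex x y - Complex 1 y)) ^ 4 * (x - 1) * norm (zeta (Complex x (2 * y)))"
      unfolding n using x by (simp add: power_divide divide_simps) (simp add: power_numeral_reduce algebra_simps)
    finally show "1 \<le> K ^ 3 * (norm (zeta (Complex x y)) / norm (Complex x y - Complex 1 y)) ^ 4 * (x - 1) * norm (zeta (Complex x (2 * y)))" .
  qed simp
  from tendsto_lowerbound[OF lim0 this] show False by simp
qed

section \<open>Growth of Gamma on vertical lines\<close>

lemma norm_Gamma_series_complex:
  assumes x: "x > 0"
  shows "norm (Gamma_series (Complex x u) n) / Gamma_series x n = (\<Prod>k\<le>n. (x + real k) / norm (Complex (x + real k) u))"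
proof -
  have P: "pochhammer z (n + 1) = (\<Prod>k\<le>n. z + of_nat k)" for z :: "'a :: comm_semiring_1"
    by (simp only: pochhammer_prod atLeast0LessThan Suc_eq_plus1[symmetric] lessThan_Suc_atMost)
  have c: "Complex x u + of_nat k = Complex (x + real k) u" for k by (simp add: complex_eq_iff)
  have ne: "Complex (x + real k) u \<noteq> 0" for k using x by (simp add: complex_eq_iff)
  have "norm (exp (Complex x u * of_real (ln (real n)))) = exp (x * ln (real n))"
    by simp
  then have "norm (Gamma_series (Complex x u) n) = fact n * exp (x * ln (real n)) / (\<Prod>k\<le>n. norm (Complex (x + real k) u))"
    unfolding Gamma_series_def norm_divide norm_mult P prod_norm[symmetric] c by simp
  moreover have "Gamma_series x n = fact n * exp (x * ln (real n)) / (\<Prod>k\<le>n. x + real k)"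
    unfolding Gamma_series_def P by simp
  moreover have "(\<Prod>k\<le>n. x + real k) > 0" using x by (intro prod_pos) auto
  moreover have "(\<Prod>k\<le>n. norm (Complex (x + real k) u)) > 0" using ne by (intro prod_pos) auto
  ultimately show ?thesis by (simp add: prod_dividef)
qed

text \<open>Dividing by Gamma at the real point turns Euler's limit into a limit of products of
  factors a / |a + i u|, each of which increases with a.\<close>

lemma norm_Gamma_quotient_mono:
  assumes "0 < x" "x \<le> y"
  shows "norm (Gamma (Complex x u)) / Gamma x \<le> norm (Gamma (Complex y u)) / Gamma y"
proof (rule LIMSEQ_le)
  have lim: "(\<lambda>n. norm (Gamma_series (Complex x u) n) / Gamma_series x n) \<longlonglongrightarrow> norm (Gamma (Complex x u)) / Gamma x"
    if "x > 0" for x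
    using Gamma_real_pos[OF that] by (intro tendsto_intros Gamma_series_LIMSEQ) auto
  show "(\<lambda>n. norm (Gamma_series (Complex x u) n) / Gamma_series x n) \<longlonglongrightarrow> norm (Gamma (Complex x u)) / Gamma x"
    by (rule lim) (use assms in auto)
  show "(\<lambda>n. norm (Gamma_series (Complex y u) n) / Gamma_series y n) \<longlonglongrightarrow> norm (Gamma (Complex y u)) / Gamma y"
    by (rule lim) (use assms in auto)
  have "(x + real k) / norm (Complex (x + real k) u) \<le> (y + real k) / norm (Complex (y + real k) u)" for k
  proof -
    define a b where "a = x + real k" and "b = y + real k"
    have ab: "0 < a" "a \<le> b" using assms by (auto simp: a_def b_def)
    then have sq: "a\<^sup>2 \<le> b\<^sup>2" by (intro power_mono) auto
    have "(a * norm (Complex b u))\<^sup>2 \<le> (b * norm (Complex a u))\<^sup>2"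
      using mult_right_mono[OF sq, of "u\<^sup>2"] by (simp add: power_mult_distrib cmod_power2 algebra_simps)
    then have "a * norm (Complex b u) \<le> b * norm (Complex a u)"
      by (rule power2_le_imp_le) (use ab in auto)
    moreover have "norm (Complex a u) > 0" "norm (Complex b u) > 0" using ab by (auto simp: complex_eq_iff)
    ultimately show ?thesis unfolding a_def[symmetric] b_def[symmetric] by (simp add: divide_simps mult.commute)
  qed
  then show "\<exists>N. \<forall>n\<ge>N. norm (Gamma_series (Complex x u) n) / Gamma_series x n \<le> norm (Gamma_series (Complex y u) n) / Gamma_series y n"
    using assms by (subst (1 2) norm_Gamma_series_complex) (auto intro!: prod_mono)
qed

lemma norm_Gamma_add_nat:
  assumes "u \<noteq> 0"
  shows "norm (Gamma (Complex (a + real N) u)) = norm (Gamma (Complex a u)) * (\<Prod>j<N. norm (Complex (a + real j) u))"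
proof (induction N)
  case (Suc N)
  have e: "Complex (a + real (Suc N)) u = Complex (a + real N) u + 1" by (simp add: complex_eq_iff)
  have "Complex (a + real N) u \<notin> \<int>\<^sub>\<le>\<^sub>0" using assms by (auto elim!: nonpos_Ints_cases simp: complex_eq_iff)
  from Gamma_plus1[OF this] show ?case unfolding e by (simp add: norm_mult Suc mult_ac)
qed simp

text \<open>Comparison with an integer shift replaces Stirling's formula.\<close>

lemma norm_Gamma_ratio_le:
  fixes N :: nat
  obtains C :: real where "C > 0"
    "\<And>A B u. 1 / 4 \<le> B \<Longrightarrow> B \<le> real N \<Longrightarrow> B \<le> A + real N \<Longrightarrow> A \<le> B \<Longrightarrow> 1 \<le> \<bar>u\<bar> \<Longrightarrow>
       norm (Gamma (Complex B u)) \<le> C * (2 * real N + 1 + \<bar>u\<bar>) ^ N * norm (Gamma (Complex A u))"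
proof -
  let ?I = "{1 / 4..2 * real N + 1}"
  have cont: "continuous_on ?I (Gamma :: real \<Rightarrow> real)"
    by (intro continuous_intros) (auto elim!: nonpos_Ints_cases)
  obtain b where b: "b \<in> ?I" "\<And>x. x \<in> ?I \<Longrightarrow> Gamma x \<le> Gamma b"
    using continuous_attains_sup[OF compact_Icc _ cont] by auto
  obtain c where c: "c \<in> ?I" "\<And>x. x \<in> ?I \<Longrightarrow> Gamma c \<le> Gamma x"
    using continuous_attains_inf[OF compact_Icc _ cont] by auto
  have pos: "Gamma b > 0" "Gamma c > 0" using b c by (auto intro!: Gamma_real_pos)
  show ?thesis
  proof (rule that[of "Gamma b / Gamma c"])
    show "Gamma b / Gamma c > 0" using pos by simp
    fix A B u :: real
    assume B: "1 / 4 \<le> B" "B \<le> real N" "B \<le> A + real N" "A \<le> B" and u: "1 \<le> \<bar>u\<bar>"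
    have G: "Gamma B > 0" "Gamma (A + real N) > 0" using B by (auto intro!: Gamma_real_pos)
    have 1: "norm (Gamma (Complex B u)) \<le> Gamma B / Gamma (A + real N) * norm (Gamma (Complex (A + real N) u))"
      using norm_Gamma_quotient_mono[of B "A + real N" u] B G by (simp add: divide_simps mult_ac)
    have 2: "Gamma B / Gamma (A + real N) \<le> Gamma b / Gamma c"
      using B b(2)[of B] c(2)[of "A + real N"] pos G by (intro frac_le less_imp_le[OF pos(1)]) auto
    have 3: "norm (Gamma (Complex (A + real N) u)) = norm (Gamma (Complex A u)) * (\<Prod>j<N. norm (Complex (A + real j) u))"
      by (rule norm_Gamma_add_nat) (use u in auto)
    have 4: "(\<Prod>j<N. norm (Complex (A + real j) u)) \<le> (\<Prod>j<N. 2 * real N + 1 + \<bar>u\<bar>)"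
    proof (rule prod_mono, safe)
      fix j assume "j < N"
      have "norm (Complex (A + real j) u) \<le> \<bar>A + real j\<bar> + \<bar>u\<bar>" using cmod_le[of "Complex (A + real j) u"] by simp
      also have "\<dots> \<le> 2 * real N + 1 + \<bar>u\<bar>" using B \<open>j < N\<close> by linarith
      finally show "norm (Complex (A + real j) u) \<le> 2 * real N + 1 + \<bar>u\<bar>" .
    qed auto
    have "norm (Gamma (Complex B u)) \<le> Gamma b / Gamma c * (norm (Gamma (Complex A u)) * (\<Prod>j<N. 2 * real N + 1 + \<bar>u\<bar>))"
    proof (rule order_trans[OF 1], unfold 3, intro mult_mono 2 4)
      show "0 \<le> Gamma b / Gamma c" using pos by simp
    qed (simp_all add: prod_nonneg)
    then show "norm (Gamma (Complex B u)) \<le> Gamma b / Gamma c * (2 * real N + 1 + \<bar>u\<bar>) ^ N * norm (Gamma (Complex A u))"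
      by (simp add: mult_ac)
  qed
qed

section \<open>Size of zeta\<close>

lemma zeta_functional_equation_norm:
  assumes "Im s \<noteq> 0"
  shows "norm (zeta s) * norm (Gamma (Complex (Re s / 2) (Im s / 2)))
    = pi powr (Re s - 1 / 2) * norm (Gamma (Complex ((1 - Re s) / 2) (Im s / 2))) * norm (zeta (1 - s))"
proof -
  let ?a = "Complex (Re s / 2) (Im s / 2)" and ?b = "Complex ((1 - Re s) / 2) (Im s / 2)"
  have ab: "s / 2 = ?a" "(1 - s) / 2 = cnj ?b" by (simp_all add: complex_eq_iff)
  have nn: "?a \<notin> \<int>\<^sub>\<le>\<^sub>0" "?b \<notin> \<int>\<^sub>\<le>\<^sub>0" using assms by (auto elim!: nonpos_Ints_cases simp: complex_eq_iff)
  have "s \<noteq> 0" "s \<noteq> 1" using assms by auto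
  from arg_cong[OF zeta_functional_equation[OF this], of norm]
  have "norm (zeta s) * norm (rGamma (cnj ?b)) = norm (of_real pi powr (s - 1 / 2)) * norm (rGamma ?a) * norm (zeta (1 - s))"
    unfolding norm_mult ab .
  moreover have "norm (rGamma (cnj ?b)) = norm (rGamma ?b)" unfolding cnj_rGamma[symmetric] by (rule complex_mod_cnj)
  moreover have "norm (of_real pi powr (s - 1 / 2)) = pi powr (Re s - 1 / 2)"
    using norm_powr_real_powr[of "of_real pi" "s - 1 / 2"] by simp
  moreover have "norm (rGamma ?a) = 1 / norm (Gamma ?a)" "norm (rGamma ?b) = 1 / norm (Gamma ?b)"
    by (simp_all add: Gamma_def norm_divide inverse_eq_divide)
  moreover have "norm (Gamma ?a) > 0" "norm (Gamma ?b) > 0" using nn by (auto simp: Gamma_eq_zero_iff)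
  ultimately show ?thesis by (simp add: divide_simps mult_ac)
qed

text \<open>For n \<ge> 2 each term is at most half of 1 / n^2, and pi < 4 bounds (pi^2 / 6 - 1) / 2
  by 5 / 6. What matters is that this is less than 1, so that zeta stays away from 0.\<close>

lemma norm_zeta_minus_one_le:
  assumes s: "Re s \<ge> 3"
  shows "norm (zeta s - 1) \<le> 5 / 6"
proof -
  have "(\<lambda>n. 1 / of_nat (Suc n) powr s) sums zeta s" by (rule zeta_sums) (use s in auto)
  then have S: "(\<lambda>n. 1 / of_nat (Suc (Suc n)) powr s) sums (zeta s - 1)"
    using sums_Suc_iff[of "\<lambda>n. 1 / of_nat (Suc n) powr s" "zeta s - 1"] by (simp del: of_nat_Suc add: of_nat_Suc[of 0])
  have P: "(\<lambda>n. 1 / real (Suc n + 1) ^ 2) sums (pi\<^sup>2 / 6 - 1)"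
    using inverse_squares_sums sums_Suc_iff[of "\<lambda>n. 1 / real (n + 1) ^ 2" "pi\<^sup>2 / 6 - 1"] by simp
  have le: "norm (1 / of_nat (Suc (Suc n)) powr s :: complex) \<le> 1 / 2 * (1 / real (Suc n + 1) ^ 2)" for n
  proof -
    define x where "x = real (Suc (Suc n))"
    have x: "x \<ge> 2" by (simp add: x_def)
    have "norm (1 / of_nat (Suc (Suc n)) powr s :: complex) = 1 / x powr Re s"
      unfolding norm_divide norm_of_nat_powr x_def by simp
    also have "\<dots> \<le> 1 / x powr 3" using s x by (intro divide_left_mono powr_mono mult_pos_pos) auto
    also have "x powr 3 = x ^ 3" using x by (simp add: powr_numeral)
    also have "1 / x ^ 3 \<le> 1 / 2 * (1 / x ^ 2)" using x by (simp add: power3_eq_cube power2_eq_square divide_simps)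
    finally show ?thesis by (simp add: x_def)
  qed
  have "norm (\<Sum>n. 1 / of_nat (Suc (Suc n)) powr s :: complex) \<le> (\<Sum>n. 1 / 2 * (1 / real (Suc n + 1) ^ 2))"
    by (rule norm_suminf_le[OF le sums_summable[OF sums_mult[OF P]]])
  also have "\<dots> = 1 / 2 * (pi\<^sup>2 / 6 - 1)" by (rule sums_unique[OF sums_mult[OF P], symmetric])
  also have "(\<Sum>n. 1 / of_nat (Suc (Suc n)) powr s) = zeta s - 1" by (rule sums_unique[OF S, symmetric])
  finally have "norm (zeta s - 1) \<le> 1 / 2 * (pi\<^sup>2 / 6 - 1)" .
  moreover have "pi\<^sup>2 \<le> 4\<^sup>2" using pi_less_4 by (intro power_mono) auto
  ultimately show ?thesis by simp
qed

lemma zeta_far_right_bounds: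
  assumes s: "Re s \<ge> 3"
  shows "norm (zeta s) \<ge> 1 / 6" "norm (zeta s) \<le> 2"
  using norm_zeta_minus_one_le[OF s] norm_triangle_ineq2[of "zeta s" 1] norm_triangle_ineq3[of 1 "zeta s"]
    norm_minus_commute[of "zeta s" 1]
  by (simp_all add: abs_if split: if_splits)

lemma zeta_right_half_bound:
  obtains C :: real where "C > 0" "\<And>s. Re s \<ge> 1 / 2 \<Longrightarrow> \<bar>Im s\<bar> \<ge> 1 \<Longrightarrow> norm (zeta s) \<le> C * (norm s + 1)\<^sup>2"
proof -
  obtain C where C: "C > 0" "\<And>s. Re s \<ge> 1 / 2 \<Longrightarrow> s \<noteq> 1 \<Longrightarrow> norm (zeta s - 1 / (s - 1)) \<le> C * (norm s + 1)\<^sup>2"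
    using zeta_minus_pole_bound by blast
  have "norm (zeta s) \<le> (C + 1) * (norm s + 1)\<^sup>2" if s: "Re s \<ge> 1 / 2" "\<bar>Im s\<bar> \<ge> 1" for s
  proof -
    have "norm (s - 1) \<ge> 1" using abs_Im_le_cmod[of "s - 1"] s by simp
    then have "norm (1 / (s - 1)) \<le> 1" unfolding norm_divide by (simp add: divide_le_eq_1)
    moreover have "1 \<le> (norm s + 1)\<^sup>2" by (rule one_le_power) simp
    moreover have "norm (zeta s - 1 / (s - 1)) \<le> C * (norm s + 1)\<^sup>2" using s by (intro C(2)) auto
    ultimately show ?thesis
      using norm_triangle_sub[of "zeta s" "1 / (s - 1)"] unfolding distrib_right mult_1 by linarith
  qed
  with C(1) show ?thesis by (intro that[of "C + 1"]) auto
qed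

text \<open>At abscissa 1/2 - N the two Gamma arguments of the functional equation differ by exactly
  \<open>N\<close>, so their ratio is a product of \<open>N\<close> linear factors, each of modulus
  at least |Im s| / 2.\<close>

lemma zeta_left_lower_bound:
  assumes s: "Re s = 1 / 2 - real N" and N: "N > 0" and t: "Im s \<noteq> 0"
  shows "norm (zeta s) \<ge> pi powr (- real N) * (\<bar>Im s\<bar> / 2) ^ N * norm (zeta (1 - s))"
proof -
  define u where "u = Im s / 2"
  have u: "u \<noteq> 0" using t by (simp add: u_def)
  let ?G = "norm (Gamma (Complex (Re s / 2) u))"
  have e: "(1 - Re s) / 2 = Re s / 2 + real N" using s by (simp add: field_simps)
  have "norm (Gamma (Complex ((1 - Re s) / 2) u)) = ?G * (\<Prod>j<N. norm (Complex (Re s / 2 + real j) u))"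
    unfolding e by (rule norm_Gamma_add_nat[OF u])
  also have "\<dots> \<ge> ?G * (\<Prod>j<N. \<bar>u\<bar>)"
    using abs_Im_le_cmod[of "Complex _ u"] by (intro mult_left_mono prod_mono) auto
  finally have "?G * \<bar>u\<bar> ^ N \<le> norm (Gamma (Complex ((1 - Re s) / 2) u))" by simp
  then have "pi powr (- real N) * (?G * \<bar>u\<bar> ^ N) * norm (zeta (1 - s))
     \<le> pi powr (- real N) * norm (Gamma (Complex ((1 - Re s) / 2) u)) * norm (zeta (1 - s))"
    by (intro mult_right_mono mult_left_mono) auto
  also have "\<dots> = norm (zeta s) * ?G"
    using zeta_functional_equation_norm[OF t] s by (simp add: u_def)
  finally have "?G * (pi powr (- real N) * \<bar>u\<bar> ^ N * norm (zeta (1 - s))) \<le> ?G * norm (zeta s)"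
    by (simp add: mult_ac)
  moreover have "Complex (Re s / 2) u \<notin> \<int>\<^sub>\<le>\<^sub>0" using u by (auto elim!: nonpos_Ints_cases simp: complex_eq_iff)
  then have "?G > 0" by (simp add: Gamma_eq_zero_iff)
  ultimately show ?thesis by (simp add: u_def abs_divide)
qed

text \<open>The product is symmetric under s -> 1 - s, so Re s \<le> 1/2 may be assumed. The Gamma
  ratio of the functional equation costs the exponent \<open>N\<close>, the square of the quadratic
  bound for zeta (1 - s) costs 4. An exponent linear in \<open>N\<close> is what
  \<open>RH_log_concave\<close> needs, where it is divided by N^2.\<close>

lemma zeta_product_upper_bound:
  fixes N :: nat
  assumes N: "N \<ge> 1"
  obtains K :: real where "K > 0"
    "\<And>s T. \<bar>Re s - 1 / 2\<bar> \<le> real N \<Longrightarrow> 2 \<le> \<bar>Im s\<bar> \<Longrightarrow> \<bar>Im s\<bar> \<le> T \<Longrightarrow>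
       norm (zeta s * zeta (1 - s)) \<le> K * (2 * real N + 2 + T) ^ (N + 4)"
proof -
  obtain C where C: "C > 0" "\<And>s. Re s \<ge> 1 / 2 \<Longrightarrow> \<bar>Im s\<bar> \<ge> 1 \<Longrightarrow> norm (zeta s) \<le> C * (norm s + 1)\<^sup>2"
    using zeta_right_half_bound by blast
  obtain D where D: "D > 0"
    "\<And>A B u. 1 / 4 \<le> B \<Longrightarrow> B \<le> real N \<Longrightarrow> B \<le> A + real N \<Longrightarrow> A \<le> B \<Longrightarrow> 1 \<le> \<bar>u\<bar> \<Longrightarrow>
       norm (Gamma (Complex B u)) \<le> D * (2 * real N + 1 + \<bar>u\<bar>) ^ N * norm (Gamma (Complex A u))"
    using norm_Gamma_ratio_le[of N] by blast
  have left: "norm (zeta s * zeta (1 - s)) \<le> (D * C\<^sup>2) * (2 * real N + 2 + T) ^ (N + 4)"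
    if s: "Re s \<le> 1 / 2" "1 / 2 - Re s \<le> real N" "2 \<le> \<bar>Im s\<bar>" "\<bar>Im s\<bar> \<le> T" for s T
  proof -
    define X where "X = 2 * real N + 2 + T"
    have X: "X \<ge> 0" using s by (simp add: X_def)
    let ?A = "Re s / 2" and ?B = "(1 - Re s) / 2" and ?u = "Im s / 2"
    let ?G = "norm (Gamma (Complex ?A ?u))"
    have "Im s \<noteq> 0" using s by auto
    have "norm (Gamma (Complex ?B ?u)) \<le> D * (2 * real N + 1 + \<bar>?u\<bar>) ^ N * ?G"
      using s N by (intro D(2)) (auto simp: field_simps)
    also have "\<dots> \<le> D * X ^ N * ?G"
      using s D(1) by (intro mult_right_mono mult_left_mono power_mono) (auto simp: X_def)
    finally have g: "norm (Gamma (Complex ?B ?u)) \<le> D * X ^ N * ?G" .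
    have "Complex ?A ?u \<notin> \<int>\<^sub>\<le>\<^sub>0" using \<open>Im s \<noteq> 0\<close> by (auto elim!: nonpos_Ints_cases simp: complex_eq_iff)
    then have G: "?G > 0" by (simp add: Gamma_eq_zero_iff)
    have "norm (zeta s) * ?G = pi powr (Re s - 1 / 2) * norm (Gamma (Complex ?B ?u)) * norm (zeta (1 - s))"
      by (rule zeta_functional_equation_norm) fact
    also have "\<dots> \<le> 1 * (D * X ^ N * ?G) * norm (zeta (1 - s))"
    proof (intro mult_right_mono mult_mono g)
      show "pi powr (Re s - 1 / 2) \<le> 1"
        using powr_mono[of "Re s - 1 / 2" 0 pi] s pi_ge_two by simp
    qed auto
    finally have "?G * norm (zeta s) \<le> ?G * (D * X ^ N * norm (zeta (1 - s)))" by (simp add: mult_ac)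
    then have zs: "norm (zeta s) \<le> D * X ^ N * norm (zeta (1 - s))" using G by simp
    have "norm (zeta (1 - s)) \<le> C * (norm (1 - s) + 1)\<^sup>2" using s by (intro C(2)) auto
    also have "\<dots> \<le> C * X\<^sup>2"
    proof (intro mult_left_mono power_mono)
      have "norm (1 - s) \<le> \<bar>Re (1 - s)\<bar> + \<bar>Im (1 - s)\<bar>" by (rule cmod_le)
      then show "norm (1 - s) + 1 \<le> X" using s by (simp add: X_def)
    qed (use C in auto)
    finally have z1: "norm (zeta (1 - s)) \<le> C * X\<^sup>2" .
    have "norm (zeta s * zeta (1 - s)) \<le> (D * X ^ N * norm (zeta (1 - s))) * norm (zeta (1 - s))"
      unfolding norm_mult by (intro mult_right_mono zs) auto
    also have "\<dots> = D * X ^ N * (norm (zeta (1 - s)))\<^sup>2" by (simp add: power2_eq_square)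
    also have "\<dots> \<le> D * X ^ N * (C * X\<^sup>2)\<^sup>2"
      using X D(1) by (intro mult_left_mono power_mono z1) auto
    also have "\<dots> = (D * C\<^sup>2) * X ^ (N + 4)"
      by (simp add: power_mult_distrib power_add flip: power_mult)
    finally show ?thesis by (simp only: X_def)
  qed
  show ?thesis
  proof (rule that[of "D * C\<^sup>2"])
    fix s T assume s: "\<bar>Re s - 1 / 2\<bar> \<le> real N" "2 \<le> \<bar>Im s\<bar>" "\<bar>Im s\<bar> \<le> T"
    show "norm (zeta s * zeta (1 - s)) \<le> (D * C\<^sup>2) * (2 * real N + 2 + T) ^ (N + 4)"
    proof (cases "Re s \<le> 1 / 2")
      case True
      then show ?thesis using s by (intro left) auto
    next
      case False
      have "norm (zeta (1 - s) * zeta (1 - (1 - s))) \<le> (D * C\<^sup>2) * (2 * real N + 2 + T) ^ (N + 4)"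
        using s False by (intro left) auto
      then show ?thesis by (simp add: mult.commute)
    qed
  qed (use C D in auto)
qed

text \<open>
  If \<open>zeta\<close> tended to 0 along the critical line, the maximum principle on tall rectangles between the
  abscissae 1/2 and 11/2 would make it small at abscissa 3, where it is at least 1/6 in modulus.
\<close>

lemma zeta_critical_line_not_tendsto_0:
  obtains d :: real where "d > 0" "\<And>T. \<exists>t>T. norm (zeta (Complex (1 / 2) t)) \<ge> d"
proof -
  obtain C where C: "C > 0" "\<And>s. Re s \<ge> 1 / 2 \<Longrightarrow> \<bar>Im s\<bar> \<ge> 1 \<Longrightarrow> norm (zeta s) \<le> C * (norm s + 1)\<^sup>2"
    using zeta_right_half_bound by blast
  \<comment> \<open>The weight in \<open>G\<close> below combines a Gaussian, which damps the
    horizontal sides, with a tilt that gains a factor 1 / A on the side Re s = 11/2, where zeta is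
    only bounded, and loses A on the side Re s = 1/2. Since (Re s - 3)^2 \<le> 25/4, these constants
    make 2 exp (25/4) / A and d exp (25/4) A both equal to 1/7, which is less than the lower bound
    1/6 at abscissa 3.\<close>
  define A where "A = 14 * exp (25 / 4 :: real)"
  define d where "d = 1 / (7 * exp (25 / 4) * A)"
  have A: "A > 0" by (simp add: A_def)
  have d: "d > 0" using A by (simp add: d_def)
  have "\<exists>t>T0. norm (zeta (Complex (1 / 2) t)) \<ge> d" for T0
  proof (rule ccontr)
    assume "\<not> ?thesis"
    then have small: "norm (zeta (Complex (1 / 2) t)) \<le> d" if "t > T0" for t using that by force
    have "((\<lambda>T. C * (7 + 2 * T)\<^sup>2 * exp (25 / 4) * A * exp (- (T\<^sup>2 / 4))) \<longlongrightarrow> 0) at_top" by real_asymp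
    then have "eventually (\<lambda>T. C * (7 + 2 * T)\<^sup>2 * exp (25 / 4) * A * exp (- (T\<^sup>2 / 4)) < 1 / 7) at_top"
      by (rule order_tendstoD) simp
    then obtain T where T: "C * (7 + 2 * T)\<^sup>2 * exp (25 / 4) * A * exp (- (T\<^sup>2 / 4)) < 1 / 7" "T > 2 * \<bar>T0\<bar> + 2"
      using eventually_happens[OF eventually_conj[OF _ eventually_gt_at_top[of "2 * \<bar>T0\<bar> + 2"]]] by fastforce
    define k where "k = 2 / 5 * ln A"
    define c where "c = Complex 3 T"
    define G where "G = (\<lambda>s. zeta s * exp ((s - c)\<^sup>2 - of_real k * (s - 3)))"
    have nG: "norm (G s) = norm (zeta s) * exp ((Re s - 3)\<^sup>2 - (Im s - T)\<^sup>2 - k * (Re s - 3))" for s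
      by (simp add: G_def norm_mult c_def power2_eq_square)
    let ?S = "cbox (Complex (1 / 2) (T / 2)) (Complex (11 / 2) (3 * T / 2))"
    have sub: "?S \<subseteq> - {1}" using T by (auto simp: in_cbox_complex_iff)
    have hol: "G holomorphic_on ?S"
      unfolding G_def by (intro holomorphic_intros holomorphic_on_subset[OF holomorphic_zeta sub])
    have A1: "A \<ge> 1" using one_le_exp_iff[of "25 / 4 :: real"] unfolding A_def by linarith
    have k: "k \<ge> 0" using A1 by (simp add: k_def)
    have kA: "exp (k * (5 / 2)) = A" using A by (simp add: k_def)
    have "norm (G c) \<le> 1 / 7"
    proof (rule maximum_modulus_frontier[of G ?S])
      show "G holomorphic_on interior ?S" by (rule holomorphic_on_subset[OF hol interior_subset])
      show "continuous_on (closure ?S) G" using holomorphic_on_imp_continuous_on[OF hol] by simp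
      show "c \<in> ?S" using T by (auto simp: c_def in_cbox_complex_iff)
      fix s assume "s \<in> frontier ?S"
      then have sS: "s \<in> ?S" and "s \<notin> box (Complex (1 / 2) (T / 2)) (Complex (11 / 2) (3 * T / 2))"
        by (auto simp: frontier_def)
      then have cases: "Re s = 1 / 2 \<or> Re s = 11 / 2 \<or> Im s = T / 2 \<or> Im s = 3 * T / 2"
        and R: "1 / 2 \<le> Re s" "Re s \<le> 11 / 2" "T / 2 \<le> Im s" "Im s \<le> 3 * T / 2"
        by (auto simp: in_cbox_complex_iff in_box_complex_iff)
      have sq: "(Re s - 3)\<^sup>2 \<le> 25 / 4"
      proof -
        have "\<bar>Re s - 3\<bar> \<le> 5 / 2" using R by linarith
        then have "\<bar>Re s - 3\<bar>\<^sup>2 \<le> (5 / 2)\<^sup>2" by (rule power_mono) simp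
        then show ?thesis by (simp add: power_divide)
      qed
      have kR: "- (k * (Re s - 3)) \<le> k * (5 / 2)"
      proof -
        have "k * (- (Re s - 3)) \<le> k * (5 / 2)" using R k by (intro mult_left_mono) auto
        then show ?thesis by (simp only: mult_minus_right)
      qed
      consider "Re s = 1 / 2" | "Re s = 11 / 2" | "(Im s - T)\<^sup>2 = T\<^sup>2 / 4"
      proof -
        have "(Im s - T)\<^sup>2 = T\<^sup>2 / 4" if "Im s = T / 2 \<or> Im s = 3 * T / 2"
        proof -
          have "Im s - T = - (T / 2) \<or> Im s - T = T / 2" using that by linarith
          then show ?thesis by (elim disjE) (simp_all only: power2_minus power_divide, simp_all)
        qed
        then show ?thesis using cases that by blast
      qed
      then show "norm (G s) \<le> 1 / 7"
      proof cases
        case 1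
        then have s: "s = Complex (1 / 2) (Im s)" by (simp add: complex_eq_iff)
        have "norm (G s) \<le> d * exp (25 / 4 + k * (5 / 2))"
          unfolding nG
        proof (rule mult_mono)
          show "norm (zeta s) \<le> d" using small[of "Im s"] R T s by simp
          have "(Re s - 3)\<^sup>2 - (Im s - T)\<^sup>2 - k * (Re s - 3) \<le> 25 / 4 + k * (5 / 2)"
            using sq kR zero_le_power2[of "Im s - T"] by linarith
          then show "exp ((Re s - 3)\<^sup>2 - (Im s - T)\<^sup>2 - k * (Re s - 3)) \<le> exp (25 / 4 + k * (5 / 2))" by simp
        qed (use d in auto)
        also have "\<dots> = 1 / 7" unfolding exp_add kA d_def using A by simp
        finally show ?thesis .
      next
        case 2
        have "norm (G s) \<le> 2 * exp (25 / 4 - k * (5 / 2))"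
          unfolding nG
        proof (rule mult_mono)
          show "norm (zeta s) \<le> 2" using 2 by (intro zeta_far_right_bounds) simp
          have "k * (Re s - 3) = k * (5 / 2)" using 2 by simp
          then have "(Re s - 3)\<^sup>2 - (Im s - T)\<^sup>2 - k * (Re s - 3) \<le> 25 / 4 - k * (5 / 2)"
            using sq zero_le_power2[of "Im s - T"] by linarith
          then show "exp ((Re s - 3)\<^sup>2 - (Im s - T)\<^sup>2 - k * (Re s - 3)) \<le> exp (25 / 4 - k * (5 / 2))" by simp
        qed auto
        also have "\<dots> = 1 / 7" unfolding exp_diff kA by (simp add: A_def)
        finally show ?thesis .
      next
        case 3
        have "norm (G s) \<le> (C * (7 + 2 * T)\<^sup>2) * exp (25 / 4 + - (T\<^sup>2 / 4) + k * (5 / 2))"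
          unfolding nG
        proof (rule mult_mono)
          have "norm (zeta s) \<le> C * (norm s + 1)\<^sup>2" using R T by (intro C(2)) auto
          also have "\<dots> \<le> C * (7 + 2 * T)\<^sup>2"
            using cmod_le[of s] R T C by (intro mult_left_mono power_mono) auto
          finally show "norm (zeta s) \<le> C * (7 + 2 * T)\<^sup>2" .
          have "(Re s - 3)\<^sup>2 - (Im s - T)\<^sup>2 - k * (Re s - 3) \<le> 25 / 4 + - (T\<^sup>2 / 4) + k * (5 / 2)"
            using sq kR 3 by linarith
          then show "exp ((Re s - 3)\<^sup>2 - (Im s - T)\<^sup>2 - k * (Re s - 3)) \<le> exp (25 / 4 + - (T\<^sup>2 / 4) + k * (5 / 2))" by simp
        qed (use C in auto)
        also have "\<dots> \<le> 1 / 7" unfolding exp_add kA using T(1) by (simp add: mult_ac)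
        finally show ?thesis .
      qed
    qed simp
    moreover have "norm (G c) = norm (zeta c)" by (simp add: nG c_def)
    moreover have "norm (zeta c) \<ge> 1 / 6" by (rule zeta_far_right_bounds) (simp add: c_def)
    ultimately show False by simp
  qed
  with d show ?thesis by (rule that)
qed

section \<open>The square of the modulus of zeta on the critical line\<close>

text \<open>The holomorphic extension of \<open>critical_square\<close>: for real z the second
  factor is the conjugate of the first. In terms of s = 1/2 + i z it is zeta(s) zeta(1 - s), and no
  theta function is involved.\<close>

definition critical_product :: "complex \<Rightarrow> complex" where
  "critical_product z = zeta (1 / 2 + \<i> * z) * zeta (1 / 2 - \<i> * z)"

definition critical_square :: "real \<Rightarrow> real" where
  "critical_square t = (norm (zeta (Complex (1 / 2) t)))\<^sup>2"

lemma critical_product_of_real: "critical_product (of_real t) = of_real (critical_square t)"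
proof -
  have e: "1 / 2 + \<i> * of_real t = Complex (1 / 2) t" "1 / 2 - \<i> * of_real t = cnj (Complex (1 / 2) t)"
    by (simp_all add: complex_eq_iff)
  show ?thesis unfolding critical_product_def critical_square_def e zeta_cnj complex_norm_square ..
qed

lemma critical_product_holomorphic: "critical_product holomorphic_on {z. Re z > 0}"
proof -
  have "(\<lambda>z. zeta (1 / 2 + \<i> * z)) holomorphic_on {z. Re z > 0}"
    "(\<lambda>z. zeta (1 / 2 - \<i> * z)) holomorphic_on {z. Re z > 0}"
    by (rule holomorphic_on_compose_gen[OF _ holomorphic_zeta, unfolded o_def];
        auto intro!: holomorphic_intros simp: complex_eq_iff)+
  then show ?thesis unfolding critical_product_def by (rule holomorphic_on_mult)
qed

text \<open>The hypothesis speaks of the open critical strip. Zeros with Re s \<ge> 1 are excluded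
  by the Euler product and the 3-4-1 inequality, and the functional equation reflects this to Re s
  \<le> 0; off the real axis there are no trivial zeros.\<close>

lemma RH_zero_on_critical_line:
  assumes RH: riemann_hypothesis and s: "zeta s = 0" "Im s \<noteq> 0"
  shows "Re s = 1 / 2"
proof -
  have right: "zeta s \<noteq> 0" if "Re s \<ge> 1" "Im s \<noteq> 0" for s
  proof (cases "Re s = 1")
    case True
    then have "s = Complex 1 (Im s)" by (simp add: complex_eq_iff)
    then show ?thesis using zeta_nonzero_line_1[OF that(2)] by simp
  qed (use zeta_nonzero_right[of s] that in auto)
  have "Re s < 1" using right[of s] s by force
  moreover have "Re s > 0"
  proof (rule ccontr)
    assume "\<not> Re s > 0"
    then have "zeta (1 - s) \<noteq> 0" using s by (intro right) auto
    moreover have "Complex ((1 - Re s) / 2) (Im s / 2) \<notin> \<int>\<^sub>\<le>\<^sub>0"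
      using s by (auto elim!: nonpos_Ints_cases simp: complex_eq_iff)
    ultimately show False
      using zeta_functional_equation_norm[OF s(2)] s(1) by (simp add: Gamma_eq_zero_iff)
  qed
  ultimately show ?thesis using RH s unfolding riemann_hypothesis_def by blast
qed

lemma RH_critical_product_zero_real:
  assumes RH: riemann_hypothesis and z: "critical_product z = 0" "Re z > 0"
  shows "z \<in> \<real>" "zeta (Complex (1 / 2) (Re z)) = 0"
proof -
  have "Im z = 0"
    using z RH_zero_on_critical_line[OF RH, of "1 / 2 + \<i> * z"] RH_zero_on_critical_line[OF RH, of "1 / 2 - \<i> * z"]
    by (auto simp: critical_product_def)
  then show "z \<in> \<real>" by (simp add: complex_is_Real_iff)
  then have "z = of_real (Re z)" by (simp add: complex_is_Real_iff complex_eq_iff)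
  then have "critical_square (Re z) = 0" using z(1) critical_product_of_real[of "Re z"] by simp
  then show "zeta (Complex (1 / 2) (Re z)) = 0" by (simp add: critical_square_def)
qed

lemma critical_product_growth:
  obtains K :: "nat \<Rightarrow> real" where "\<And>N. K N > 0"
    "\<And>N z t. N \<ge> 1 \<Longrightarrow> norm z \<le> real N \<Longrightarrow> 3 * real N + 2 \<le> t \<Longrightarrow>
       norm (critical_product (of_real t + z)) \<le> K N * (2 * t) ^ (N + 4)"
proof -
  have "\<exists>K. \<forall>N. K N > 0 \<and> (\<forall>z t. N \<ge> 1 \<longrightarrow> norm z \<le> real N \<longrightarrow> 3 * real N + 2 \<le> t \<longrightarrow>
       norm (critical_product (of_real t + z)) \<le> K N * (2 * t) ^ (N + 4))"
  proof (rule choice, rule allI)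
    fix N :: nat
    show "\<exists>K>0. \<forall>z t. N \<ge> 1 \<longrightarrow> norm z \<le> real N \<longrightarrow> 3 * real N + 2 \<le> t \<longrightarrow>
       norm (critical_product (of_real t + z)) \<le> K * (2 * t) ^ (N + 4)"
    proof (cases "N \<ge> 1")
      case True
      obtain K where K: "K > 0"
        "\<And>s T. \<bar>Re s - 1 / 2\<bar> \<le> real N \<Longrightarrow> 2 \<le> \<bar>Im s\<bar> \<Longrightarrow> \<bar>Im s\<bar> \<le> T \<Longrightarrow>
           norm (zeta s * zeta (1 - s)) \<le> K * (2 * real N + 2 + T) ^ (N + 4)"
        using zeta_product_upper_bound[OF True] by blast
      have "norm (critical_product (of_real t + z)) \<le> K * (2 * t) ^ (N + 4)"
        if z: "norm z \<le> real N" "3 * real N + 2 \<le> t" for z t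
      proof -
        define s where "s = 1 / 2 + \<i> * (of_real t + z)"
        have ri: "Re s = 1 / 2 - Im z" "Im s = t + Re z" by (simp_all add: s_def)
        have b: "\<bar>Im z\<bar> \<le> real N" "\<bar>Re z\<bar> \<le> real N"
          using abs_Im_le_cmod[of z] abs_Re_le_cmod[of z] z by linarith+
        have "norm (zeta s * zeta (1 - s)) \<le> K * (2 * real N + 2 + (t + real N)) ^ (N + 4)"
          by (rule K(2)) (use ri b z in auto)
        also have "\<dots> \<le> K * (2 * t) ^ (N + 4)"
          using z K(1) by (intro mult_left_mono power_mono) auto
        also have "zeta s * zeta (1 - s) = critical_product (of_real t + z)"
          by (simp add: critical_product_def s_def)
        finally show ?thesis .
      qed
      with K(1) show ?thesis by blast
    qed (intro exI[of _ 1], auto)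
  qed
  then show ?thesis using that by blast
qed

text \<open>At distance 6 one factor of the product lies at abscissa 13/2, where zeta is at least
  1/6, and the other at -11/2, where the functional equation supplies t^6 and once more the 1/6;
  hence the 36.\<close>

lemma critical_product_imaginary_lower_bound:
  assumes t: "t > 0"
  shows "norm (critical_product (of_real t + \<i> * 6) * critical_product (of_real t + - (\<i> * 6)))
    \<ge> (pi powr (- 6) * (t / 2) ^ 6 / 36)\<^sup>2"
proof -
  have *: "norm (critical_product z) \<ge> pi powr (- 6) * (t / 2) ^ 6 / 36"
    if z: "s = 1 / 2 + \<i> * z \<or> s = 1 / 2 - \<i> * z" "Re s = 1 / 2 - 6" "\<bar>Im s\<bar> = t" for z s
  proof -
    have e: "norm (critical_product z) = norm (zeta s) * norm (zeta (1 - s))"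
      using z(1) by (auto simp: critical_product_def norm_mult mult.commute)
    have far: "norm (zeta (1 - s)) \<ge> 1 / 6" by (rule zeta_far_right_bounds) (use z in auto)
    have "pi powr (- 6) * (t / 2) ^ 6 / 36 = pi powr (- 6) * (t / 2) ^ 6 * (1 / 6) * (1 / 6)" by simp
    also have "\<dots> \<le> pi powr (- 6) * (t / 2) ^ 6 * norm (zeta (1 - s)) * norm (zeta (1 - s))"
      using far t by (intro mult_mono mult_nonneg_nonneg) auto
    also have "\<dots> \<le> norm (zeta s) * norm (zeta (1 - s))"
      using zeta_left_lower_bound[of s 6] z t by (intro mult_right_mono) auto
    finally show ?thesis unfolding e .
  qed
  have "norm (critical_product (of_real t + \<i> * 6)) \<ge> pi powr (- 6) * (t / 2) ^ 6 / 36"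
    by (rule *[of "1 / 2 + \<i> * (of_real t + \<i> * 6)"]) (use t in \<open>auto simp: algebra_simps\<close>)
  moreover have "norm (critical_product (of_real t + - (\<i> * 6))) \<ge> pi powr (- 6) * (t / 2) ^ 6 / 36"
    by (rule *[of "1 / 2 - \<i> * (of_real t + - (\<i> * 6))"]) (use t in \<open>auto simp: algebra_simps\<close>)
  moreover have "pi powr (- 6) * (t / 2) ^ 6 / 36 \<ge> 0" by simp
  ultimately show ?thesis unfolding norm_mult power2_eq_square by (intro mult_mono) auto
qed

lemma critical_square_upper_bound:
  obtains C :: real where "C > 0" "\<And>t. t \<ge> 2 \<Longrightarrow> critical_square t \<le> C * t ^ 4"
proof -
  obtain C where C: "C > 0" "\<And>s. Re s \<ge> 1 / 2 \<Longrightarrow> \<bar>Im s\<bar> \<ge> 1 \<Longrightarrow> norm (zeta s) \<le> C * (norm s + 1)\<^sup>2"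
    using zeta_right_half_bound by blast
  have "critical_square t \<le> C\<^sup>2 * 16 * t ^ 4" if t: "t \<ge> 2" for t
  proof -
    have "norm (zeta (Complex (1 / 2) t)) \<le> C * (norm (Complex (1 / 2) t) + 1)\<^sup>2" using t by (intro C(2)) auto
    also have "\<dots> \<le> C * (2 * t)\<^sup>2"
      using cmod_le[of "Complex (1 / 2) t"] t C by (intro mult_left_mono power_mono) auto
    finally have "critical_square t \<le> (C * (2 * t)\<^sup>2)\<^sup>2" unfolding critical_square_def by (rule power_mono) simp
    also have "\<dots> = C\<^sup>2 * 16 * t ^ 4" by (simp add: power_mult_distrib flip: power_mult)
    finally show ?thesis .
  qed
  then show ?thesis using that[of "C\<^sup>2 * 16"] C by simp
qed

text \<open>
  The second logarithmic derivative of \<open>\<bar>zeta\<bar>\<^sup>2\<close> on the critical line is at most \<open>- S\<close> up to a controlled error,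
  where \<open>S\<close> is a sum over zeros near \<open>t\<close>; comparing \<open>critical_product\<close> at height \<open>t\<close> with its values six units away,
  where it is of order at least \<open>t ^ 6\<close> against at most \<open>t ^ 4\<close> at \<open>t\<close> itself, shows that \<open>S\<close> is at least of order \<open>ln t\<close>.
\<close>

lemma RH_log_concave:
  assumes RH: riemann_hypothesis and d: "d > 0"
  obtains N :: nat and T C :: real where "N \<ge> 1" "T \<ge> 3 * real N + 2"
    "\<And>t. t \<ge> T \<Longrightarrow> norm (zeta (Complex (1 / 2) t)) \<ge> d \<Longrightarrow>
       \<exists>x. \<bar>x - t\<bar> \<le> real N / 2 \<and> zeta (Complex (1 / 2) x) = 0"
    "\<And>t. t \<ge> T \<Longrightarrow> norm (zeta (Complex (1 / 2) t)) \<ge> d \<Longrightarrow>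
       36 * Re (deriv (deriv critical_product) t / critical_product t - (deriv critical_product t / critical_product t)\<^sup>2)
         \<le> C - 2 * ln t"
proof -
  obtain K where K: "\<And>N. K N > 0"
    "\<And>N z t. N \<ge> 1 \<Longrightarrow> norm z \<le> real N \<Longrightarrow> 3 * real N + 2 \<le> t \<Longrightarrow>
       norm (critical_product (of_real t + z)) \<le> K N * (2 * t) ^ (N + 4)"
    using critical_product_growth by blast
  obtain B where B: "B > 0" "\<And>t. t \<ge> 2 \<Longrightarrow> critical_square t \<le> B * t ^ 4"
    using critical_square_upper_bound by blast
  (* any N with 36 * 1024 * (N + 4) <= N^2 works *)
  define N :: nat where "N = 40000"
  define L where "L = \<bar>ln (K N)\<bar> + \<bar>ln (d\<^sup>2)\<bar>"
  \<comment> \<open>Chosen so that the squared lower bound at distance 6, of order t^12, equals (B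
    t^4)^2 times c4 t^4. The 64 comes from (t / 2)^6.\<close>
  define c4 where "c4 = (pi powr (- 6) / 64 / 36)\<^sup>2 / B\<^sup>2"
  have c4: "c4 > 0" using B by (simp add: c4_def)
  have main: "\<exists>S\<ge>0. (S \<noteq> 0 \<longrightarrow> (\<exists>x. \<bar>x - t\<bar> \<le> real N / 2 \<and> zeta (Complex (1 / 2) x) = 0)) \<and>
     36 * S \<ge> 4 * ln t + ln c4 - ln (2 * t) - L \<and>
     36 * Re (deriv (deriv critical_product) t / critical_product t - (deriv critical_product t / critical_product t)\<^sup>2)
        \<le> - 36 * S + ln (2 * t) + L"
    if t: "t \<ge> 3 * real N + 2" and dt: "norm (zeta (Complex (1 / 2) t)) \<ge> d" for t
  proof -
    have t2: "t \<ge> 2" "t > 0" using t by auto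
    define f where "f = (\<lambda>z. critical_product (of_real t + z))"
    \<comment> \<open>The logarithm of the bound on the circle of radius \<open>N\<close> relative
      to the centre, where the modulus is at least d^2; \<open>L\<close> absorbs both
      constants.\<close>
    define M where "M = real (N + 4) * ln (2 * t) + L"
    have ln2t: "ln (2 * t) > 0" using t2 by simp
    have L: "L \<ge> 0" by (simp add: L_def)
    have M: "M > 0" unfolding M_def using L ln2t by (intro add_pos_nonneg) (auto simp: N_def)
    have err: "36 * (1024 * M / (real N)\<^sup>2) \<le> ln (2 * t) + L"
      using L ln2t by (simp add: M_def N_def power2_eq_square algebra_simps)
    have q0: "critical_square t \<ge> d\<^sup>2" unfolding critical_square_def using dt d by (intro power_mono) auto
    have d2: "d\<^sup>2 > 0" using d by simp
    have f0: "f 0 = of_real (critical_square t)" by (simp add: f_def critical_product_of_real)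
    have qpos: "critical_square t > 0" using q0 d2 by linarith
    have nf0: "norm (f 0) = critical_square t" using qpos by (simp add: f0)
    have hol: "f holomorphic_on ball 0 (real N + 1)"
      unfolding f_def
    proof (rule holomorphic_on_compose_gen[OF _ critical_product_holomorphic, unfolded o_def])
      show "(\<lambda>z. of_real t + z) ` ball 0 (real N + 1) \<subseteq> {z. 0 < Re z}"
      proof safe
        fix z :: complex assume "z \<in> ball 0 (real N + 1)"
        then show "0 < Re (of_real t + z)" using abs_Re_le_cmod[of z] t by auto
      qed
    qed (intro holomorphic_intros)
    have bound: "norm (f z) \<le> norm (f 0) * exp M" if "norm z = real N" for z
    proof -
      have "norm (f z) \<le> K N * (2 * t) ^ (N + 4)"
        unfolding f_def by (rule K(2)) (use that t in \<open>auto simp: N_def\<close>)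
      also have "\<dots> = exp (ln (K N) + real (N + 4) * ln (2 * t))"
      proof -
        have "exp (real (N + 4) * ln (2 * t)) = (2 * t) ^ (N + 4)"
          unfolding exp_of_nat_mult using t2 by simp
        then show ?thesis using K(1)[of N] by (simp only: exp_add exp_ln)
      qed
      also have "\<dots> \<le> exp (ln (d\<^sup>2) + M)"
        unfolding M_def L_def by simp
      also have "\<dots> = d\<^sup>2 * exp M" using d2 by (simp add: exp_add)
      also have "\<dots> \<le> norm (f 0) * exp M" unfolding nf0 using q0 by (intro mult_right_mono) auto
      finally show ?thesis .
    qed
    have zero: "z \<in> \<real> \<and> zeta (Complex (1 / 2) (t + Re z)) = 0" if "norm z \<le> real N / 2" "f z = 0" for z
    proof -
      have "Re (of_real t + z) > 0" using abs_Re_le_cmod[of z] that t by auto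
      from RH_critical_product_zero_real[OF RH _ this] that show ?thesis
        by (auto simp: f_def complex_is_Real_iff)
    qed
    have y: "0 < (6 :: real)" "6 < real N / 8" "0 < real N" "real N < real N + 1" by (auto simp: N_def)
    obtain S where S: "S \<ge> 0" "(\<And>z. norm z \<le> real N / 2 \<Longrightarrow> f z \<noteq> 0) \<Longrightarrow> S = 0"
      "norm (f (\<i> * of_real 6) * f (- (\<i> * of_real 6))) \<le> (norm (f 0))\<^sup>2 * exp (6\<^sup>2 * (S + 1024 * M / (real N)\<^sup>2))"
      "norm (deriv (deriv f) 0 / f 0 - (deriv f 0 / f 0)\<^sup>2 + of_real S) \<le> 1024 * M / (real N)\<^sup>2"
      using real_zeros_growth[OF hol y(3,4) _ M bound _ y(1,2)] zero qpos by (auto simp: f0)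
    define E where "E = 1024 * M / (real N)\<^sup>2"
    have shift: "deriv (\<lambda>z. g (a + z)) z = deriv g (a + z)" for g :: "complex \<Rightarrow> complex" and a z
      by (subst (1 2) deriv_shift_0) (simp add: o_def add.assoc)
    have df: "deriv f = (\<lambda>z. deriv critical_product (of_real t + z))" unfolding f_def by (rule ext, rule shift)
    have D: "deriv (deriv f) 0 / f 0 - (deriv f 0 / f 0)\<^sup>2
        = deriv (deriv critical_product) t / critical_product t - (deriv critical_product t / critical_product t)\<^sup>2"
      unfolding df shift by (simp add: f_def)
    have "(pi powr (- 6) * (t / 2) ^ 6 / 36)\<^sup>2 \<le> norm (f (\<i> * of_real 6) * f (- (\<i> * of_real 6)))"
      using critical_product_imaginary_lower_bound[OF t2(2)] by (simp add: f_def)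
    also have "\<dots> \<le> (critical_square t)\<^sup>2 * exp (36 * (S + E))" using S(3) by (simp add: nf0 E_def)
    also have "\<dots> \<le> (B * t ^ 4)\<^sup>2 * exp (36 * (S + E))"
      using B(2)[OF t2(1)] qpos by (intro mult_right_mono power_mono) auto
    finally have "(pi powr (- 6) * (t / 2) ^ 6 / 36)\<^sup>2 \<le> (B * t ^ 4)\<^sup>2 * exp (36 * (S + E))" .
    moreover have "(pi powr (- 6) * (t / 2) ^ 6 / 36)\<^sup>2 = (B * t ^ 4)\<^sup>2 * (c4 * t ^ 4)"
      using B(1) by (simp add: c4_def power_mult_distrib power_divide flip: power_mult power_add)
    ultimately have "c4 * t ^ 4 \<le> exp (36 * (S + E))" using B(1) t2 by simp
    then have "ln (c4 * t ^ 4) \<le> ln (exp (36 * (S + E)))" using c4 t2 by (subst ln_le_cancel_iff) auto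
    then have "ln (c4 * t ^ 4) \<le> 36 * (S + E)" by simp
    then have low: "36 * S \<ge> 4 * ln t + ln c4 - ln (2 * t) - L"
      using err c4 t2 by (simp add: ln_mult ln_realpow E_def)
    have "Re (deriv (deriv critical_product) t / critical_product t - (deriv critical_product t / critical_product t)\<^sup>2) + S \<le> E"
      using S(4) complex_Re_le_cmod[of "deriv (deriv f) 0 / f 0 - (deriv f 0 / f 0)\<^sup>2 + of_real S"]
      unfolding D E_def by simp
    then have up: "36 * Re (deriv (deriv critical_product) t / critical_product t - (deriv critical_product t / critical_product t)\<^sup>2)
        \<le> - 36 * S + ln (2 * t) + L"
      using err unfolding E_def by linarith
    have "\<exists>x. \<bar>x - t\<bar> \<le> real N / 2 \<and> zeta (Complex (1 / 2) x) = 0" if S0: "S \<noteq> 0"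
    proof -
      obtain z where z: "norm z \<le> real N / 2" "f z = 0" using S(2) S0 by blast
      have "\<bar>t + Re z - t\<bar> \<le> real N / 2" using abs_Re_le_cmod[of z] z by simp
      then show ?thesis using zero[OF z] by blast
    qed
    then show ?thesis using S(1) low up by blast
  qed
  \<comment> \<open>With these constants the lower bound in \<open>main\<close> reads 36 S \<ge> 3
    ln t - C0, so S > 0 as soon as t > exp (C0 / 3). Inserted into the upper bound, which contains +
    ln (2 t), it leaves - 2 ln t.\<close>
  define C0 where "C0 = ln 2 + L - ln c4"
  define T where "T = max (3 * real N + 2) (exp (C0 / 3) + 1)"
  show ?thesis
  proof (rule that[of N T "C0 + ln 2 + L"])
    show "N \<ge> 1" by (simp add: N_def)
    show "T \<ge> 3 * real N + 2" by (simp add: T_def)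
    fix t assume t: "t \<ge> T" and dt: "norm (zeta (Complex (1 / 2) t)) \<ge> d"
    have t1: "t \<ge> 3 * real N + 2" "t > exp (C0 / 3)" using t by (auto simp: T_def)
    have l2: "ln (2 * t) = ln 2 + ln t" using t1 by (simp add: ln_mult)
    obtain S where S: "S \<ge> 0" "S \<noteq> 0 \<longrightarrow> (\<exists>x. \<bar>x - t\<bar> \<le> real N / 2 \<and> zeta (Complex (1 / 2) x) = 0)"
      "36 * S \<ge> 4 * ln t + ln c4 - ln (2 * t) - L"
      "36 * Re (deriv (deriv critical_product) t / critical_product t - (deriv critical_product t / critical_product t)\<^sup>2)
        \<le> - 36 * S + ln (2 * t) + L"
      using main[OF t1(1) dt] by blast
    have "ln t > C0 / 3" using t1 by (metis exp_gt_zero less_trans exp_less_cancel_iff exp_ln)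
    then have "C0 < 3 * ln t" by simp
    then have "S > 0" using S(3) unfolding l2 C0_def by linarith
    then have "S \<noteq> 0" by simp
    with S(2) show "\<exists>x. \<bar>x - t\<bar> \<le> real N / 2 \<and> zeta (Complex (1 / 2) x) = 0" by blast
    show "36 * Re (deriv (deriv critical_product) t / critical_product t - (deriv critical_product t / critical_product t)\<^sup>2)
        \<le> C0 + ln 2 + L - 2 * ln t"
      using S(3,4) unfolding l2 C0_def by linarith
  qed
qed


section \<open>Real derivatives of the squared modulus and its high maxima\<close>

definition critical_square' :: "real \<Rightarrow> real" where
  "critical_square' t = Re (deriv critical_product (of_real t))"

definition critical_square'' :: "real \<Rightarrow> real" where
  "critical_square'' t = Re (deriv (deriv critical_product) (of_real t))"

lemma critical_square_derivatives:
  assumes t: "t > 0"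
  shows "(critical_square has_real_derivative critical_square' t) (at t)"
    "(critical_square' has_real_derivative critical_square'' t) (at t)"
    "isCont critical_square'' t"
    "deriv critical_product (of_real t) = of_real (critical_square' t)"
proof -
  have op: "open {z. Re z > 0}" by (rule open_halfspace_Re_gt)
  have tin: "complex_of_real t \<in> {z. Re z > 0}" using t by simp
  have h1: "deriv critical_product holomorphic_on {z. Re z > 0}"
    by (rule holomorphic_deriv[OF critical_product_holomorphic op])
  have h2: "deriv (deriv critical_product) holomorphic_on {z. Re z > 0}"
    by (rule holomorphic_deriv[OF h1 op])
  note v0 = has_vector_derivative_real_field[OF holomorphic_derivI[OF critical_product_holomorphic op tin], of UNIV]
  note v1 = has_vector_derivative_real_field[OF holomorphic_derivI[OF h1 op tin], of UNIV]
  note v2 = has_vector_derivative_real_field[OF holomorphic_derivI[OF h2 op tin], of UNIV]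
  show "(critical_square has_real_derivative critical_square' t) (at t)"
    using has_field_derivative_Re[OF v0] unfolding critical_product_of_real critical_square'_def by simp
  show "(critical_square' has_real_derivative critical_square'' t) (at t)"
    using has_field_derivative_Re[OF v1] unfolding critical_square'_def[symmetric] critical_square''_def by simp
  show "isCont critical_square'' t"
    using DERIV_isCont[OF has_field_derivative_Re[OF v2]] unfolding critical_square''_def[symmetric] by simp
  have "((\<lambda>x::real. 0::real) has_field_derivative Im (deriv critical_product (of_real t))) (at t)"
    using has_field_derivative_Im[OF v0] unfolding critical_product_of_real by simp
  then have "Im (deriv critical_product (of_real t)) = 0" using DERIV_unique DERIV_const by blast
  then show "deriv critical_product (of_real t) = of_real (critical_square' t)"
    by (simp add: critical_square'_def complex_eq_iff)
qed

lemma critical_square_eq_0_iff: "critical_square t = 0 \<longleftrightarrow> zeta (Complex (1 / 2) t) = 0"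
  by (simp add: critical_square_def)

lemma critical_square_nonneg: "critical_square t \<ge> 0"
  by (simp add: critical_square_def)

lemma continuous_on_critical_square: "continuous_on {0<..} critical_square"
  using critical_square_derivatives(1)
  by (intro continuous_at_imp_continuous_on ballI DERIV_isCont) auto

lemma RH_deep_maximum:
  assumes RH: riemann_hypothesis
  obtains a b t where "X < a" "0 < a" "neighboring_ordinates a b" "a < t" "t < b"
    "critical_square' t = 0" "critical_square'' t < - Y"
proof -
  obtain d where d: "d > 0" "\<And>T. \<exists>t>T. norm (zeta (Complex (1 / 2) t)) \<ge> d"
    using zeta_critical_line_not_tendsto_0 by blast
  obtain N :: nat and T C :: real where NT: "N \<ge> 1" "T \<ge> 3 * real N + 2"
    and zero: "\<And>t. t \<ge> T \<Longrightarrow> norm (zeta (Complex (1 / 2) t)) \<ge> d \<Longrightarrow>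
       \<exists>x. \<bar>x - t\<bar> \<le> real N / 2 \<and> zeta (Complex (1 / 2) x) = 0"
    and conc: "\<And>t. t \<ge> T \<Longrightarrow> norm (zeta (Complex (1 / 2) t)) \<ge> d \<Longrightarrow>
       36 * Re (deriv (deriv critical_product) t / critical_product t - (deriv critical_product t / critical_product t)\<^sup>2)
         \<le> C - 2 * ln t"
    using RH_log_concave[OF RH d(1)] by blast
  \<comment> \<open>Three requirements on the height: beyond \<open>X\<close>, within the range of
    \<open>RH_log_concave\<close>, and so large that 2 ln t reaches C + 36 (|Y| + 1) / d^2.\<close>
  define X' where "X' = Max {X, T, exp ((C + 36 * ((\<bar>Y\<bar> + 1) / d\<^sup>2)) / 2)}"
  have X': "X' \<ge> X" "X' \<ge> T" "X' \<ge> exp ((C + 36 * ((\<bar>Y\<bar> + 1) / d\<^sup>2)) / 2)" by (auto simp: X'_def)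
  have X'0: "X' > 0" using X'(2) NT by linarith
  \<comment> \<open>Zeros are found near the large values at \<open>t1\<close> and
    \<open>t3\<close>, and they enclose the large value at \<open>t2\<close>. The margin
    \<open>N\<close> against the search radius N / 2 keeps the points in order.\<close>
  obtain t1 where t1: "t1 > X' + real N" "norm (zeta (Complex (1 / 2) t1)) \<ge> d" using d(2) by blast
  obtain g1 where g1: "\<bar>g1 - t1\<bar> \<le> real N / 2" "zeta (Complex (1 / 2) g1) = 0"
    using zero[OF _ t1(2)] t1(1) X' by auto
  have g1X: "g1 > X'" using g1(1) t1(1) unfolding abs_le_iff by linarith
  obtain t2 where t2: "t2 > g1" "norm (zeta (Complex (1 / 2) t2)) \<ge> d" using d(2) by blast
  obtain t3 where t3: "t3 > t2 + real N" "norm (zeta (Complex (1 / 2) t3)) \<ge> d" using d(2) by blast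
  obtain g3 where g3: "\<bar>g3 - t3\<bar> \<le> real N / 2" "zeta (Complex (1 / 2) g3) = 0"
    using zero[OF _ t3(2)] t3(1) t2 g1X X' by auto
  have g3t: "g3 > t2" using g3(1) t3(1) unfolding abs_le_iff by linarith
  have cont: "continuous_on {u..v} critical_square" if "u > 0" for u v
    by (rule continuous_on_subset[OF continuous_on_critical_square]) (use that in auto)
  have comp: "compact {x \<in> {u..v}. critical_square x = 0}" if "u > 0" for u v
  proof -
    have "closed {x \<in> {u..v}. critical_square x = 0}"
      by (rule continuous_closed_preimage_constant[OF cont[OF that] closed_atLeastAtMost])
    then have "compact ({u..v} \<inter> {x \<in> {u..v}. critical_square x = 0})" by (rule compact_Int_closed[OF compact_Icc])
    moreover have "{u..v} \<inter> {x \<in> {u..v}. critical_square x = 0} = {x \<in> {u..v}. critical_square x = 0}" by blast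
    ultimately show ?thesis by (simp only:)
  qed
  have q2: "critical_square t2 \<ge> d\<^sup>2" unfolding critical_square_def using t2(2) d(1) by (intro power_mono) auto
  have d2: "d\<^sup>2 > 0" using d(1) by simp
  have "g1 \<in> {x \<in> {g1..t2}. critical_square x = 0}" using g1 t2 by (simp add: critical_square_eq_0_iff)
  then obtain a where a: "a \<in> {g1..t2}" "critical_square a = 0"
    and amax: "\<And>x. x \<in> {g1..t2} \<Longrightarrow> critical_square x = 0 \<Longrightarrow> x \<le> a"
    using compact_attains_sup[OF comp[of g1 t2]] g1X X'0 by force
  have "g3 \<in> {x \<in> {t2..g3}. critical_square x = 0}" using g3 g3t by (simp add: critical_square_eq_0_iff)
  then obtain b where b: "b \<in> {t2..g3}" "critical_square b = 0"
    and bmin: "\<And>x. x \<in> {t2..g3} \<Longrightarrow> critical_square x = 0 \<Longrightarrow> b \<le> x"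
    using compact_attains_inf[OF comp[of t2 g3]] g1X X'0 t2 by force
  have ab: "a < t2" "t2 < b" using a b q2 d2 by (auto simp: less_le)
  have aX: "a > X'" using a g1X by simp
  have nbr: "neighboring_ordinates a b"
    unfolding neighboring_ordinates_def
  proof (intro conjI notI)
    assume "\<exists>x>a. x < b \<and> zeta (Complex (1 / 2) x) = 0"
    then obtain x where x: "a < x" "x < b" "critical_square x = 0" by (auto simp: critical_square_eq_0_iff)
    show False
    proof (cases "x \<le> t2")
      case True
      then show False using amax[of x] x a by auto
    next
      case False
      then show False using bmin[of x] x b by auto
    qed
  qed (use a b ab in \<open>auto simp: critical_square_eq_0_iff\<close>)
  obtain t where t: "t \<in> {a..b}" "\<And>x. x \<in> {a..b} \<Longrightarrow> critical_square x \<le> critical_square t"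
    using continuous_attains_sup[OF compact_Icc _ cont[of a b]] ab aX X'0 by auto
  have qt: "critical_square t \<ge> d\<^sup>2" using t(2)[of t2] q2 ab by auto
  then have tab: "a < t" "t < b" using t(1) a b d2 by (auto simp: less_le)
  have t0: "t > 0" using tab aX X'0 by simp
  have q1: "critical_square' t = 0"
  proof (rule DERIV_local_max[OF critical_square_derivatives(1)[OF t0]])
    show "0 < min (t - a) (b - t)" using tab by simp
    show "\<forall>y. \<bar>t - y\<bar> < min (t - a) (b - t) \<longrightarrow> critical_square y \<le> critical_square t"
      by (auto intro!: t(2))
  qed
  have "norm (zeta (Complex (1 / 2) t)) \<ge> d"
    using qt power2_le_imp_le[of d "norm (zeta (Complex (1 / 2) t))"] by (simp add: critical_square_def)
  moreover have "t \<ge> T" using tab aX X' by simp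
  ultimately have "36 * Re (deriv (deriv critical_product) t / critical_product t - (deriv critical_product t / critical_product t)\<^sup>2)
         \<le> C - 2 * ln t" by (intro conc)
  \<comment> \<open>The first derivative vanishes at the maximum, so the second logarithmic
    derivative reduces to a quotient. Its denominator is at least d^2, which makes the numerator
    itself very negative.\<close>
  then have "36 * (critical_square'' t / critical_square t) \<le> C - 2 * ln t"
    using q1 by (simp add: critical_square_derivatives(4)[OF t0] critical_product_of_real critical_square''_def)
  moreover have "2 * ln t \<ge> C + 36 * ((\<bar>Y\<bar> + 1) / d\<^sup>2)"
  proof -
    have "exp ((C + 36 * ((\<bar>Y\<bar> + 1) / d\<^sup>2)) / 2) \<le> t" using tab aX X'(3) by linarith
    then have "(C + 36 * ((\<bar>Y\<bar> + 1) / d\<^sup>2)) / 2 \<le> ln t" using t0 by (simp only: ln_ge_iff)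
    moreover have "x \<le> 2 * y" if "x / 2 \<le> y" for x y :: real using that by simp
    ultimately show ?thesis by blast
  qed
  ultimately have "critical_square'' t / critical_square t \<le> - ((\<bar>Y\<bar> + 1) / d\<^sup>2)" by linarith
  then have "critical_square'' t \<le> - ((\<bar>Y\<bar> + 1) / d\<^sup>2) * critical_square t"
    using qt d2 by (simp only: pos_divide_le_eq[of "critical_square t"])
  also have "\<dots> \<le> - ((\<bar>Y\<bar> + 1) / d\<^sup>2) * d\<^sup>2" using qt d2 by (intro mult_left_mono_neg) auto
  also have "\<dots> = - (\<bar>Y\<bar> + 1)" using d2 by simp
  finally have "critical_square'' t < - Y" by linarith
  then show ?thesis using that[of a b t] aX X'(1) X'0 nbr tab q1 by linarith
qed

text \<open>Multiplication by |Gamma (1/4 + i t / 2)| turns exp (i theta) into pi^(-i t / 2) Gamma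
  (1/4 + i t / 2), and the functional equation at s = 1/2 + i t says that the resulting multiple of
  zeta(s) equals its conjugate.\<close>

lemma hardy_Z_real: "hardy_Z t \<in> \<real>"
proof (cases "t = 0")
  case True
  have "Complex (1 / 2) 0 = cnj (Complex (1 / 2) 0)" by (simp add: complex_eq_iff)
  then have "cnj (zeta (Complex (1 / 2) 0)) = zeta (Complex (1 / 2) 0)" by (metis zeta_cnj)
  then show ?thesis unfolding hardy_Z_def True rs_theta_0 by (simp add: Reals_cnj_iff)
next
  case False
  define g where "g = Gamma (Complex (1 / 4) (t / 2))"
  define s where "s = Complex (1 / 2) t"
  define P where "P = exp (- (\<i> * of_real (t / 2 * ln pi)))"
  have gnn: "Complex (1 / 4) (t / 2) \<notin> \<int>\<^sub>\<le>\<^sub>0" by (auto elim!: nonpos_Ints_cases simp: complex_eq_iff)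
  then have g0: "g \<noteq> 0" by (simp add: g_def Gamma_eq_zero_iff)
  have polar: "g = of_real (norm g) * exp (\<i> * of_real (Im (ln_Gamma (Complex (1 / 4) (t / 2)))))"
  proof -
    have "exp (of_real (Re w) + \<i> * of_real (Im w)) = exp w" for w by (simp flip: complex_eq)
    then show ?thesis
      unfolding g_def exp_rs_theta[symmetric] norm_exp_eq_Re exp_of_real[symmetric] exp_add[symmetric] by simp
  qed
  have "of_real (norm g) * exp (\<i> * of_real (rs_theta t)) = g * P"
    by (subst polar) (simp add: rs_theta_def P_def mult.assoc algebra_simps flip: exp_add)
  then have Z: "of_real (norm g) * hardy_Z t = P * g * zeta s"
    by (simp add: hardy_Z_def s_def mult_ac)
  have "s \<noteq> 0" "s \<noteq> 1" by (auto simp: s_def complex_eq_iff)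
  from zeta_functional_equation[OF this]
  have "zeta s * rGamma ((1 - s) / 2) = of_real pi powr (s - 1 / 2) * rGamma (s / 2) * zeta (1 - s)" .
  moreover have "rGamma (s / 2) = 1 / g" "rGamma ((1 - s) / 2) = 1 / cnj g"
  proof -
    have "s / 2 = Complex (1 / 4) (t / 2)" "(1 - s) / 2 = cnj (Complex (1 / 4) (t / 2))"
      by (simp_all add: s_def complex_eq_iff)
    then show "rGamma (s / 2) = 1 / g" "rGamma ((1 - s) / 2) = 1 / cnj g"
      by (simp_all add: g_def Gamma_def cnj_rGamma[symmetric] inverse_eq_divide)
  qed
  moreover have "1 - s = cnj s" by (simp add: s_def complex_eq_iff)
  moreover have "of_real pi powr (s - 1 / 2) = cnj P * cnj P"
  proof -
    have "s - 1 / 2 = \<i> * of_real t" by (simp add: s_def complex_eq_iff)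
    then show ?thesis
      by (simp add: powr_def P_def exp_cnj Ln_of_real mult_ac flip: exp_add)
  qed
  ultimately have "zeta s / cnj g = cnj P * cnj P / g * cnj (zeta s)" by (simp add: zeta_cnj)
  then have "g * zeta s = cnj P * cnj P * cnj g * cnj (zeta s)" using g0 by (simp add: field_simps)
  moreover have "P * cnj P = 1"
    by (simp add: P_def exp_cnj flip: exp_add)
  ultimately have "P * g * zeta s = cnj (P * g * zeta s)"
    by (metis (no_types, lifting) complex_cnj_mult mult.assoc mult_1)
  then have "of_real (norm g) * hardy_Z t \<in> \<real>" unfolding Z by (simp add: Reals_cnj_iff)
  moreover have "hardy_Z t = (of_real (norm g) * hardy_Z t) / of_real (norm g)" using g0 by simp
  ultimately show ?thesis by (metis Reals_divide Reals_of_real)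
qed

section \<open>The radius\<close>

lemma radius_eq_sqrt: "radius = (\<lambda>t. sqrt (critical_square t))"
  by (rule ext) (simp add: radius_def hardy_Z_def critical_square_def norm_mult)

lemma radius_deriv:
  assumes "t > 0" "critical_square t > 0"
  shows "(radius has_real_derivative critical_square' t / (2 * sqrt (critical_square t))) (at t)"
  unfolding radius_eq_sqrt using assms
  by (auto intro!: derivative_eq_intros critical_square_derivatives(1) simp: divide_simps)

lemma eventually_critical_square_pos:
  assumes "t > 0" "critical_square t > 0"
  shows "\<forall>\<^sub>F x in nhds t. x > 0 \<and> critical_square x > 0"
proof (rule eventually_conj)
  show "\<forall>\<^sub>F x in nhds t. x > 0" using eventually_nhds_in_open[of "{0<..}" t] assms by simp
  have "(critical_square \<longlongrightarrow> critical_square t) (nhds t)"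
    using DERIV_isCont[OF critical_square_derivatives(1)[OF assms(1)]] by (simp add: isCont_def tendsto_at_iff_tendsto_nhds)
  from order_tendstoD(1)[OF this assms(2)] show "\<forall>\<^sub>F x in nhds t. critical_square x > 0" .
qed

lemma radius_second_deriv:
  assumes t: "t > 0" "critical_square t > 0"
  shows "deriv (deriv radius) t = critical_square'' t / (2 * sqrt (critical_square t))
     - (critical_square' t)\<^sup>2 / (4 * critical_square t * sqrt (critical_square t))"
proof (rule DERIV_imp_deriv)
  define r where "r = sqrt (critical_square t)"
  have r: "r > 0" "critical_square t = r * r" using t by (auto simp: r_def)
  have "((\<lambda>x. critical_square' x / (2 * sqrt (critical_square x))) has_real_derivative
      (critical_square'' t * (2 * r) - critical_square' t * (2 * (critical_square' t / (2 * r)))) / (2 * r * (2 * r))) (at t)"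
    using t r(1) unfolding r_def
    by (intro DERIV_divide critical_square_derivatives(2) DERIV_cmult radius_deriv[unfolded radius_eq_sqrt]) auto
  moreover have "(critical_square'' t * (2 * r) - critical_square' t * (2 * (critical_square' t / (2 * r)))) / (2 * r * (2 * r))
     = critical_square'' t / (2 * r) - (critical_square' t)\<^sup>2 / (4 * (r * r) * r)"
    using r(1) by (simp add: divide_simps power2_eq_square)
  ultimately have D: "((\<lambda>x. critical_square' x / (2 * sqrt (critical_square x))) has_real_derivative
      critical_square'' t / (2 * r) - (critical_square' t)\<^sup>2 / (4 * (r * r) * r)) (at t)" by (simp only:)
  have ev: "\<forall>\<^sub>F x in nhds t. deriv radius x = critical_square' x / (2 * sqrt (critical_square x))"
    using eventually_critical_square_pos[OF t] by eventually_elim (auto intro!: DERIV_imp_deriv radius_deriv)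
  show "(deriv radius has_real_derivative critical_square'' t / (2 * sqrt (critical_square t))
     - (critical_square' t)\<^sup>2 / (4 * critical_square t * sqrt (critical_square t))) (at t)"
    unfolding DERIV_cong_ev[OF refl ev refl] r_def[symmetric]
    unfolding r(2) by (rule D)
qed

lemma continuous_on_hardy_Z: "continuous_on A hardy_Z"
proof -
  have "continuous_on A (\<lambda>t. zeta (Complex (1 / 2) t))"
  proof (rule continuous_on_compose2[OF holomorphic_on_imp_continuous_on[OF holomorphic_zeta]])
    show "continuous_on A (\<lambda>t. Complex (1 / 2) t)" unfolding Complex_eq by (intro continuous_intros)
  qed (auto simp: complex_eq_iff)
  then show ?thesis unfolding hardy_Z_def by (intro continuous_intros continuous_on_rs_theta)
qed

text \<open>A real continuous function keeps its sign near a point where it does not vanish, so Z is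
  locally plus or minus \<open>radius\<close>. This avoids differentiating the theta
  function.\<close>

lemma hardy_Z_derivative_0:
  assumes t: "t > 0" "critical_square t > 0" and q': "critical_square' t = 0"
  shows "(hardy_Z has_vector_derivative 0) (at t)"
proof -
  define z where "z = (\<lambda>x. Re (hardy_Z x))"
  have Z: "hardy_Z x = of_real (z x)" for x using hardy_Z_real[of x] by (simp add: z_def)
  have rad: "\<bar>z x\<bar> = radius x" for x by (simp add: radius_def Z)
  have "radius t > 0" using t(2) by (simp add: radius_eq_sqrt)
  then have zt: "z t \<noteq> 0" using rad[of t] by auto
  have "isCont z t"
    using continuous_on_Re[OF continuous_on_hardy_Z[of UNIV]] unfolding z_def
    by (simp add: continuous_on_eq_continuous_at)
  then have "((\<lambda>x. z x * z t) \<longlongrightarrow> z t * z t) (nhds t)"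
    by (intro tendsto_intros) (simp add: isCont_def tendsto_at_iff_tendsto_nhds)
  then have "\<forall>\<^sub>F x in nhds t. z x * z t > 0" by (rule order_tendstoD) (use zt in \<open>auto simp: zero_less_mult_iff\<close>)
  then have ev: "\<forall>\<^sub>F x in nhds t. z x = sgn (z t) * radius x"
    by (rule eventually_mono) (auto simp: rad[symmetric] zero_less_mult_iff)
  have "(radius has_real_derivative 0) (at t)" using radius_deriv[OF t] q' by simp
  from DERIV_cmult[OF this, of "sgn (z t)"] have "(z has_real_derivative 0) (at t)"
    by (subst DERIV_cong_ev[OF refl ev refl]) simp
  then have "(z has_vector_derivative 0) (at t)" by (simp add: has_real_derivative_iff_has_vector_derivative)
  from bounded_linear.has_vector_derivative[OF bounded_linear_of_real this]
  have "((\<lambda>x. complex_of_real (z x)) has_vector_derivative 0) (at t)" by simp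
  then show ?thesis by (simp only: Z[symmetric])
qed

theorem mainTheorem9:
  fixes \<kappa> c k :: real and \<rho> p :: "real \<Rightarrow> real"
  assumes RH: "riemann_hypothesis"
    and kappa: "\<kappa> > 0" and c: "c > 0" and k: "k = 1"
    and friedmann_density: "\<And>t. t > 0 \<Longrightarrow> hardy_Z t \<noteq> 0 \<Longrightarrow>
          \<kappa> * c\<^sup>2 * \<rho> t = 3 / (radius t)\<^sup>2 * (k * c\<^sup>2 + (deriv radius t)\<^sup>2)"
    and friedmann_pressure: "\<And>t. t > 0 \<Longrightarrow> hardy_Z t \<noteq> 0 \<Longrightarrow>
          \<kappa> * p t = - (2 * deriv (deriv radius) t / radius t)
                   - (deriv radius t)\<^sup>2 / (radius t)\<^sup>2 - k * c\<^sup>2 / (radius t)\<^sup>2"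
  shows "\<exists>(t0 :: nat \<Rightarrow> real) (\<delta> :: real \<Rightarrow> real).
           filterlim t0 at_top sequentially \<and>
           (\<forall>n. t0 n > 0 \<and>
                (hardy_Z has_vector_derivative 0) (at (t0 n)) \<and>
                \<delta> (t0 n) > 0 \<and>
                (\<exists>\<gamma>' \<gamma>''. 0 < \<gamma>' \<and> neighboring_ordinates \<gamma>' \<gamma>'' \<and>
                   \<gamma>' < t0 n \<and> t0 n < \<gamma>'' \<and>
                   \<gamma>' < t0 n - \<delta> (t0 n) \<and>
                   t0 n - \<delta> (t0 n) < t0 n + \<delta> (t0 n) \<and>
                   t0 n + \<delta> (t0 n) < \<gamma>'') \<and>
                (\<forall>t\<in>{t0 n - \<delta> (t0 n)..t0 n + \<delta> (t0 n)}. \<rho> t > 0 \<and> p t \<ge> 0))"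
proof -
  define good where "good = (\<lambda>t d. d > 0 \<and>
                (\<exists>\<gamma>' \<gamma>''. 0 < \<gamma>' \<and> neighboring_ordinates \<gamma>' \<gamma>'' \<and>
                   \<gamma>' < t \<and> t < \<gamma>'' \<and> \<gamma>' < t - d \<and> t - d < t + d \<and> t + d < \<gamma>'') \<and>
                (\<forall>x\<in>{t - d..t + d}. \<rho> x > 0 \<and> p x \<ge> 0))"
  have hardy_nz: "hardy_Z x \<noteq> 0" if "critical_square x > 0" for x
    using that by (auto simp: hardy_Z_def critical_square_def)
  have density: "\<rho> x > 0" if x: "x > 0" "critical_square x > 0" for x
  proof -
    have "radius x > 0" using x by (simp add: radius_eq_sqrt)
    then have "\<kappa> * c\<^sup>2 * \<rho> x > 0"
      using friedmann_density[OF x(1) hardy_nz[OF x(2)]] k c by (simp add: add_pos_nonneg)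
    moreover have "\<kappa> * c\<^sup>2 > 0" using kappa c by simp
    ultimately show ?thesis by (rule zero_less_mult_pos)
  qed
  \<comment> \<open>Away from the maximum the square of \<open>critical_square'\<close> contributes
    with the favourable sign, so only the strict bound on \<open>critical_square''\<close> has to
    persist in a neighbourhood.\<close>
  have pressure: "p x \<ge> 0" if x: "x > 0" "critical_square x > 0" "critical_square'' x < - c\<^sup>2" for x
  proof -
    define r where "r = sqrt (critical_square x)"
    have r: "r > 0" "critical_square x = r * r" using x by (auto simp: r_def)
    have rr: "radius x = r" by (simp add: radius_eq_sqrt r_def)
    have d1: "deriv radius x = critical_square' x / (2 * r)"
      using DERIV_imp_deriv[OF radius_deriv[OF x(1,2)]] by (simp add: r_def)
    have d2: "deriv (deriv radius) x = critical_square'' x / (2 * r) - (critical_square' x)\<^sup>2 / (4 * (r * r) * r)"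
      unfolding radius_second_deriv[OF x(1,2)] r_def[symmetric] unfolding r(2) ..
    have "\<kappa> * p x = (- critical_square'' x - c\<^sup>2 + (critical_square' x)\<^sup>2 / (4 * (r * r))) / (r * r)"
      unfolding friedmann_pressure[OF x(1) hardy_nz[OF x(2)]] rr d1 d2 k
      using r(1) by (simp add: divide_simps power2_eq_square) (simp add: algebra_simps)
    also have "\<dots> \<ge> 0" using x(3) r(1) by (intro divide_nonneg_pos add_nonneg_nonneg) auto
    finally show ?thesis using kappa by (simp add: zero_le_mult_iff)
  qed
  have ex: "\<exists>t. t > real n \<and> (hardy_Z has_vector_derivative 0) (at t) \<and> (\<exists>d. good t d)" for n
  proof -
    obtain a b t where ab: "real n < a" "0 < a" "neighboring_ordinates a b" "a < t" "t < b"
      and q: "critical_square' t = 0" "critical_square'' t < - c\<^sup>2"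
      using RH_deep_maximum[OF RH] by blast
    have pos: "critical_square x > 0" if "a < x" "x < b" for x
      using ab(3) that critical_square_nonneg[of x] critical_square_eq_0_iff[of x]
      unfolding neighboring_ordinates_def by (metis less_le)
    have t0: "t > 0" using ab by simp
    have "(critical_square'' \<longlongrightarrow> critical_square'' t) (nhds t)"
      using critical_square_derivatives(3)[OF t0] by (simp add: isCont_def tendsto_at_iff_tendsto_nhds)
    from order_tendstoD(2)[OF this q(2)]
    obtain e where e: "e > 0" "\<And>x. dist x t < e \<Longrightarrow> critical_square'' x < - c\<^sup>2"
      unfolding eventually_nhds_metric by blast
    \<comment> \<open>Halving keeps all inequalities strict on the closed interval.\<close>
    define d where "d = min e (min (t - a) (b - t)) / 2"
    have d: "d > 0" "d < e" "d < t - a" "d < b - t" using e ab by (auto simp: d_def)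
    have "\<exists>\<gamma>' \<gamma>''. 0 < \<gamma>' \<and> neighboring_ordinates \<gamma>' \<gamma>'' \<and>
        \<gamma>' < t \<and> t < \<gamma>'' \<and> \<gamma>' < t - d \<and> t - d < t + d \<and> t + d < \<gamma>''"
      by (rule exI[of _ a], rule exI[of _ b]) (use d ab in auto)
    moreover have "\<rho> x > 0 \<and> p x \<ge> 0" if x: "x \<in> {t - d..t + d}" for x
    proof
      have x': "x > 0" "critical_square x > 0" using x d ab by (auto intro!: pos)
      then show "\<rho> x > 0" by (rule density)
      have "dist x t < e" using x d by (auto simp: dist_real_def)
      then show "p x \<ge> 0" using pressure[OF x'] e(2) by blast
    qed
    ultimately have "good t d" unfolding good_def using d(1) by blast
    moreover have "(hardy_Z has_vector_derivative 0) (at t)"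
      by (rule hardy_Z_derivative_0[OF t0 pos[OF ab(4,5)] q(1)])
    ultimately show ?thesis using ab by (intro exI[of _ t]) auto
  qed
  then obtain t0 where t0: "\<And>n. t0 n > real n \<and> (hardy_Z has_vector_derivative 0) (at (t0 n)) \<and> (\<exists>d. good (t0 n) d)"
    by metis
  \<comment> \<open>The width is a function of the point, not of the index, and values of
    \<open>t0\<close> might repeat; choosing it from a predicate on the point makes it well
    defined.\<close>
  define \<delta> where "\<delta> = (\<lambda>t. SOME d. good t d)"
  have good: "good (t0 n) (\<delta> (t0 n))" for n
    unfolding \<delta>_def using t0[of n] by (blast intro: someI_ex)
  have lim: "filterlim t0 at_top sequentially"
    by (rule filterlim_at_top_mono[OF filterlim_real_sequentially]) (use t0 in \<open>auto intro: always_eventually less_imp_le\<close>)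
  have pos: "t0 n > 0" for n using t0[of n] by (meson le_less_trans of_nat_0_le_iff)
  show ?thesis
    using lim pos t0 good unfolding good_def by (intro exI[of _ t0] exI[of _ \<delta>]) blast
qed

end
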